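(* Under the standing setup below with $r=1$, write $\theta=\theta_1$ and assume $D'_{\mu_X}(b^+)=-\infty$. Let $\rho=D^{-1}_{\mu_X}(1/\theta^2)$ when $\theta^2>1/D_{\mu_X}(b^+)$. Then as $n,m\to\infty$ with $n/m\to c$, almost surely $$w^{\rm opt}_1\to\begin{cases}\dfrac{-2}{\theta^2D'_{\mu_X}(\rho)} & \text{if }\theta^2>1/D_{\mu_X}(b^+),\\[2mm] 0&\text{otherwise,}\end{cases}$$ $$\mathrm{MSE}(w^{\rm opt})\to\begin{cases}\theta^2-\dfrac{4}{(\theta^2D'_{\mu_X}(\rho))^2}&\text{if }\theta^2>1/D_{\mu_X}(b^+),\\[2mm] \theta^2&\text{otherwise,}\end{cases}$$ $$\mathrm{MSE}(w^{\rm eym})\to\begin{cases}\theta^2+\rho^2+\dfrac{4\rho}{\theta^2D'_{\mu_X}(\rho)}&\text{if }\theta^2>1/D_{\mu_X}(b^+),\\[2mm] \theta^2+b^2&\text{otherwise.}\end{cases}$$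
   Context: Standing setup. Let $\mathbb{K}\in\{\mathbb{R},\mathbb{C}\}$ and $^H$ denote conjugate transpose. For each $n$ let $m=m(n)\ge n$ with $n/m\to c$ as $n\to\infty$. Let $X_n$ be an $n\times m$ random matrix over $\mathbb{K}$ with singular values $\sigma_1(X_n)\ge\cdots\ge\sigma_n(X_n)$, and assume its empirical singular value distribution $\mu_{X_n}=\frac1n\sum_{i=1}^n\delta_{\sigma_i(X_n)}$ converges almost surely weakly to a deterministic compactly supported probability measure $\mu_X$ supported on $[a,b]$ (with $b$ the right endpoint of the support), and that $\sigma_1(X_n)\to b$ almost surely. Assume $X_n$ is bi-unitarily (resp. bi-orthogonally) invariant: its distribution is invariant under multiplication on the left and on the right by unitary (resp. orthogonal) matrices. Fix $r\ge1$ and deterministic reals $\theta_1>\cdots>\theta_r>0$ independent of $n$; let $S_n=\sum_{i=1}^r\theta_iu_iv_i^H$ be a deterministic $n\times m$ matrix with $u_1,\dots,u_r$ orthonormal in $\mathbb{K}^n$ and $v_1,\dots,v_r$ orthonormal in $\mathbb{K}^m$, with $X_n$ independent of $S_n$. Observe $\widetilde X_n=S_n+X_n$, with SVD $\widetilde X_n=\sum_{i=1}^{q}\hat\sigma_i\hat u_i\hat v_i^H$, $q=\min(n,m)$, $\hat\sigma_1\ge\hat\sigma_2\ge\cdots$. For a probability measure $\mu$ let $\phi_\mu(z)=\int\frac{z}{z^2-t^2}\,d\mu(t)$. The $D$-transform of $\mu_X$ is $D_{\mu_X}(z)=\phi_{\mu_X}(z)\cdot\big[c\,\phi_{\mu_X}(z)+\frac{1-c}{z}\big]$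 for $z>b$; $D_{\mu_X}(b^+)=\lim_{z\downarrow b}D_{\mu_X}(z)$, $D'_{\mu_X}$ is its derivative, $D'_{\mu_X}(b^+)=\lim_{z\downarrow b}D'_{\mu_X}(z)$, and $D^{-1}_{\mu_X}$ is its functional inverse on $(b,\infty)$. For $w\in\mathbb{R}^l$, $\mathrm{MSE}(w)=\big\|S_n-\sum_{i=1}^l w_i\hat u_i\hat v_i^H\big\|_F^2$. The EYM weights are $w^{\rm eym}_i=\hat\sigma_i$, $i=1,\dots,r$, and $w^{\rm opt}=\arg\min_{w\in\mathbb{R}^r_+}\mathrm{MSE}(w)$. *)

theory Defs
  imports "HOL-Probability.Probability" "Jordan_Normal_Form.Matrix"
begin

text \<open>Matrices over K are complex JNF matrices; the real case (K = R) is modelled by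
  the flag realK, which forces real entries and orthogonal (instead of unitary) invariance.\<close>

definition cinner :: "complex vec \<Rightarrow> complex vec \<Rightarrow> complex" where
  "cinner x y = (\<Sum>i<dim_vec x. x $ i * cnj (y $ i))"

definition real_vec :: "complex vec \<Rightarrow> bool" where
  "real_vec x \<longleftrightarrow> (\<forall>i<dim_vec x. x $ i \<in> \<real>)"

definition real_mat :: "complex mat \<Rightarrow> bool" where
  "real_mat A \<longleftrightarrow> (\<forall>i<dim_row A. \<forall>j<dim_col A. A $$ (i,j) \<in> \<real>)"

definition adjoint_mat :: "complex mat \<Rightarrow> complex mat" where
  "adjoint_mat A = mat (dim_col A) (dim_row A) (\<lambda>(i,j). cnj (A $$ (j,i)))"

definition unitary_K :: "bool \<Rightarrow> nat \<Rightarrow> complex mat \<Rightarrow> bool" where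
  "unitary_K realK d U \<longleftrightarrow> U \<in> carrier_mat d d \<and> U * adjoint_mat U = 1\<^sub>m d
      \<and> (realK \<longrightarrow> real_mat U)"

definition outer :: "complex vec \<Rightarrow> complex vec \<Rightarrow> complex mat" where
  "outer x y = mat (dim_vec x) (dim_vec y) (\<lambda>(i,j). x $ i * cnj (y $ j))"

definition orthonormal_fam :: "nat \<Rightarrow> nat \<Rightarrow> (nat \<Rightarrow> complex vec) \<Rightarrow> bool" where
  "orthonormal_fam d k x \<longleftrightarrow> (\<forall>i<k. x i \<in> carrier_vec d)
      \<and> (\<forall>i<k. \<forall>j<k. cinner (x i) (x j) = (if i = j then 1 else 0))"

definition is_svd :: "bool \<Rightarrow> complex mat \<Rightarrow> (nat \<Rightarrow> real) \<Rightarrow> (nat \<Rightarrow> complex vec)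
    \<Rightarrow> (nat \<Rightarrow> complex vec) \<Rightarrow> bool" where
  "is_svd realK A s x y \<longleftrightarrow>
     (let q = min (dim_row A) (dim_col A) in
       (\<forall>i<q. 0 \<le> s i) \<and> (\<forall>i j. i \<le> j \<and> j < q \<longrightarrow> s j \<le> s i)
     \<and> orthonormal_fam (dim_row A) q x \<and> orthonormal_fam (dim_col A) q y
     \<and> (realK \<longrightarrow> (\<forall>i<q. real_vec (x i) \<and> real_vec (y i)))
     \<and> (\<forall>i<dim_row A. \<forall>j<dim_col A.
          A $$ (i,j) = (\<Sum>k<q. complex_of_real (s k) * x k $ i * cnj (y k $ j))))"

definition sing_vals :: "complex mat \<Rightarrow> nat \<Rightarrow> real" where
  "sing_vals A = (THE s. (\<forall>i\<ge>min (dim_row A) (dim_col A). s i = 0)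
                       \<and> (\<exists>x y. is_svd False A s x y))"

definition emp_sv :: "complex mat \<Rightarrow> real measure" where
  "emp_sv A = measure_pmf (pmf_of_multiset (mset (map (sing_vals A) [0..<dim_row A])))"

definition fro_sq :: "complex mat \<Rightarrow> real" where
  "fro_sq A = (\<Sum>i<dim_row A. \<Sum>j<dim_col A. (cmod (A $$ (i,j)))\<^sup>2)"

definition mse1 :: "complex mat \<Rightarrow> complex vec \<Rightarrow> complex vec \<Rightarrow> real \<Rightarrow> real" where
  "mse1 S x y w = fro_sq (S - complex_of_real w \<cdot>\<^sub>m outer x y)"

definition wopt1 :: "complex mat \<Rightarrow> complex vec \<Rightarrow> complex vec \<Rightarrow> real" where
  "wopt1 S x y = (ARG_MIN (mse1 S x y) w. 0 \<le> w)"

definition phi_tr :: "real measure \<Rightarrow> real \<Rightarrow> real" where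
  "phi_tr \<mu> z = (\<integral>t. z / (z\<^sup>2 - t\<^sup>2) \<partial>\<mu>)"

definition D_tr :: "real \<Rightarrow> real measure \<Rightarrow> real \<Rightarrow> real" where
  "D_tr c \<mu> z = phi_tr \<mu> z * (c * phi_tr \<mu> z + (1 - c) / z)"

text \<open>D(b+) as an extended real (it may be +infinity).\<close>
definition D_at_b :: "real \<Rightarrow> real measure \<Rightarrow> real \<Rightarrow> ereal" where
  "D_at_b c \<mu> b = Lim (at_right b) (\<lambda>z. ereal (D_tr c \<mu> z))"

definition D_inv :: "real \<Rightarrow> real measure \<Rightarrow> real \<Rightarrow> real \<Rightarrow> real" where
  "D_inv c \<mu> b y = (THE z. b < z \<and> D_tr c \<mu> z = y)"

end

theory Submission
  imports Defs "Jordan_Normal_Form.Determinant"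
begin

text \<open>A left-invariant matrix cannot distinguish a fixed unit vector from a normalised random
  sign vector, because a generalised Householder reflection carries one into the other. Fourth
  moments of sign sums and sign chaoses therefore show, by Borel--Cantelli, that almost surely
  \<open>u\<^sup>H (X X\<^sup>H)\<^sup>k u\<close> and \<open>v\<^sup>H (X\<^sup>H X)\<^sup>k v\<close> converge to the even moments of \<open>\<mu>\<^sub>X\<close> (the latter weighted
  by \<open>c\<close>), while \<open>u\<^sup>H (X X\<^sup>H)\<^sup>k X v\<close> tends to zero. All further arguments are deterministic.

  Let \<open>g \<theta>\<close> be the largest singular value of \<open>X + \<theta> u v\<^sup>H\<close>. Expanding the singular vector equations
  in a Neumann series bounds \<open>g \<theta>\<close> from above by any \<open>z > b\<close> with \<open>\<theta>\<^sup>2 D z < 1\<close>, and trial vectors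
  given by truncated Neumann series bound it from below by any \<open>z > b\<close> with \<open>\<theta>\<^sup>2 D z > 1\<close>; below the
  threshold the lower bound \<open>b\<close> follows from convexity in \<open>\<theta>\<close>. Hence \<open>g \<theta>\<close> converges for every
  positive \<open>\<theta>\<close>. The product of the overlaps of the top singular vectors with \<open>u\<close> and \<open>v\<close> is a subgradient
  of the convex function \<open>g\<close>, so it converges to the derivative of the limit. At the critical \<open>\<theta>\<close>
  this derivative exists because \<open>D'\<close> tends to minus infinity at \<open>b\<close>. The mean squared error is a
  quadratic polynomial in the weight whose coefficients are determined by these limits.\<close>

text \<open>Singular vectors are not unique and need not depend measurably on \<omega>, and nothing
  is assumed about the joint law of the matrices for different n. Apart from the assumed limits,
  probability therefore enters only through countably many scalar sequences, each controlled by a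
  summable bound on its own expectations; then \<omega> is frozen. Fourth moments are the lowest
  even ones that serve: second moments would give 1/n, whose sum diverges. As X is not assumed to
  have any moments, each deviation is divided by a unitarily invariant quantity before integrating,
  and this is undone on the sample path, where the divisor is bounded. Only finitely many forms are
  controlled at one time, so every Neumann series is truncated. Overlaps are not computed from
  derivatives of the resolvent because that breaks down at the threshold, where the outlier merges
  with the edge b; slopes of convex functions treat all positive \<theta> alike. Negative \<theta>
  matters as well: the upper bound depends on \<theta>^2 alone, and g 0 <= (g \<theta> + g
  (-\<theta>)) / 2 turns it into a lower bound.\<close>

no_notation vec_nth (infixl "$" 90)

section \<open>Vectors and matrices over the complex numbers\<close>

lemma cinner_eq_sum:
  "x \<in> carrier_vec d \<Longrightarrow> cinner x y = (\<Sum>i<d. x $ i * cnj (y $ i))"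
  by (simp add: cinner_def)

lemma cinner_commute:
  assumes "x \<in> carrier_vec d" "y \<in> carrier_vec d"
  shows "cinner y x = cnj (cinner x y)"
  using assms by (simp add: cinner_eq_sum mult.commute)

lemma cinner_add_left:
  assumes "x \<in> carrier_vec d" "x' \<in> carrier_vec d"
  shows "cinner (x + x') y = cinner x y + cinner x' y"
  using assms by (simp add: cinner_def algebra_simps sum.distrib)

lemma cinner_smult_left: "cinner (a \<cdot>\<^sub>v x) y = a * cinner x y"
  by (simp add: cinner_def sum_distrib_left mult.assoc)

lemma cinner_smult_right:
  assumes "x \<in> carrier_vec d" "y \<in> carrier_vec d"
  shows "cinner x (a \<cdot>\<^sub>v y) = cnj a * cinner x y"
  using assms by (simp add: cinner_def sum_distrib_left mult_ac)

text \<open>Built on \<open>L2_set\<close>, so that Cauchy--Schwarz is an instance of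
  \<open>L2_set_mult_ineq\<close>.\<close>

definition vnorm :: "complex vec \<Rightarrow> real" where
  "vnorm x = L2_set (\<lambda>i. cmod (x $ i)) {..<dim_vec x}"

lemma vnorm_nonneg [simp]: "0 \<le> vnorm x"
  by (simp add: vnorm_def)

lemma vnorm_sq: "(vnorm x)\<^sup>2 = (\<Sum>i<dim_vec x. (cmod (x $ i))\<^sup>2)"
  by (simp add: vnorm_def L2_set_def sum_nonneg)

lemma cinner_self: "cinner x x = complex_of_real ((vnorm x)\<^sup>2)"
  by (simp add: cinner_def vnorm_sq complex_norm_square del: of_real_power)

lemma vnorm_eq_1_iff: "vnorm x = 1 \<longleftrightarrow> cinner x x = 1"
proof -
  have "cinner x x = 1 \<longleftrightarrow> (vnorm x)\<^sup>2 = 1"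
    unfolding cinner_self by (simp only: of_real_eq_1_iff)
  then show ?thesis by (simp add: power2_eq_1_iff) (smt (verit) vnorm_nonneg)
qed

lemma cinner_Cauchy_Schwarz:
  assumes "x \<in> carrier_vec d" "y \<in> carrier_vec d"
  shows "cmod (cinner x y) \<le> vnorm x * vnorm y"
proof -
  have "cmod (cinner x y) \<le> (\<Sum>i<d. \<bar>cmod (x $ i)\<bar> * \<bar>cmod (y $ i)\<bar>)"
    unfolding cinner_eq_sum[OF assms(1)] by (rule sum_norm_le) (simp add: norm_mult)
  also have "\<dots> \<le> vnorm x * vnorm y"
    using L2_set_mult_ineq[of "\<lambda>i. cmod (x $ i)" "\<lambda>i. cmod (y $ i)" "{..<d}"] assms
    by (simp add: vnorm_def)
  finally show ?thesis .
qed

lemma vnorm_smult: "vnorm (a \<cdot>\<^sub>v x) = cmod a * vnorm x"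
proof -
  have "(vnorm (a \<cdot>\<^sub>v x))\<^sup>2 = (cmod a * vnorm x)\<^sup>2"
    by (simp add: vnorm_sq power_mult_distrib norm_mult sum_distrib_left)
  then show ?thesis by (simp add: power2_eq_iff_nonneg)
qed

subsection \<open>Adjoints and Gram powers\<close>

lemma adjoint_carrier [simp]: "adjoint_mat A \<in> carrier_mat n m \<longleftrightarrow> A \<in> carrier_mat m n"
  unfolding adjoint_mat_def by (auto intro!: carrier_matI dest: carrier_matD)

lemma adjoint_dim [simp]:
  "dim_row (adjoint_mat A) = dim_col A" "dim_col (adjoint_mat A) = dim_row A"
  by (auto simp: adjoint_mat_def)

lemma adjoint_index [simp]:
  "i < dim_col A \<Longrightarrow> j < dim_row A \<Longrightarrow> adjoint_mat A $$ (i,j) = cnj (A $$ (j,i))"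
  by (simp add: adjoint_mat_def)

lemma adjoint_adjoint [simp]: "adjoint_mat (adjoint_mat A) = A"
  by (rule eq_matI) auto

lemma adjoint_one [simp]: "adjoint_mat (1\<^sub>m n) = 1\<^sub>m n"
  by (rule eq_matI) auto

lemma mult_mat_index_sum:
  assumes "A \<in> carrier_mat n k" "B \<in> carrier_mat k m" "i < n" "j < m"
  shows "(A * B) $$ (i,j) = (\<Sum>l<k. A $$ (i,l) * B $$ (l,j))"
  using assms by (auto simp: scalar_prod_def lessThan_atLeast0 intro!: sum.cong)

lemma mult_mat_vec_index_sum:
  assumes "A \<in> carrier_mat n k" "w \<in> carrier_vec k" "i < n"
  shows "(A *\<^sub>v w) $ i = (\<Sum>l<k. A $$ (i,l) * w $ l)"
  using assms by (auto simp: scalar_prod_def lessThan_atLeast0 intro!: sum.cong)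

lemma adjoint_mult:
  assumes "A \<in> carrier_mat n k" "B \<in> carrier_mat k m"
  shows "adjoint_mat (A * B) = adjoint_mat B * adjoint_mat A"
proof (rule eq_matI)
  fix i j assume "i < dim_row (adjoint_mat B * adjoint_mat A)" "j < dim_col (adjoint_mat B * adjoint_mat A)"
  then have ij: "i < m" "j < n" using assms by auto
  have "(adjoint_mat B * adjoint_mat A) $$ (i,j)
      = (\<Sum>l<k. adjoint_mat B $$ (i,l) * adjoint_mat A $$ (l,j))"
    by (rule mult_mat_index_sum) (use assms ij in auto)
  also have "\<dots> = (\<Sum>l<k. cnj (A $$ (j,l) * B $$ (l,i)))"
    by (rule sum.cong) (use assms ij in auto)
  also have "\<dots> = cnj ((A * B) $$ (j,i))"
    by (simp add: mult_mat_index_sum[OF assms ij(2) ij(1)])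
  finally show "adjoint_mat (A * B) $$ (i,j) = (adjoint_mat B * adjoint_mat A) $$ (i,j)"
    using assms ij by simp
qed (use assms in auto)

lemma cinner_mult_mat_vec:
  assumes "A \<in> carrier_mat n m" "x \<in> carrier_vec m" "y \<in> carrier_vec n"
  shows "cinner (A *\<^sub>v x) y = cinner x (adjoint_mat A *\<^sub>v y)"
proof -
  have "cinner (A *\<^sub>v x) y = (\<Sum>i<n. (A *\<^sub>v x) $ i * cnj (y $ i))"
    by (rule cinner_eq_sum) (use assms in auto)
  also have "\<dots> = (\<Sum>i<n. \<Sum>j<m. A $$ (i,j) * x $ j * cnj (y $ i))"
    by (rule sum.cong) (use mult_mat_vec_index_sum[OF assms(1,2)] in \<open>auto simp: sum_distrib_right\<close>)
  also have "\<dots> = (\<Sum>j<m. \<Sum>i<n. A $$ (i,j) * x $ j * cnj (y $ i))"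
    by (rule sum.swap)
  also have "\<dots> = (\<Sum>j<m. x $ j * cnj (\<Sum>i<n. adjoint_mat A $$ (j,i) * y $ i))"
    by (rule sum.cong) (use assms in \<open>auto simp: sum_distrib_left mult_ac\<close>)
  also have "\<dots> = (\<Sum>j<m. x $ j * cnj ((adjoint_mat A *\<^sub>v y) $ j))"
    by (rule sum.cong) (use assms in \<open>auto simp del: index_mult_mat_vec simp: mult_mat_vec_index_sum[of "adjoint_mat A" m n y]\<close>)
  also have "\<dots> = cinner x (adjoint_mat A *\<^sub>v y)"
    by (rule cinner_eq_sum[symmetric]) (use assms in auto)
  finally show ?thesis .
qed

text \<open>Serves both Gram matrices: applied to \<open>Y\<close> it gives the powers of Y Y^H,
  applied to \<open>adjoint_mat Y\<close> those of Y^H Y. Every fact about the \<open>u\<close> side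
  thereby covers the \<open>v\<close> side too.\<close>

definition gpow :: "complex mat \<Rightarrow> nat \<Rightarrow> complex mat" where
  "gpow Y k = (Y * adjoint_mat Y) ^\<^sub>m k"

lemma gram_carrier [simp]: "Y \<in> carrier_mat d e \<Longrightarrow> Y * adjoint_mat Y \<in> carrier_mat d d"
  by (rule mult_carrier_mat) auto

lemma gpow_carrier [simp]: "Y \<in> carrier_mat d e \<Longrightarrow> gpow Y k \<in> carrier_mat d d"
  unfolding gpow_def by (rule pow_carrier_mat) simp

lemma gpow_0 [simp]: "Y \<in> carrier_mat d e \<Longrightarrow> gpow Y 0 = 1\<^sub>m d"
  by (simp add: gpow_def)

lemma gpow_Suc: "gpow Y (Suc k) = gpow Y k * (Y * adjoint_mat Y)"
  by (simp add: gpow_def)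

lemma gpow_add:
  assumes "Y \<in> carrier_mat d e"
  shows "gpow Y (k + l) = gpow Y k * gpow Y l"
proof (induction l)
  case 0
  then show ?case using assms right_mult_one_mat[OF gpow_carrier[OF assms]] by simp
next
  case (Suc l)
  have "gpow Y (k + Suc l) = gpow Y k * gpow Y l * (Y * adjoint_mat Y)"
    using Suc by (simp add: gpow_Suc)
  also have "\<dots> = gpow Y k * (gpow Y l * (Y * adjoint_mat Y))"
    by (rule assoc_mult_mat[of _ d d _ d _ d]) (use assms in auto)
  finally show ?case by (simp add: gpow_Suc)
qed

lemma adjoint_gram: "adjoint_mat (Y * adjoint_mat Y) = Y * adjoint_mat Y"
  by (subst adjoint_mult[of _ "dim_row Y" "dim_col Y" _ "dim_row Y"]) auto

lemma gpow_1: "Y \<in> carrier_mat d e \<Longrightarrow> gpow Y (Suc 0) = Y * adjoint_mat Y"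
  unfolding gpow_Suc using left_mult_one_mat[OF gram_carrier] by simp

lemma gpow_Suc': "Y \<in> carrier_mat d e \<Longrightarrow> gpow Y (Suc k) = (Y * adjoint_mat Y) * gpow Y k"
  using gpow_add[of Y d e 1 k] by (simp add: gpow_1)

lemma adjoint_gpow:
  assumes "Y \<in> carrier_mat d e"
  shows "adjoint_mat (gpow Y k) = gpow Y k"
proof (induction k)
  case 0
  then show ?case using assms by simp
next
  case (Suc k)
  have "adjoint_mat (gpow Y (Suc k)) = adjoint_mat (Y * adjoint_mat Y) * adjoint_mat (gpow Y k)"
    unfolding gpow_Suc by (rule adjoint_mult[of _ d d _ d]) (use assms in auto)
  then show ?case by (simp add: Suc adjoint_gram gpow_Suc'[OF assms])
qed

text \<open>Reassociating Y Y^H Y moves one Gram factor at a time across Y. This intertwining rule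
  lets mixed forms be written with the powers on either side.\<close>

lemma gpow_mult_swap:
  assumes "Y \<in> carrier_mat d e"
  shows "gpow Y k * Y = Y * gpow (adjoint_mat Y) k"
proof (induction k)
  case 0
  then show ?case using assms by (simp add: gpow_0[of "adjoint_mat Y" e d])
next
  case (Suc k)
  have "gpow Y (Suc k) * Y = (gpow Y k * (Y * adjoint_mat Y)) * Y"
    by (simp add: gpow_Suc)
  also have "\<dots> = gpow Y k * ((Y * adjoint_mat Y) * Y)"
    by (rule assoc_mult_mat[of _ d d _ d _ e]) (use assms in auto)
  also have "(Y * adjoint_mat Y) * Y = Y * (adjoint_mat Y * Y)"
    by (rule assoc_mult_mat[of _ d e _ d _ e]) (use assms in auto)
  also have "gpow Y k * (Y * (adjoint_mat Y * Y)) = (gpow Y k * Y) * (adjoint_mat Y * Y)"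
    by (rule assoc_mult_mat[symmetric, of _ d d _ e _ e]) (use assms in auto)
  also have "\<dots> = Y * (gpow (adjoint_mat Y) k * (adjoint_mat Y * Y))"
    unfolding Suc by (rule assoc_mult_mat[of _ d e _ e _ e]) (use assms gpow_carrier[of "adjoint_mat Y" e d] in auto)
  finally show ?case by (simp add: gpow_Suc)
qed

subsection \<open>Linear combinations\<close>

definition lincomb :: "nat \<Rightarrow> nat \<Rightarrow> (nat \<Rightarrow> complex) \<Rightarrow> (nat \<Rightarrow> complex vec) \<Rightarrow> complex vec" where
  "lincomb d q a x = vec d (\<lambda>i. \<Sum>k<q. a k * x k $ i)"

lemma lincomb_carrier [simp]: "lincomb d q a x \<in> carrier_vec d"
  by (simp add: lincomb_def)

lemma cinner_lincomb_left:
  assumes "\<And>k. k < q \<Longrightarrow> x k \<in> carrier_vec d"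
  shows "cinner (lincomb d q a x) y = (\<Sum>k<q. a k * cinner (x k) y)"
proof -
  have "cinner (lincomb d q a x) y = (\<Sum>i<d. \<Sum>k<q. a k * (x k $ i * cnj (y $ i)))"
    unfolding cinner_eq_sum[OF lincomb_carrier]
    by (simp add: lincomb_def sum_distrib_right mult.assoc)
  also have "\<dots> = (\<Sum>k<q. \<Sum>i<d. a k * (x k $ i * cnj (y $ i)))"
    by (rule sum.swap)
  also have "\<dots> = (\<Sum>k<q. a k * cinner (x k) y)"
    by (rule sum.cong) (use assms in \<open>auto simp: cinner_eq_sum[of _ d] sum_distrib_left\<close>)
  finally show ?thesis .
qed

lemma cinner_lincomb_right:
  assumes "\<And>k. k < q \<Longrightarrow> x k \<in> carrier_vec d" "y \<in> carrier_vec d"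
  shows "cinner y (lincomb d q a x) = (\<Sum>k<q. cnj (a k) * cinner y (x k))"
proof -
  have "cinner y (lincomb d q a x) = cnj (cinner (lincomb d q a x) y)"
    by (rule cinner_commute) (use assms in auto)
  also have "\<dots> = (\<Sum>k<q. cnj (a k * cinner (x k) y))"
    by (subst cinner_lincomb_left) (use assms in auto)
  also have "\<dots> = (\<Sum>k<q. cnj (a k) * cinner y (x k))"
    by (rule sum.cong) (use assms cinner_commute in auto)
  finally show ?thesis .
qed

section \<open>Orthonormal families: Bessel's inequality, dimension, basis expansion\<close>

lemma cinner_lincomb_orthonormal:
  assumes "orthonormal_fam d q x" "j < q"
  shows "cinner (lincomb d q a x) (x j) = a j"
proof -
  have "cinner (lincomb d q a x) (x j) = (\<Sum>k<q. a k * cinner (x k) (x j))"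
    by (rule cinner_lincomb_left) (use assms in \<open>auto simp: orthonormal_fam_def\<close>)
  also have "\<dots> = (\<Sum>k<q. a k * (if k = j then 1 else 0))"
    by (rule sum.cong) (use assms in \<open>auto simp: orthonormal_fam_def\<close>)
  finally show ?thesis using assms(2) by (simp add: if_distrib[of "\<lambda>t. _ * t"] cong: if_cong)
qed

lemma vnorm_lincomb_orthonormal:
  assumes "orthonormal_fam d q x"
  shows "(vnorm (lincomb d q a x))\<^sup>2 = (\<Sum>k<q. (cmod (a k))\<^sup>2)"
proof -
  have "complex_of_real ((vnorm (lincomb d q a x))\<^sup>2) = cinner (lincomb d q a x) (lincomb d q a x)"
    by (simp add: cinner_self)
  also have "\<dots> = (\<Sum>k<q. cnj (a k) * cinner (lincomb d q a x) (x k))"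
    by (rule cinner_lincomb_right) (use assms in \<open>auto simp: orthonormal_fam_def\<close>)
  also have "\<dots> = (\<Sum>k<q. complex_of_real ((cmod (a k))\<^sup>2))"
    by (rule sum.cong) (auto simp: cinner_lincomb_orthonormal[OF assms] complex_norm_square mult.commute simp del: of_real_power)
  finally show ?thesis by (metis of_real_eq_iff of_real_sum)
qed

text \<open>The projection p of w satisfies |p|^2 = <w,p>, so Cauchy--Schwarz gives |p|^2 <= |w|
  |p|, and one factor cancels.\<close>

lemma Bessel:
  assumes x: "orthonormal_fam d q x" and w: "w \<in> carrier_vec d"
  shows "(\<Sum>k<q. (cmod (cinner w (x k)))\<^sup>2) \<le> (vnorm w)\<^sup>2"
proof -
  let ?S = "\<Sum>k<q. (cmod (cinner w (x k)))\<^sup>2"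
  let ?p = "lincomb d q (\<lambda>k. cinner w (x k)) x"
  have "cinner w ?p = (\<Sum>k<q. cnj (cinner w (x k)) * cinner w (x k))"
    by (rule cinner_lincomb_right) (use assms in \<open>auto simp: orthonormal_fam_def\<close>)
  also have "\<dots> = complex_of_real ?S"
    by (simp add: complex_norm_square mult.commute del: of_real_power)
  finally have "?S = cmod (cinner w ?p)"
    by (simp add: sum_nonneg del: of_real_sum)
  also have "\<dots> \<le> vnorm w * vnorm ?p"
    by (rule cinner_Cauchy_Schwarz) (use w in auto)
  finally have le: "?S \<le> vnorm w * vnorm ?p" .
  have "(vnorm ?p)\<^sup>2 = ?S" by (rule vnorm_lincomb_orthonormal[OF x])
  then have "vnorm ?p * vnorm ?p \<le> vnorm w * vnorm ?p" using le by (simp add: power2_eq_square)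
  then have "vnorm ?p \<le> vnorm w"
    using vnorm_nonneg[of ?p] vnorm_nonneg[of w] by (metis mult_right_le_imp_le order_le_less)
  then show ?thesis using \<open>(vnorm ?p)\<^sup>2 = ?S\<close> by (metis power_mono vnorm_nonneg)
qed

lemma cinner_minus_left:
  assumes "x \<in> carrier_vec d" "x' \<in> carrier_vec d"
  shows "cinner (x - x') y = cinner x y - cinner x' y"
  using assms by (simp add: cinner_def algebra_simps sum_subtractf)

lemma cinner_minus_right:
  assumes "x \<in> carrier_vec d" "y \<in> carrier_vec d" "y' \<in> carrier_vec d"
  shows "cinner x (y - y') = cinner x y - cinner x y'"
  using assms by (simp add: cinner_def algebra_simps sum_subtractf)

lemma vnorm_minus_sq:
  assumes "x \<in> carrier_vec d" "y \<in> carrier_vec d"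
  shows "(vnorm (x - y))\<^sup>2 = (vnorm x)\<^sup>2 - 2 * Re (cinner x y) + (vnorm y)\<^sup>2"
proof -
  have "cinner (x - y) (x - y) = cinner x x - cinner x y - (cinner y x - cinner y y)"
    using assms by (simp add: cinner_minus_left[of _ d] cinner_minus_right[of _ d])
  then have "Re (cinner (x - y) (x - y)) = Re (cinner x x) - Re (cinner x y) - Re (cinner y x) + Re (cinner y y)"
    by simp
  moreover have "Re (cinner y x) = Re (cinner x y)"
    using cinner_commute[OF assms] by simp
  ultimately show ?thesis by (simp add: cinner_self)
qed

lemma vnorm_0D:
  assumes "vnorm x = 0" "x \<in> carrier_vec d"
  shows "x = 0\<^sub>v d"
proof -
  have "(\<Sum>i<dim_vec x. (cmod (x $ i))\<^sup>2) = 0"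
    using assms(1) vnorm_sq[of x] by simp
  then have "\<forall>i<dim_vec x. x $ i = 0"
    by (subst (asm) sum_nonneg_eq_0_iff) auto
  then show ?thesis using assms(2) by (intro eq_vecI) auto
qed

text \<open>Equality of vectors is proved later by expanding the squared norm of a difference and
  bounding it by zero; the last hypothesis has the shape that such a computation delivers.\<close>

lemma vec_eqI_vnorm:
  assumes "x \<in> carrier_vec d" "y \<in> carrier_vec d" "(vnorm (x - y))\<^sup>2 \<le> 0"
  shows "x = y"
proof -
  have "vnorm (x - y) = 0" using assms(3) by simp
  then have "x - y = 0\<^sub>v d" using assms vnorm_0D by auto
  then have "\<And>i. i < d \<Longrightarrow> (x - y) $ i = 0" by simp
  then show ?thesis using assms by (intro eq_vecI) auto
qed

lemma cinner_unit_vec_left: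
  assumes "x \<in> carrier_vec d" "j < d"
  shows "cinner (unit_vec d j) x = cnj (x $ j)"
proof -
  have "cinner (unit_vec d j) x = (\<Sum>i<d. (if i = j then 1 else 0) * cnj (x $ i))"
    by (subst cinner_eq_sum[of _ d]) (auto intro!: sum.cong simp: unit_vec_def)
  also have "\<dots> = (\<Sum>i<d. if i = j then cnj (x $ i) else 0)"
    by (rule sum.cong) auto
  finally show ?thesis using assms(2) by simp
qed

lemma vnorm_unit_vec: "j < d \<Longrightarrow> vnorm (unit_vec d j) = 1"
  unfolding vnorm_eq_1_iff by (subst cinner_unit_vec_left[of _ d]) auto

lemma sum_cinner_unit_vec:
  assumes "x \<in> carrier_vec d"
  shows "(\<Sum>j<d. (cmod (cinner (unit_vec d j) x))\<^sup>2) = (vnorm x)\<^sup>2"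
  using assms by (auto simp: cinner_unit_vec_left[OF assms] vnorm_sq intro!: sum.cong)

text \<open>The left side is the trace, in the standard basis, of the projection onto the span of
  the family. Combined with Bessel it does the work of a dimension theory.\<close>

lemma sum_Bessel_unit_vec:
  assumes x: "orthonormal_fam d q x"
  shows "(\<Sum>j<d. \<Sum>i<q. (cmod (cinner (unit_vec d j) (x i)))\<^sup>2) = real q"
proof -
  have "(\<Sum>j<d. \<Sum>i<q. (cmod (cinner (unit_vec d j) (x i)))\<^sup>2)
      = (\<Sum>i<q. \<Sum>j<d. (cmod (cinner (unit_vec d j) (x i)))\<^sup>2)"
    by (rule sum.swap)
  also have "\<dots> = (\<Sum>i<q. 1)"
  proof (rule sum.cong[OF refl])
    fix i assume "i \<in> {..<q}"
    then have "x i \<in> carrier_vec d" "vnorm (x i) = 1"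
      using x unfolding vnorm_eq_1_iff by (auto simp: orthonormal_fam_def)
    then show "(\<Sum>j<d. (cmod (cinner (unit_vec d j) (x i)))\<^sup>2) = 1"
      by (simp add: sum_cinner_unit_vec)
  qed
  finally show ?thesis by simp
qed

text \<open>The trace q of the projection is a sum of d terms, each at most 1 by Bessel.\<close>

lemma orthonormal_fam_le_dim:
  assumes x: "orthonormal_fam d q x"
  shows "q \<le> d"
proof -
  have "real q = (\<Sum>j<d. \<Sum>i<q. (cmod (cinner (unit_vec d j) (x i)))\<^sup>2)"
    using sum_Bessel_unit_vec[OF x] by simp
  also have "\<dots> \<le> (\<Sum>j<d. 1)"
  proof (rule sum_mono)
    fix j assume "j \<in> {..<d}"
    then show "(\<Sum>i<q. (cmod (cinner (unit_vec d j) (x i)))\<^sup>2) \<le> 1"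
      using Bessel[OF x, of "unit_vec d j"] by (simp add: vnorm_unit_vec)
  qed
  finally show ?thesis by simp
qed

definition residual :: "nat \<Rightarrow> nat \<Rightarrow> (nat \<Rightarrow> complex vec) \<Rightarrow> complex vec \<Rightarrow> complex vec" where
  "residual d q x w = w - lincomb d q (\<lambda>k. cinner w (x k)) x"

lemma residual_carrier: "w \<in> carrier_vec d \<Longrightarrow> residual d q x w \<in> carrier_vec d"
  by (simp add: residual_def)

lemma cinner_residual:
  assumes x: "orthonormal_fam d q x" and w: "w \<in> carrier_vec d" and j: "j < q"
  shows "cinner (residual d q x w) (x j) = 0"
  unfolding residual_def using w
  by (subst cinner_minus_left[of _ d]) (auto simp: cinner_lincomb_orthonormal[OF x j])

lemma vnorm_residual_sq:
  assumes x: "orthonormal_fam d q x" and w: "w \<in> carrier_vec d"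
  shows "(vnorm (residual d q x w))\<^sup>2 = (vnorm w)\<^sup>2 - (\<Sum>k<q. (cmod (cinner w (x k)))\<^sup>2)"
proof -
  let ?p = "lincomb d q (\<lambda>k. cinner w (x k)) x"
  have "cinner w ?p = (\<Sum>k<q. cnj (cinner w (x k)) * cinner w (x k))"
    by (rule cinner_lincomb_right) (use assms in \<open>auto simp: orthonormal_fam_def\<close>)
  also have "\<dots> = complex_of_real (\<Sum>k<q. (cmod (cinner w (x k)))\<^sup>2)"
    by (simp add: complex_norm_square mult.commute del: of_real_power)
  finally show ?thesis
    unfolding residual_def using w
    by (subst vnorm_minus_sq[of _ d]) (auto simp: vnorm_lincomb_orthonormal[OF x] simp del: of_real_sum)
qed

lemma vnorm_normalized:
  assumes "vnorm w \<noteq> 0"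
  shows "vnorm (complex_of_real (1 / vnorm w) \<cdot>\<^sub>v w) = 1"
  using assms by (simp add: vnorm_smult norm_divide)

text \<open>Pigeonhole: the Bessel sums of the d standard basis vectors add up to q < d, so one of
  them is below 1 and that basis vector has a nonzero residual.\<close>

lemma exists_unit_orthogonal:
  assumes x: "orthonormal_fam d q x" and "q < d"
  shows "\<exists>w\<in>carrier_vec d. vnorm w = 1 \<and> (\<forall>i<q. cinner w (x i) = 0)"
proof -
  have "\<exists>j<d. (\<Sum>i<q. (cmod (cinner (unit_vec d j) (x i)))\<^sup>2) < 1"
  proof (rule ccontr)
    assume "\<not> ?thesis"
    then have "(\<Sum>j<d. 1) \<le> (\<Sum>j<d. \<Sum>i<q. (cmod (cinner (unit_vec d j) (x i)))\<^sup>2)"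
      by (intro sum_mono) auto
    then show False using sum_Bessel_unit_vec[OF x] \<open>q < d\<close> by simp
  qed
  then obtain j where j: "j < d" "(\<Sum>i<q. (cmod (cinner (unit_vec d j) (x i)))\<^sup>2) < 1" by blast
  define r where "r = residual d q x (unit_vec d j)"
  have "(vnorm r)\<^sup>2 > 0"
    unfolding r_def using j by (subst vnorm_residual_sq[OF x]) (auto simp: vnorm_unit_vec)
  then have r0: "vnorm r \<noteq> 0" by auto
  have r: "r \<in> carrier_vec d" unfolding r_def by (rule residual_carrier) simp
  show ?thesis
    using r r0 cinner_residual[OF x, of "unit_vec d j"]
    by (intro bexI[of _ "complex_of_real (1 / vnorm r) \<cdot>\<^sub>v r"])
      (auto simp: vnorm_normalized cinner_smult_left r_def simp del: of_real_divide)
qed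

text \<open>A nonzero residual, once normalised, would enlarge the family to d + 1 orthonormal
  vectors.\<close>

lemma orthonormal_basis_expansion:
  assumes x: "orthonormal_fam d d x" and w: "w \<in> carrier_vec d"
  shows "w = lincomb d d (\<lambda>k. cinner w (x k)) x"
proof (rule ccontr)
  assume ne: "w \<noteq> lincomb d d (\<lambda>k. cinner w (x k)) x"
  define r where "r = residual d d x w"
  have rc: "r \<in> carrier_vec d" unfolding r_def by (rule residual_carrier[OF w])
  have "vnorm r \<noteq> 0"
    using ne vec_eqI_vnorm[OF w lincomb_carrier] unfolding r_def residual_def by auto
  define e where "e = complex_of_real (1 / vnorm r) \<cdot>\<^sub>v r"
  have ec: "e \<in> carrier_vec d" using rc by (simp add: e_def)
  have e1: "cinner e e = 1"
    unfolding e_def vnorm_eq_1_iff[symmetric] by (rule vnorm_normalized) fact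
  have e0: "cinner e (x j) = 0" if "j < d" for j
    using cinner_residual[OF x w that] by (simp add: e_def r_def cinner_smult_left)
  have e0': "cinner (x j) e = 0" if "j < d" for j
    using e0[OF that] cinner_commute[OF ec, of "x j"] x that by (auto simp: orthonormal_fam_def)
  have "orthonormal_fam d (Suc d) (x(d := e))"
    using x ec e1 e0 e0' by (auto simp: orthonormal_fam_def less_Suc_eq)
  from orthonormal_fam_le_dim[OF this] show False by simp
qed

subsection \<open>Singular value decompositions\<close>

text \<open>Keeping the two families and both dimensions independent makes these matrices closed
  under adjoints and, when the inner families agree, under products. Gram powers are products of
  this kind with equal outer families.\<close>

definition svdmat :: "nat \<Rightarrow> nat \<Rightarrow> nat \<Rightarrow> (nat \<Rightarrow> real) \<Rightarrow> (nat \<Rightarrow> complex vec) \<Rightarrow> (nat \<Rightarrow> complex vec) \<Rightarrow> complex mat"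
  where "svdmat d e q l x y = mat d e (\<lambda>(i,j). \<Sum>k<q. complex_of_real (l k) * x k $ i * cnj (y k $ j))"

lemma svdmat_carrier [simp]: "svdmat d e q l x y \<in> carrier_mat d e"
  by (simp add: svdmat_def)

lemma svdmat_mult:
  assumes y: "orthonormal_fam e q y"
  shows "svdmat d e q l x y * svdmat e f q r y z = svdmat d f q (\<lambda>k. l k * r k) x z"
proof (rule eq_matI)
  fix i j assume "i < dim_row (svdmat d f q (\<lambda>k. l k * r k) x z)" "j < dim_col (svdmat d f q (\<lambda>k. l k * r k) x z)"
  then have ij: "i < d" "j < f" by (auto simp: svdmat_def)
  have "(svdmat d e q l x y * svdmat e f q r y z) $$ (i,j)
      = (\<Sum>t<e. svdmat d e q l x y $$ (i,t) * svdmat e f q r y z $$ (t,j))"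
    by (rule mult_mat_index_sum) (use ij in auto)
  also have "\<dots> = (\<Sum>t<e. \<Sum>k<q. \<Sum>k'<q. (complex_of_real (l k) * x k $ i * cnj (y k $ t)) *
       (complex_of_real (r k') * y k' $ t * cnj (z k' $ j)))"
    by (rule sum.cong) (use ij in \<open>auto simp: svdmat_def sum_product\<close>)
  also have "\<dots> = (\<Sum>k<q. \<Sum>t<e. \<Sum>k'<q. (complex_of_real (l k) * x k $ i * cnj (y k $ t)) *
       (complex_of_real (r k') * y k' $ t * cnj (z k' $ j)))"
    by (rule sum.swap)
  also have "\<dots> = (\<Sum>k<q. \<Sum>k'<q. \<Sum>t<e. (complex_of_real (l k) * x k $ i * cnj (y k $ t)) *
       (complex_of_real (r k') * y k' $ t * cnj (z k' $ j)))"
    by (rule sum.cong[OF refl], rule sum.swap)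
  also have "\<dots> = (\<Sum>k<q. \<Sum>k'<q. complex_of_real (l k * r k') * x k $ i * cnj (z k' $ j) * cinner (y k') (y k))"
    by (intro sum.cong refl)
      (use y in \<open>auto simp: orthonormal_fam_def cinner_eq_sum[of _ e] sum_distrib_left mult_ac\<close>)
  also have "\<dots> = (\<Sum>k<q. \<Sum>k'<q. if k' = k then complex_of_real (l k * r k') * x k $ i * cnj (z k' $ j) else 0)"
    by (intro sum.cong refl) (use y in \<open>auto simp: orthonormal_fam_def\<close>)
  also have "\<dots> = svdmat d f q (\<lambda>k. l k * r k) x z $$ (i,j)"
    using ij by (simp add: svdmat_def)
  finally show "(svdmat d e q l x y * svdmat e f q r y z) $$ (i,j) = svdmat d f q (\<lambda>k. l k * r k) x z $$ (i,j)" .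
qed (auto simp: svdmat_def)

lemma adjoint_svdmat: "adjoint_mat (svdmat d e q l x y) = svdmat e d q l y x"
  by (rule eq_matI) (auto simp: svdmat_def mult_ac)

lemma trace_svdmat:
  assumes x: "orthonormal_fam d q x"
  shows "(\<Sum>i<d. svdmat d d q l x x $$ (i,i)) = complex_of_real (\<Sum>k<q. l k)"
proof -
  have "(\<Sum>i<d. svdmat d d q l x x $$ (i,i)) = (\<Sum>i<d. \<Sum>k<q. complex_of_real (l k) * (x k $ i * cnj (x k $ i)))"
    by (rule sum.cong) (auto simp: svdmat_def mult.assoc)
  also have "\<dots> = (\<Sum>k<q. \<Sum>i<d. complex_of_real (l k) * (x k $ i * cnj (x k $ i)))"
    by (rule sum.swap)
  also have "\<dots> = (\<Sum>k<q. complex_of_real (l k) * cinner (x k) (x k))"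
    by (rule sum.cong) (use x in \<open>auto simp: orthonormal_fam_def cinner_eq_sum[of _ d] sum_distrib_left\<close>)
  also have "\<dots> = (\<Sum>k<q. complex_of_real (l k))"
    by (rule sum.cong) (use x in \<open>auto simp: orthonormal_fam_def\<close>)
  finally show ?thesis by simp
qed

lemma fro_sq_eq_trace:
  assumes "A \<in> carrier_mat d e"
  shows "(\<Sum>i<d. (A * adjoint_mat A) $$ (i,i)) = complex_of_real (fro_sq A)"
proof -
  have "(\<Sum>i<d. (A * adjoint_mat A) $$ (i,i)) = (\<Sum>i<d. \<Sum>j<e. A $$ (i,j) * adjoint_mat A $$ (j,i))"
    by (rule sum.cong[OF refl], rule mult_mat_index_sum[of _ d e _ d]) (use assms in auto)
  also have "\<dots> = (\<Sum>i<d. \<Sum>j<e. complex_of_real ((cmod (A $$ (i,j)))\<^sup>2))"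
    by (intro sum.cong refl) (use assms in \<open>auto simp: complex_norm_square simp del: of_real_power\<close>)
  finally show ?thesis using assms by (simp add: fro_sq_def)
qed

lemma fro_sq_svdmat:
  assumes "orthonormal_fam d q x" "orthonormal_fam e q y"
  shows "fro_sq (svdmat d e q l x y) = (\<Sum>k<q. (l k)\<^sup>2)"
proof -
  have "complex_of_real (fro_sq (svdmat d e q l x y))
      = (\<Sum>i<d. (svdmat d e q l x y * adjoint_mat (svdmat d e q l x y)) $$ (i,i))"
    by (rule fro_sq_eq_trace[OF svdmat_carrier, symmetric])
  also have "\<dots> = complex_of_real (\<Sum>k<q. l k * l k)"
    unfolding adjoint_svdmat svdmat_mult[OF assms(2)] by (rule trace_svdmat[OF assms(1)])
  finally show ?thesis by (simp only: of_real_eq_iff power2_eq_square)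
qed

lemma is_svd_svdmat:
  assumes "is_svd rK A s x y" "A \<in> carrier_mat n m"
  shows "A = svdmat n m (min n m) s x y"
  using assms by (intro eq_matI) (auto simp: is_svd_def svdmat_def Let_def)

lemma is_svd_FalseI: "is_svd rK A s x y \<Longrightarrow> is_svd False A s x y"
  by (auto simp: is_svd_def Let_def)

lemma is_svd_adjoint:
  assumes "is_svd False A s x y"
  shows "is_svd False (adjoint_mat A) s y x"
  using assms by (auto simp: is_svd_def Let_def min.commute mult_ac)

lemma is_svd_orthonormal:
  assumes "is_svd rK A s x y" "A \<in> carrier_mat n m"
  shows "orthonormal_fam n (min n m) x" "orthonormal_fam m (min n m) y"
  using assms by (auto simp: is_svd_def Let_def)

lemma is_svd_nonneg: "is_svd rK A s x y \<Longrightarrow> A \<in> carrier_mat n m \<Longrightarrow> i < min n m \<Longrightarrow> 0 \<le> s i"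
  by (auto simp: is_svd_def Let_def)

lemma is_svd_decreasing:
  "is_svd rK A s x y \<Longrightarrow> A \<in> carrier_mat n m \<Longrightarrow> i \<le> j \<Longrightarrow> j < min n m \<Longrightarrow> s j \<le> s i"
  by (auto simp: is_svd_def Let_def)

text \<open>Only positive powers have this form: the zeroth power is the identity, whereas the
  right-hand side with all weights 1 is merely a projection when \<open>min n m\<close> is below
  n.\<close>

lemma gpow_svd:
  assumes svd: "is_svd rK A s x y" and A: "A \<in> carrier_mat n m"
  shows "gpow A (Suc k) = svdmat n n (min n m) (\<lambda>i. s i ^ (2 * Suc k)) x x"
proof (induction k)
  case 0
  have "A * adjoint_mat A = svdmat n n (min n m) (\<lambda>i. s i * s i) x x"
    using is_svd_svdmat[OF svd A] adjoint_svdmat svdmat_mult[OF is_svd_orthonormal(2)[OF svd A]] by metis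
  then show ?case using A by (simp add: gpow_1 power2_eq_square)
next
  case (Suc k)
  have "gpow A (Suc (Suc k)) = gpow A (Suc k) * gpow A (Suc 0)"
    using gpow_add[OF A, of "Suc k" "Suc 0"] by simp
  also have "gpow A (Suc 0) = svdmat n n (min n m) (\<lambda>i. s i * s i) x x"
    using is_svd_svdmat[OF svd A] adjoint_svdmat svdmat_mult[OF is_svd_orthonormal(2)[OF svd A]] gpow_1[OF A] by metis
  finally show ?case
    unfolding Suc svdmat_mult[OF is_svd_orthonormal(1)[OF svd A]] by (simp add: algebra_simps)
qed

lemma trace_gpow_svd:
  assumes svd: "is_svd rK A s x y" and A: "A \<in> carrier_mat n m" and "k > 0"
  shows "(\<Sum>i<n. gpow A k $$ (i,i)) = complex_of_real (\<Sum>i<min n m. s i ^ (2 * k))"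
  using gpow_svd[OF svd A, of "k - 1"] trace_svdmat[OF is_svd_orthonormal(1)[OF svd A]] \<open>k > 0\<close> by simp

lemma fro_sq_gpow_svd:
  assumes svd: "is_svd rK A s x y" and A: "A \<in> carrier_mat n m" and "k > 0"
  shows "fro_sq (gpow A k) = (\<Sum>i<min n m. s i ^ (4 * k))"
  using gpow_svd[OF svd A, of "k - 1"] fro_sq_svdmat[OF is_svd_orthonormal(1)[OF svd A] is_svd_orthonormal(1)[OF svd A]] \<open>k > 0\<close>
  by (simp flip: power_mult)

lemma svd_mult_vec:
  assumes svd: "is_svd rK A s x y" and A: "A \<in> carrier_mat n m" and w: "w \<in> carrier_vec m"
  shows "A *\<^sub>v w = lincomb n (min n m) (\<lambda>k. complex_of_real (s k) * cinner w (y k)) x"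
proof (rule eq_vecI)
  let ?q = "min n m"
  fix i assume "i < dim_vec (lincomb n ?q (\<lambda>k. complex_of_real (s k) * cinner w (y k)) x)"
  then have i: "i < n" by (simp add: lincomb_def)
  have "(A *\<^sub>v w) $ i = (\<Sum>j<m. A $$ (i,j) * w $ j)"
    by (rule mult_mat_vec_index_sum[OF A w i])
  also have "\<dots> = (\<Sum>j<m. \<Sum>k<?q. complex_of_real (s k) * x k $ i * (w $ j * cnj (y k $ j)))"
    by (rule sum.cong[OF refl], subst is_svd_svdmat[OF svd A])
      (use i in \<open>auto simp: svdmat_def sum_distrib_left mult_ac\<close>)
  also have "\<dots> = (\<Sum>k<?q. \<Sum>j<m. complex_of_real (s k) * x k $ i * (w $ j * cnj (y k $ j)))"
    by (rule sum.swap)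
  also have "\<dots> = (\<Sum>k<?q. complex_of_real (s k) * cinner w (y k) * x k $ i)"
    by (rule sum.cong) (use w in \<open>auto simp: cinner_eq_sum sum_distrib_left sum_distrib_right mult_ac\<close>)
  finally show "(A *\<^sub>v w) $ i = lincomb n ?q (\<lambda>k. complex_of_real (s k) * cinner w (y k)) x $ i"
    using i by (simp add: lincomb_def)
qed (use A in \<open>auto simp: lincomb_def\<close>)

lemma svd_op_bound:
  assumes svd: "is_svd rK A s x y" and A: "A \<in> carrier_mat n m" and w: "w \<in> carrier_vec m"
    and nm: "0 < n" "0 < m"
  shows "vnorm (A *\<^sub>v w) \<le> s 0 * vnorm w"
proof -
  let ?q = "min n m"
  have s0: "0 \<le> s 0" using is_svd_nonneg[OF svd A] nm by simp
  have "(vnorm (A *\<^sub>v w))\<^sup>2 = (\<Sum>k<?q. (cmod (complex_of_real (s k) * cinner w (y k)))\<^sup>2)"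
    unfolding svd_mult_vec[OF svd A w] by (rule vnorm_lincomb_orthonormal[OF is_svd_orthonormal(1)[OF svd A]])
  also have "\<dots> \<le> (\<Sum>k<?q. (s 0)\<^sup>2 * (cmod (cinner w (y k)))\<^sup>2)"
    using is_svd_decreasing[OF svd A] is_svd_nonneg[OF svd A]
    by (intro sum_mono) (auto simp: norm_mult power_mult_distrib intro!: mult_right_mono power_mono)
  also have "\<dots> \<le> (s 0)\<^sup>2 * (vnorm w)\<^sup>2"
    unfolding sum_distrib_left[symmetric]
    by (intro mult_left_mono Bessel[OF is_svd_orthonormal(2)[OF svd A] w]) auto
  finally have "(vnorm (A *\<^sub>v w))\<^sup>2 \<le> (s 0 * vnorm w)\<^sup>2" by (simp add: power_mult_distrib)
  then show ?thesis using s0 by (simp add: power2_le_iff_abs_le)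
qed

lemma svd_right_vec:
  assumes svd: "is_svd rK A s x y" and A: "A \<in> carrier_mat n m" and k: "k < min n m"
  shows "A *\<^sub>v y k = complex_of_real (s k) \<cdot>\<^sub>v x k"
proof -
  let ?q = "min n m"
  have o: "orthonormal_fam m ?q y" "orthonormal_fam n ?q x" using is_svd_orthonormal[OF svd A] by auto
  have "A *\<^sub>v y k = lincomb n ?q (\<lambda>l. complex_of_real (s l) * cinner (y k) (y l)) x"
    by (rule svd_mult_vec[OF svd A]) (use o k in \<open>auto simp: orthonormal_fam_def\<close>)
  also have "\<dots> = complex_of_real (s k) \<cdot>\<^sub>v x k"
  proof (rule eq_vecI)
    fix i assume "i < dim_vec (complex_of_real (s k) \<cdot>\<^sub>v x k)"
    then have i: "i < n" using o(2) k by (auto simp: orthonormal_fam_def)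
    have "lincomb n ?q (\<lambda>l. complex_of_real (s l) * cinner (y k) (y l)) x $ i
        = (\<Sum>l<?q. if l = k then complex_of_real (s l) * x l $ i else 0)"
    proof -
      have "cinner (y k) (y l) = (if l = k then 1 else 0)" if "l < ?q" for l
        using o(1) k that by (auto simp: orthonormal_fam_def)
      then have "(\<Sum>l<?q. complex_of_real (s l) * cinner (y k) (y l) * x l $ i)
          = (\<Sum>l<?q. if l = k then complex_of_real (s l) * x l $ i else 0)"
        by (intro sum.cong) auto
      then show ?thesis using i by (simp add: lincomb_def)
    qed
    also have "\<dots> = complex_of_real (s k) * x k $ i" using k by simp
    finally show "lincomb n ?q (\<lambda>l. complex_of_real (s l) * cinner (y k) (y l)) x $ i
        = (complex_of_real (s k) \<cdot>\<^sub>v x k) $ i" using i o k by (auto simp: orthonormal_fam_def)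
  qed (use o k in \<open>auto simp: lincomb_def orthonormal_fam_def\<close>)
  finally show ?thesis .
qed

text \<open>The common initial segment cancels. At the first index where the sequences differ the
  larger value dominates, because its powers outgrow n times the powers of the smaller one.\<close>

lemma power_sums_determine:
  fixes s t :: "nat \<Rightarrow> real"
  assumes s: "\<And>i. i < n \<Longrightarrow> 0 \<le> s i" "\<And>i j. i \<le> j \<Longrightarrow> j < n \<Longrightarrow> s j \<le> s i"
    and t: "\<And>i. i < n \<Longrightarrow> 0 \<le> t i" "\<And>i j. i \<le> j \<Longrightarrow> j < n \<Longrightarrow> t j \<le> t i"
    and eq: "\<And>k. k > 0 \<Longrightarrow> (\<Sum>i<n. s i ^ (2 * k)) = (\<Sum>i<n. t i ^ (2 * k))"
    and i: "i < n"
  shows "s i = t i"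
  using i
proof (induction i rule: less_induct)
  case (less i)
  \<comment> \<open>Stated for arbitrary \<open>s\<close> and \<open>t\<close>, so that both
    possible orders at index \<open>i\<close> are covered by one argument.\<close>
  have aux: False if s: "\<And>i. i < n \<Longrightarrow> 0 \<le> s i" and t: "\<And>i. i < n \<Longrightarrow> 0 \<le> t i" "\<And>i j. i \<le> j \<Longrightarrow> j < n \<Longrightarrow> t j \<le> t i"
    and eq: "\<And>k. k > 0 \<Longrightarrow> (\<Sum>i<n. s i ^ (2 * k)) = (\<Sum>i<n. t i ^ (2 * k))"
    and eq': "\<And>j. j < i \<Longrightarrow> s j = t j" and lt: "t i < s i" for s t :: "nat \<Rightarrow> real"
  proof -
    have split: "(\<Sum>j<n. f j) = (\<Sum>j<i. f j) + (\<Sum>j=i..<n. f j)" for f :: "nat \<Rightarrow> real"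
      using less.prems by (simp add: lessThan_atLeast0 sum.atLeastLessThan_concat)
    have bound: "s i ^ (2 * k) \<le> real n * t i ^ (2 * k)" if "k > 0" for k
    proof -
      have "s i ^ (2 * k) \<le> (\<Sum>j=i..<n. s j ^ (2 * k))"
        by (rule member_le_sum) (use less.prems s in auto)
      also have "\<dots> = (\<Sum>j=i..<n. t j ^ (2 * k))"
        using eq[OF that] eq' by (simp add: split)
      also have "\<dots> \<le> (\<Sum>j=i..<n. t i ^ (2 * k))"
        by (intro sum_mono power_mono) (use t in auto)
      also have "\<dots> \<le> real n * t i ^ (2 * k)"
        by (simp add: mult_right_mono)
      finally show ?thesis .
    qed
    show False
    proof (cases "t i = 0")
      case True
      then show ?thesis using bound[of 1] lt by simp
    next
      case False
      then have tp: "t i > 0" using t(1)[OF less.prems] by simp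
      then have "1 < s i / t i" using lt by simp
      then obtain k where k: "real n < (s i / t i) ^ k" using real_arch_pow by blast
      \<comment> \<open>The exponent is raised to a positive even number, the only kind that
        \<open>eq\<close> speaks about.\<close>
      also have "(s i / t i) ^ k \<le> (s i / t i) ^ (2 * (k + 1))"
        using \<open>1 < s i / t i\<close> by (intro power_increasing) auto
      also have "\<dots> \<le> real n"
        using bound[of "k + 1"] tp by (simp add: power_divide divide_le_eq del: power_Suc)
      finally show False by simp
    qed
  qed
  show ?case
  proof (rule ccontr)
    have eq': "s j = t j" if "j < i" for j
      using less.IH[OF that] that less.prems by simp
    assume "s i \<noteq> t i"
    then consider "t i < s i" | "s i < t i" by linarith
    then show False
    proof cases
      case 1
      from aux[of s t, OF s(1) t eq eq' 1] show False by blast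
    next
      case 2
      from aux[of t s, OF t(1) s eq[symmetric] eq'[symmetric] 2] show False by blast
    qed
  qed
qed

text \<open>The traces of the Gram powers are the even power sums of the singular values, and they
  depend on the matrix alone.\<close>

lemma svd_unique:
  assumes "is_svd rK A s x y" "is_svd rK' A s' x' y'" "A \<in> carrier_mat n m" "i < min n m"
  shows "s i = s' i"
proof (rule power_sums_determine[of "min n m"])
  fix k :: nat assume k: "k > 0"
  show "(\<Sum>i<min n m. s i ^ (2 * k)) = (\<Sum>i<min n m. s' i ^ (2 * k))"
    using trace_gpow_svd[OF assms(1,3) k] trace_gpow_svd[OF assms(2,3) k] by (metis of_real_eq_iff)
qed (use assms is_svd_nonneg is_svd_decreasing in blast)+

section \<open>Existence of singular value decompositions by compactness\<close>

lemma bounded_coordinates_subseq: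
  fixes f :: "nat \<Rightarrow> nat \<Rightarrow> complex"
  assumes "\<And>k i. i < d \<Longrightarrow> cmod (f k i) \<le> B"
  shows "\<exists>r l. strict_mono r \<and> (\<forall>i<d. (\<lambda>k. f (r k) i) \<longlonglongrightarrow> l i)"
  using assms
proof (induction d)
  case 0
  then show ?case by (intro exI[of _ id]) (auto simp: strict_mono_id)
next
  case (Suc d)
  then obtain r l where r: "strict_mono r" "\<And>i. i < d \<Longrightarrow> (\<lambda>k. f (r k) i) \<longlonglongrightarrow> l i"
    by (metis less_SucI)
  have "bounded (range (\<lambda>k. f (r k) d))"
    using Suc.prems by (auto simp: bounded_iff)
  then obtain l' r' where r': "strict_mono r'" "((\<lambda>k. f (r k) d) \<circ> r') \<longlonglongrightarrow> l'"
    using bounded_imp_convergent_subsequence by blast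
  have "\<forall>i<Suc d. (\<lambda>k. f ((r \<circ> r') k) i) \<longlonglongrightarrow> (l(d := l')) i"
  proof (intro allI impI)
    fix i assume "i < Suc d"
    show "(\<lambda>k. f ((r \<circ> r') k) i) \<longlonglongrightarrow> (l(d := l')) i"
    proof (cases "i = d")
      case True
      then show ?thesis using r'(2) by (simp add: o_def)
    next
      case False
      then show ?thesis
        using LIMSEQ_subseq_LIMSEQ[OF r(2)[of i] r'(1)] \<open>i < Suc d\<close> by (simp add: o_def)
    qed
  qed
  then show ?case using strict_mono_o[OF r(1) r'(1)] by blast
qed

lemma unit_vec_seq_subseq:
  fixes x :: "nat \<Rightarrow> complex vec"
  assumes "\<And>k. x k \<in> carrier_vec d" "\<And>k. vnorm (x k) = 1"
  shows "\<exists>r l. strict_mono r \<and> l \<in> carrier_vec d \<and> (\<forall>i<d. (\<lambda>k. x (r k) $ i) \<longlonglongrightarrow> l $ i)"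
proof -
  have "cmod (x k $ i) \<le> 1" if "i < d" for k i
  proof -
    have "(cmod (x k $ i))\<^sup>2 \<le> (\<Sum>j<dim_vec (x k). (cmod (x k $ j))\<^sup>2)"
      by (rule member_le_sum) (use that assms(1)[of k] in auto)
    also have "\<dots> = 1" using vnorm_sq[of "x k"] assms(2) by simp
    finally show ?thesis by (simp add: power_le_one_iff)
  qed
  then obtain r l where "strict_mono r" "\<forall>i<d. (\<lambda>k. x (r k) $ i) \<longlonglongrightarrow> l i"
    using bounded_coordinates_subseq[of d "\<lambda>k i. x k $ i" 1] by blast
  then show ?thesis by (intro exI[of _ r] exI[of _ "vec d l"]) auto
qed

lemma tendsto_cinner:
  assumes "\<And>k. x k \<in> carrier_vec d" "l \<in> carrier_vec d" "\<And>i. i < d \<Longrightarrow> (\<lambda>k. x k $ i) \<longlonglongrightarrow> l $ i"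
    and "\<And>k. y k \<in> carrier_vec d" "l' \<in> carrier_vec d" "\<And>i. i < d \<Longrightarrow> (\<lambda>k. y k $ i) \<longlonglongrightarrow> l' $ i"
  shows "(\<lambda>k. cinner (x k) (y k)) \<longlonglongrightarrow> cinner l l'"
  unfolding cinner_eq_sum[OF assms(1)] cinner_eq_sum[OF assms(2)]
  by (intro tendsto_sum tendsto_mult tendsto_cnj) (use assms in auto)

definition unit_complement :: "nat \<Rightarrow> nat \<Rightarrow> (nat \<Rightarrow> complex vec) \<Rightarrow> complex vec set" where
  "unit_complement d k x = {w \<in> carrier_vec d. vnorm w = 1 \<and> (\<forall>i<k. cinner w (x i) = 0)}"

lemma unit_complement_limit:
  assumes "\<And>k. w k \<in> unit_complement d q x" "l \<in> carrier_vec d"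
    "\<And>i. i < d \<Longrightarrow> (\<lambda>k. w k $ i) \<longlonglongrightarrow> l $ i" "\<And>i. i < q \<Longrightarrow> x i \<in> carrier_vec d"
  shows "l \<in> unit_complement d q x"
proof -
  have w: "\<And>k. w k \<in> carrier_vec d" "\<And>k. cinner (w k) (w k) = 1" "\<And>k i. i < q \<Longrightarrow> cinner (w k) (x i) = 0"
    using assms(1) unfolding unit_complement_def vnorm_eq_1_iff by auto
  have "(\<lambda>k. cinner (w k) (w k)) \<longlonglongrightarrow> cinner l l"
    by (rule tendsto_cinner[of _ d]) (use w assms in auto)
  then have "cinner l l = 1" using w(2) by (simp add: LIMSEQ_const_iff)
  moreover have "cinner l (x i) = 0" if "i < q" for i
  proof -
    have "(\<lambda>k. cinner (w k) (x i)) \<longlonglongrightarrow> cinner l (x i)"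
      by (rule tendsto_cinner[of _ d]) (use w assms that in auto)
    then show ?thesis using w(3)[OF that] by (simp add: LIMSEQ_const_iff)
  qed
  ultimately show ?thesis using assms(2) unfolding unit_complement_def vnorm_eq_1_iff by auto
qed

text \<open>Sequential compactness of the two constraint sets, taken coordinatewise: one subsequence
  for the left vectors, a further one for the right vectors.\<close>

lemma bilinear_form_attains_max:
  assumes A: "A \<in> carrier_mat n m"
    and x: "\<And>i. i < k \<Longrightarrow> x i \<in> carrier_vec n" and y: "\<And>i. i < k \<Longrightarrow> y i \<in> carrier_vec m"
    and ne: "unit_complement n k x \<noteq> {}" "unit_complement m k y \<noteq> {}"
  obtains p q where "p \<in> unit_complement n k x" "q \<in> unit_complement m k y"
    "\<And>p' q'. p' \<in> unit_complement n k x \<Longrightarrow> q' \<in> unit_complement m k y \<Longrightarrow>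
       Re (cinner (A *\<^sub>v q') p') \<le> Re (cinner (A *\<^sub>v q) p)"
proof -
  define P where "P = unit_complement n k x \<times> unit_complement m k y"
  define F where "F = (\<lambda>(p,q). Re (cinner (A *\<^sub>v q) p))"
  have Pne: "P \<noteq> {}" using ne by (auto simp: P_def)
  have Pc: "fst z \<in> carrier_vec n" "snd z \<in> carrier_vec m" "vnorm (fst z) = 1" "vnorm (snd z) = 1" if "z \<in> P" for z
    using that by (auto simp: P_def unit_complement_def)
  have subseq: "\<exists>r p q. strict_mono r \<and> (p, q) \<in> P \<and> (\<lambda>k. F (z (r k))) \<longlonglongrightarrow> F (p, q)" if z: "\<And>k. z k \<in> P" for z :: "nat \<Rightarrow> _"
  proof -
    obtain r p where r: "strict_mono r" "p \<in> carrier_vec n" "\<forall>i<n. (\<lambda>k. fst (z (r k)) $ i) \<longlonglongrightarrow> p $ i"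
      using unit_vec_seq_subseq[of "\<lambda>k. fst (z k)" n] z Pc by blast
    obtain r' q where r': "strict_mono r'" "q \<in> carrier_vec m" "\<forall>i<m. (\<lambda>k. snd (z (r (r' k))) $ i) \<longlonglongrightarrow> q $ i"
      using unit_vec_seq_subseq[of "\<lambda>k. snd (z (r k))" m] z Pc by blast
    define R where "R = r \<circ> r'"
    have R: "strict_mono R" unfolding R_def by (rule strict_mono_o[OF r(1) r'(1)])
    have limp: "(\<lambda>k. fst (z (R k)) $ i) \<longlonglongrightarrow> p $ i" if "i < n" for i
      using LIMSEQ_subseq_LIMSEQ[OF r(3)[rule_format, OF that] r'(1)] by (simp add: R_def o_def)
    have limq: "(\<lambda>k. snd (z (R k)) $ i) \<longlonglongrightarrow> q $ i" if "i < m" for i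
      using r'(3) that by (simp add: R_def)
    have "p \<in> unit_complement n k x"
      by (rule unit_complement_limit[of "\<lambda>j. fst (z (R j))"]) (use z r limp x in \<open>auto simp: P_def mem_Times_iff\<close>)
    moreover have "q \<in> unit_complement m k y"
      by (rule unit_complement_limit[of "\<lambda>j. snd (z (R j))"]) (use z r' limq y in \<open>auto simp: P_def mem_Times_iff\<close>)
    moreover have "(\<lambda>k. cinner (A *\<^sub>v snd (z (R k))) (fst (z (R k)))) \<longlonglongrightarrow> cinner (A *\<^sub>v q) p"
    proof (rule tendsto_cinner[of _ n])
      fix i assume i: "i < n"
      have "(\<lambda>k. \<Sum>j<m. A $$ (i,j) * snd (z (R k)) $ j) \<longlonglongrightarrow> (\<Sum>j<m. A $$ (i,j) * q $ j)"
        by (intro tendsto_sum tendsto_mult tendsto_const limq) auto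
      then show "(\<lambda>k. (A *\<^sub>v snd (z (R k))) $ i) \<longlonglongrightarrow> (A *\<^sub>v q) $ i"
        using mult_mat_vec_index_sum[OF A r'(2) i] mult_mat_vec_index_sum[OF A Pc(2)[OF z] i]
        by (simp del: index_mult_mat_vec)
    qed (use A Pc z r r' limp in auto)
    ultimately show ?thesis
      using R unfolding P_def F_def
      by (intro exI[of _ R] exI[of _ p] exI[of _ q]) (auto simp: case_prod_unfold intro: tendsto_Re)
  qed
  \<comment> \<open>An unbounded form would exceed every k at some point \<open>z k\<close>; along
    the subsequence the values would both converge and tend to infinity.\<close>
  have bdd: "bdd_above (F ` P)"
  proof (rule ccontr)
    assume "\<not> ?thesis"
    then have "\<forall>k. \<exists>z\<in>P. real k < F z" unfolding bdd_above_def by (auto simp: not_le) 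
    then obtain z where z: "\<And>k. z k \<in> P" "\<And>k::nat. real k < F (z k)" by metis
    obtain r l where r: "strict_mono r" "(\<lambda>k. F (z (r k))) \<longlonglongrightarrow> l"
      using subseq[of z, OF z(1)] by blast
    have "real k \<le> F (z (r k))" for k
      using z(2)[of "r k"] seq_suble[OF r(1), of k] by linarith
    then have "filterlim (\<lambda>k. F (z (r k))) at_top sequentially"
      by (intro filterlim_at_top_mono[OF filterlim_real_sequentially]) auto
    then show False using r(2) not_tendsto_and_filterlim_at_infinity filterlim_at_top_imp_at_infinity
      by (metis sequentially_bot)
  qed
  define M where "M = Sup (F ` P)"
  have "\<exists>z\<in>P. M - 1 / real (Suc k) < F z" for k
    using less_cSup_iff[of "F ` P" "M - 1 / real (Suc k)"] Pne bdd unfolding M_def by auto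
  then obtain z where z: "\<And>k. z k \<in> P" "\<And>k. M - 1 / real (Suc k) < F (z k)" by metis
  obtain r p q where r: "strict_mono r" "(p, q) \<in> P" "(\<lambda>k. F (z (r k))) \<longlonglongrightarrow> F (p, q)"
    using subseq[of z, OF z(1)] by blast
  have "(\<lambda>k. M - 1 / real (Suc k)) \<longlonglongrightarrow> M - 0"
    by (intro tendsto_diff tendsto_const lim_1_over_n[THEN LIMSEQ_Suc])
  then have "(\<lambda>k. M - 1 / real (Suc (r k))) \<longlonglongrightarrow> M"
    using LIMSEQ_subseq_LIMSEQ[OF _ r(1)] by (simp add: o_def)
  then have "M \<le> F (p, q)"
    by (rule LIMSEQ_le[OF _ r(3)]) (use z(2) in \<open>auto intro: less_imp_le\<close>)
  show ?thesis
  proof (rule that[of p q])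
    fix p' q' assume "p' \<in> unit_complement n k x" "q' \<in> unit_complement m k y"
    then have "F (p', q') \<le> M" unfolding M_def by (intro cSup_upper bdd) (auto simp: P_def)
    then show "Re (cinner (A *\<^sub>v q') p') \<le> Re (cinner (A *\<^sub>v q) p)"
      using \<open>M \<le> F (p, q)\<close> by (simp add: F_def)
  qed (use r(2) in \<open>auto simp: P_def\<close>)
qed

text \<open>This is the equality case of the Cauchy--Schwarz inequality.\<close>
lemma maximizer_parallel:
  assumes w: "w \<in> carrier_vec d" and x: "\<And>i. i < k \<Longrightarrow> x i \<in> carrier_vec d"
    and orth: "\<And>i. i < k \<Longrightarrow> cinner w (x i) = 0"
    and p: "p \<in> unit_complement d k x"
    and max: "\<And>p'. p' \<in> unit_complement d k x \<Longrightarrow> Re (cinner w p') \<le> Re (cinner w p)"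
    and nonneg: "0 \<le> Re (cinner w p)"
  shows "w = complex_of_real (Re (cinner w p)) \<cdot>\<^sub>v p"
proof (rule vec_eqI_vnorm[OF w])
  let ?s = "Re (cinner w p)"
  have pc: "p \<in> carrier_vec d" "vnorm p = 1" using p by (auto simp: unit_complement_def)
  then show "complex_of_real ?s \<cdot>\<^sub>v p \<in> carrier_vec d" by simp
  have le: "vnorm w \<le> ?s"
  proof (cases "vnorm w = 0")
    case False
    let ?w = "complex_of_real (1 / vnorm w) \<cdot>\<^sub>v w"
    have "?w \<in> unit_complement d k x"
      using w orth vnorm_normalized[OF False] by (auto simp: unit_complement_def cinner_smult_left)
    from max[OF this] have "Re (cinner w ?w) \<le> ?s" .
    moreover have "cinner w ?w = complex_of_real (vnorm w)"
      using w False by (simp add: cinner_smult_right[of _ d] cinner_self power2_eq_square)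
    ultimately show ?thesis by simp
  qed (use nonneg in simp)
  have "cinner w (complex_of_real ?s \<cdot>\<^sub>v p) = complex_of_real ?s * cinner w p"
    using w pc by (simp add: cinner_smult_right[of _ d])
  then have "(vnorm (w - complex_of_real ?s \<cdot>\<^sub>v p))\<^sup>2 = (vnorm w)\<^sup>2 - ?s\<^sup>2"
    using w pc by (subst vnorm_minus_sq[of _ d]) (auto simp: vnorm_smult power2_eq_square)
  also have "\<dots> \<le> 0" using le by (simp add: power_mono)
  finally show "(vnorm (w - complex_of_real ?s \<cdot>\<^sub>v p))\<^sup>2 \<le> 0" .
qed

text \<open>The clause about \<open>unit_complement\<close> records that what remains of
  \<open>A\<close> is dominated by every value chosen so far. It makes the next maximum
  automatically no larger than its predecessors.\<close>

definition partial_svd :: "complex mat \<Rightarrow> nat \<Rightarrow> (nat \<Rightarrow> real) \<Rightarrow> (nat \<Rightarrow> complex vec) \<Rightarrow> (nat \<Rightarrow> complex vec) \<Rightarrow> bool" where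
  "partial_svd A k s x y \<longleftrightarrow>
     orthonormal_fam (dim_row A) k x \<and> orthonormal_fam (dim_col A) k y \<and>
     (\<forall>i<k. 0 \<le> s i \<and> A *\<^sub>v y i = complex_of_real (s i) \<cdot>\<^sub>v x i \<and> adjoint_mat A *\<^sub>v x i = complex_of_real (s i) \<cdot>\<^sub>v y i) \<and>
     (\<forall>i<k. \<forall>p\<in>unit_complement (dim_row A) k x. \<forall>q\<in>unit_complement (dim_col A) k y. Re (cinner (A *\<^sub>v q) p) \<le> s i) \<and>
     (\<forall>i j. i \<le> j \<and> j < k \<longrightarrow> s j \<le> s i)"

text \<open>A maximiser (p,q) of the remaining bilinear form is a singular pair. With q fixed, p
  maximises a linear functional over the unit vectors of the complement and is therefore parallel to
  A q; with p fixed, q is parallel to A^H p. Both images lie in the complements because the earlier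
  vectors are singular pairs.\<close>

lemma partial_svd_extend:
  assumes A: "A \<in> carrier_mat n m" and k: "k < n" "k < m" and ps: "partial_svd A k s x y"
  shows "\<exists>s x y. partial_svd A (Suc k) s x y"
proof -
  have dims: "dim_row A = n" "dim_col A = m" using A by auto
  have o: "orthonormal_fam n k x" "orthonormal_fam m k y" using ps dims by (auto simp: partial_svd_def)
  have xc: "x i \<in> carrier_vec n" and yc: "y i \<in> carrier_vec m" if "i < k" for i
    using o that by (auto simp: orthonormal_fam_def)
  have ne: "unit_complement n k x \<noteq> {}" "unit_complement m k y \<noteq> {}"
    using exists_unit_orthogonal[OF o(1) k(1)] exists_unit_orthogonal[OF o(2) k(2)]
    by (auto simp: unit_complement_def)
  obtain p q where p: "p \<in> unit_complement n k x" and q: "q \<in> unit_complement m k y"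
    and max: "\<And>p' q'. p' \<in> unit_complement n k x \<Longrightarrow> q' \<in> unit_complement m k y \<Longrightarrow>
       Re (cinner (A *\<^sub>v q') p') \<le> Re (cinner (A *\<^sub>v q) p)"
    using bilinear_form_attains_max[OF A xc yc ne] by blast
  define \<sigma> where "\<sigma> = Re (cinner (A *\<^sub>v q) p)"
  have pc: "p \<in> carrier_vec n" "vnorm p = 1" "\<And>i. i < k \<Longrightarrow> cinner p (x i) = 0"
    and qc: "q \<in> carrier_vec m" "vnorm q = 1" "\<And>i. i < k \<Longrightarrow> cinner q (y i) = 0"
    using p q by (auto simp: unit_complement_def)
  have Aq: "A *\<^sub>v q \<in> carrier_vec n" and Ap: "adjoint_mat A *\<^sub>v p \<in> carrier_vec m"
    using A pc qc by (auto intro!: mult_mat_vec_carrier)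
  \<comment> \<open>Comparing the maximiser with -p shows that the maximum is nonnegative.\<close>
  have "Re (cinner (A *\<^sub>v q) ((-1) \<cdot>\<^sub>v p)) \<le> \<sigma>"
    unfolding \<sigma>_def by (rule max[OF _ q]) (use pc in \<open>auto simp: unit_complement_def vnorm_smult cinner_smult_left\<close>)
  moreover have "cinner (A *\<^sub>v q) ((-1) \<cdot>\<^sub>v p) = - cinner (A *\<^sub>v q) p"
    using cinner_smult_right[OF Aq pc(1), of "-1"] by simp
  ultimately have \<sigma>0: "0 \<le> \<sigma>" by (simp add: \<sigma>_def)
  have sv: "A *\<^sub>v y i = complex_of_real (s i) \<cdot>\<^sub>v x i" "adjoint_mat A *\<^sub>v x i = complex_of_real (s i) \<cdot>\<^sub>v y i" if "i < k" for i
    using ps that by (auto simp: partial_svd_def)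
  have Aq_eq: "A *\<^sub>v q = complex_of_real \<sigma> \<cdot>\<^sub>v p"
    unfolding \<sigma>_def
  proof (rule maximizer_parallel[OF Aq xc _ p])
    fix i assume i: "i < k"
    have "cinner (A *\<^sub>v q) (x i) = cinner q (complex_of_real (s i) \<cdot>\<^sub>v y i)"
      using cinner_mult_mat_vec[OF A qc(1) xc[OF i]] sv(2)[OF i] by simp
    then show "cinner (A *\<^sub>v q) (x i) = 0"
      using cinner_smult_right[OF qc(1) yc[OF i]] qc(3)[OF i] by simp
  qed (use max q \<sigma>0 in \<open>auto simp: \<sigma>_def\<close>)
  have flip: "Re (cinner (adjoint_mat A *\<^sub>v p) q') = Re (cinner (A *\<^sub>v q') p)" if "q' \<in> carrier_vec m" for q'
  proof -
    have "cinner (adjoint_mat A *\<^sub>v p) q' = cnj (cinner q' (adjoint_mat A *\<^sub>v p))"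
      by (rule cinner_commute[OF that Ap])
    then show ?thesis using cinner_mult_mat_vec[OF A that pc(1)] by simp
  qed
  have "adjoint_mat A *\<^sub>v p = complex_of_real (Re (cinner (adjoint_mat A *\<^sub>v p) q)) \<cdot>\<^sub>v q"
  proof (rule maximizer_parallel[OF Ap yc _ q])
    fix i assume i: "i < k"
    have "cinner (adjoint_mat A *\<^sub>v p) (y i) = cinner p (A *\<^sub>v y i)"
      using cinner_mult_mat_vec[of "adjoint_mat A" m n p "y i"] A pc yc[OF i] by simp
    then show "cinner (adjoint_mat A *\<^sub>v p) (y i) = 0"
      using cinner_smult_right[OF pc(1) xc[OF i]] pc(3)[OF i] sv(1)[OF i] by simp
  next
    fix q' assume "q' \<in> unit_complement m k y"
    then show "Re (cinner (adjoint_mat A *\<^sub>v p) q') \<le> Re (cinner (adjoint_mat A *\<^sub>v p) q)"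
      using max[OF p] flip qc(1) by (auto simp: unit_complement_def)
  qed (use \<sigma>0 flip qc(1) in \<open>auto simp: \<sigma>_def\<close>)
  then have Ap_eq: "adjoint_mat A *\<^sub>v p = complex_of_real \<sigma> \<cdot>\<^sub>v q"
    using flip[OF qc(1)] by (simp add: \<sigma>_def)
  have "cinner (x i) p = 0" "cinner (y i) q = 0" if "i < k" for i
    using cinner_commute[OF pc(1) xc[OF that]] pc(3)[OF that] cinner_commute[OF qc(1) yc[OF that]] qc(3)[OF that]
    by auto
  then have o': "orthonormal_fam n (Suc k) (x(k := p))" "orthonormal_fam m (Suc k) (y(k := q))"
    using o pc qc unfolding vnorm_eq_1_iff by (auto simp: orthonormal_fam_def less_Suc_eq)
  have sub: "unit_complement n (Suc k) (x(k := p)) \<subseteq> unit_complement n k x"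
    "unit_complement m (Suc k) (y(k := q)) \<subseteq> unit_complement m k y"
    by (auto simp: unit_complement_def less_Suc_eq)
  have \<sigma>_le: "\<sigma> \<le> s i" if "i < k" for i
    using ps p q that dims unfolding \<sigma>_def partial_svd_def by blast
  have "partial_svd A (Suc k) (s(k := \<sigma>)) (x(k := p)) (y(k := q))"
    unfolding partial_svd_def dims
  proof (intro conjI o' allI impI ballI)
    fix i assume i: "i < Suc k"
    show "0 \<le> (s(k := \<sigma>)) i" "A *\<^sub>v (y(k := q)) i = complex_of_real ((s(k := \<sigma>)) i) \<cdot>\<^sub>v (x(k := p)) i"
      "adjoint_mat A *\<^sub>v (x(k := p)) i = complex_of_real ((s(k := \<sigma>)) i) \<cdot>\<^sub>v (y(k := q)) i"
      using i \<sigma>0 Aq_eq Ap_eq sv ps by (auto simp: less_Suc_eq partial_svd_def)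
    fix p' q' assume "p' \<in> unit_complement n (Suc k) (x(k := p))" "q' \<in> unit_complement m (Suc k) (y(k := q))"
    then have "Re (cinner (A *\<^sub>v q') p') \<le> \<sigma>" using max sub unfolding \<sigma>_def by blast
    then show "Re (cinner (A *\<^sub>v q') p') \<le> (s(k := \<sigma>)) i" using i \<sigma>_le by (force simp: less_Suc_eq)
  next
    fix i j assume "i \<le> j \<and> j < Suc k"
    then show "(s(k := \<sigma>)) j \<le> (s(k := \<sigma>)) i"
      using \<sigma>_le ps by (auto simp: less_Suc_eq partial_svd_def)
  qed
  then show ?thesis by blast
qed

text \<open>As n <= m, the process runs until the n left vectors form a basis of the space
  containing the columns; expanding each column in it recovers the matrix. Complex singular vectors
  suffice, since \<open>sing_vals\<close> refers to the complex notion.\<close>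

theorem svd_exists:
  assumes A: "A \<in> carrier_mat n m" and nm: "n \<le> m"
  shows "\<exists>s x y. is_svd False A s x y"
proof -
  have "\<exists>s x y. partial_svd A k s x y" if "k \<le> n" for k
    using that
  proof (induction k)
    case 0
    then show ?case by (auto simp: partial_svd_def orthonormal_fam_def)
  next
    case (Suc k)
    then obtain s x y where "partial_svd A k s x y" by auto
    then show ?case using partial_svd_extend[OF A, of k] Suc.prems nm by simp
  qed
  then obtain s x y where ps: "partial_svd A n s x y" by blast
  have dims: "dim_row A = n" "dim_col A = m" "min n m = n" using A nm by auto
  have o: "orthonormal_fam n n x" "orthonormal_fam m n y" using ps dims by (auto simp: partial_svd_def)
  have xc: "x i \<in> carrier_vec n" and yc: "y i \<in> carrier_vec m" if "i < n" for i
    using o that by (auto simp: orthonormal_fam_def)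
  have "A $$ (i,j) = (\<Sum>k<n. complex_of_real (s k) * x k $ i * cnj (y k $ j))" if ij: "i < n" "j < m" for i j
  proof -
    have Ae: "A *\<^sub>v unit_vec m j \<in> carrier_vec n" using A by auto
    have "A $$ (i,j) = (A *\<^sub>v unit_vec m j) $ i"
      using A ij by simp
    also have "\<dots> = lincomb n n (\<lambda>k. cinner (A *\<^sub>v unit_vec m j) (x k)) x $ i"
      using orthonormal_basis_expansion[OF o(1) Ae] by simp
    also have "\<dots> = (\<Sum>k<n. cinner (A *\<^sub>v unit_vec m j) (x k) * x k $ i)"
      using ij by (simp add: lincomb_def)
    also have "\<dots> = (\<Sum>k<n. complex_of_real (s k) * x k $ i * cnj (y k $ j))"
    proof (rule sum.cong[OF refl])
      fix k assume "k \<in> {..<n}"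
      then have k: "k < n" by simp
      have "cinner (A *\<^sub>v unit_vec m j) (x k) = cinner (unit_vec m j) (complex_of_real (s k) \<cdot>\<^sub>v y k)"
        using cinner_mult_mat_vec[OF A _ xc[OF k], of "unit_vec m j"] ps k by (simp add: partial_svd_def)
      also have "\<dots> = complex_of_real (s k) * cnj (y k $ j)"
        using yc[OF k] ij by (subst cinner_unit_vec_left[of _ m]) auto
      finally show "cinner (A *\<^sub>v unit_vec m j) (x k) * x k $ i = complex_of_real (s k) * x k $ i * cnj (y k $ j)"
        by (simp add: mult_ac)
    qed
    finally show ?thesis .
  qed
  moreover have "0 \<le> s i" if "i < n" for i
    using ps that by (simp add: partial_svd_def)
  moreover have "s j \<le> s i" if "i \<le> j" "j < n" for i j
    using ps that by (simp add: partial_svd_def)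
  ultimately have "is_svd False A s x y"
    using o unfolding is_svd_def dims Let_def by simp
  then show ?thesis by blast
qed

lemma sing_vals_svd:
  assumes A: "A \<in> carrier_mat n m" and nm: "n \<le> m"
  shows "\<exists>x y. is_svd False A (sing_vals A) x y"
proof -
  have q: "min (dim_row A) (dim_col A) = n" "min n m = n" using A nm by auto
  obtain s x y where svd: "is_svd False A s x y" using svd_exists[OF A nm] by blast
  \<comment> \<open>\<open>is_svd\<close> leaves the values beyond the last index free; setting them
    to zero gives the sequence that the description in \<open>sing_vals\<close> singles out.\<close>
  define s' where "s' = (\<lambda>i. if i < n then s i else 0)"
  have "is_svd False A s' x y"
    using svd by (auto simp: is_svd_def q s'_def Let_def)
  then have ex: "(\<forall>i\<ge>n. s' i = 0) \<and> (\<exists>x y. is_svd False A s' x y)" by (auto simp: s'_def)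
  have uniq: "t = s'" if t: "(\<forall>i\<ge>n. t i = 0) \<and> (\<exists>x y. is_svd False A t x y)" for t
  proof
    fix i show "t i = s' i"
      using t ex svd_unique[OF _ _ A] q by (cases "i < n") (force, simp)
  qed
  have "(\<forall>i\<ge>n. sing_vals A i = 0) \<and> (\<exists>x y. is_svd False A (sing_vals A) x y)"
    unfolding sing_vals_def q
    by (rule theI[of "\<lambda>t. (\<forall>i\<ge>n. t i = 0) \<and> (\<exists>x y. is_svd False A t x y)" s', OF ex uniq])
  then show ?thesis by blast
qed

lemma svd_eq_sing_vals:
  assumes "is_svd rK A s x y" "A \<in> carrier_mat n m" "n \<le> m" "i < n"
  shows "s i = sing_vals A i"
  using sing_vals_svd[OF assms(2,3)] svd_unique[OF assms(1) _ assms(2)] assms(3,4) by auto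

section \<open>Singular values of rank-one perturbations\<close>

lemma outer_carrier [simp]: "outer u v \<in> carrier_mat (dim_vec u) (dim_vec v)"
  by (simp add: outer_def)

lemma outer_mult_vec:
  assumes "u \<in> carrier_vec n" "v \<in> carrier_vec m" "q \<in> carrier_vec m"
  shows "outer u v *\<^sub>v q = cinner q v \<cdot>\<^sub>v u"
proof (rule eq_vecI)
  fix i assume "i < dim_vec (cinner q v \<cdot>\<^sub>v u)"
  then have i: "i < n" using assms by simp
  have "(outer u v *\<^sub>v q) $ i = (\<Sum>j<m. outer u v $$ (i,j) * q $ j)"
    by (rule mult_mat_vec_index_sum) (use assms i outer_carrier[of u v] in auto)
  also have "\<dots> = (\<Sum>j<m. q $ j * cnj (v $ j) * u $ i)"
    by (rule sum.cong) (use assms i in \<open>auto simp: outer_def\<close>)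
  also have "\<dots> = (cinner q v \<cdot>\<^sub>v u) $ i"
    using assms i by (simp add: cinner_eq_sum[of _ m] sum_distrib_right)
  finally show "(outer u v *\<^sub>v q) $ i = (cinner q v \<cdot>\<^sub>v u) $ i" .
qed (use assms outer_carrier[of u v] in auto)

definition spiked :: "complex mat \<Rightarrow> real \<Rightarrow> complex vec \<Rightarrow> complex vec \<Rightarrow> complex mat" where
  "spiked A \<theta> u v = complex_of_real \<theta> \<cdot>\<^sub>m outer u v + A"

lemma spiked_carrier [simp]: "A \<in> carrier_mat n m \<Longrightarrow> spiked A \<theta> u v \<in> carrier_mat n m"
  by (auto simp: spiked_def)

lemma adjoint_spiked:
  assumes "A \<in> carrier_mat n m" "u \<in> carrier_vec n" "v \<in> carrier_vec m"
  shows "adjoint_mat (spiked A \<theta> u v) = spiked (adjoint_mat A) \<theta> v u"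
  using assms by (intro eq_matI) (auto simp: spiked_def outer_def)

lemma spiked_mult_vec:
  assumes "A \<in> carrier_mat n m" "u \<in> carrier_vec n" "v \<in> carrier_vec m" "q \<in> carrier_vec m"
  shows "spiked A \<theta> u v *\<^sub>v q = (complex_of_real \<theta> * cinner q v) \<cdot>\<^sub>v u + A *\<^sub>v q"
proof -
  have o: "outer u v \<in> carrier_mat n m" using assms outer_carrier[of u v] by auto
  have "spiked A \<theta> u v *\<^sub>v q = (complex_of_real \<theta> \<cdot>\<^sub>m outer u v) *\<^sub>v q + A *\<^sub>v q"
    unfolding spiked_def by (rule add_mult_distrib_mat_vec[of _ n m]) (use assms o in auto)
  also have "(complex_of_real \<theta> \<cdot>\<^sub>m outer u v) *\<^sub>v q = complex_of_real \<theta> \<cdot>\<^sub>v (outer u v *\<^sub>v q)"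
    using o assms by (intro eq_vecI) auto
  also have "\<dots> = (complex_of_real \<theta> * cinner q v) \<cdot>\<^sub>v u"
    using outer_mult_vec[OF assms(2-4)] by (simp add: smult_smult_assoc)
  finally show ?thesis .
qed

section \<open>Neumann expansion of the singular vector equations\<close>

lemma cinner_gpow_swap:
  assumes Y: "Y \<in> carrier_mat d e" and "x \<in> carrier_vec d" "w \<in> carrier_vec d"
  shows "cinner (gpow Y k *\<^sub>v x) w = cinner x (gpow Y k *\<^sub>v w)"
  using cinner_mult_mat_vec[OF gpow_carrier[OF Y] assms(2,3)] adjoint_gpow[OF Y] by simp

lemma cinner_gpow_gpow:
  assumes Y: "Y \<in> carrier_mat d e" and x: "x \<in> carrier_vec d" and w: "w \<in> carrier_vec d"
  shows "cinner (gpow Y k *\<^sub>v x) (gpow Y l *\<^sub>v w) = cinner (gpow Y (l + k) *\<^sub>v x) w"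
proof -
  have "cinner (gpow Y k *\<^sub>v x) (gpow Y l *\<^sub>v w) = cinner (gpow Y l *\<^sub>v (gpow Y k *\<^sub>v x)) w"
    by (rule cinner_gpow_swap[symmetric, OF Y])
      (use w mult_mat_vec_carrier[OF gpow_carrier[OF Y] x] in auto)
  also have "gpow Y l *\<^sub>v (gpow Y k *\<^sub>v x) = gpow Y (l + k) *\<^sub>v x"
    using gpow_add[OF Y, of l k] assoc_mult_mat_vec[OF gpow_carrier[OF Y] gpow_carrier[OF Y] x] by simp
  finally show ?thesis .
qed

text \<open>The mixed forms of the adjoint problem are conjugates of the original ones, so one
  family of limits serves both sides.\<close>

lemma cinner_gpow_adjoint:
  assumes Y: "Y \<in> carrier_mat d e" and u: "u \<in> carrier_vec d" and v: "v \<in> carrier_vec e"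
  shows "cinner (gpow (adjoint_mat Y) k *\<^sub>v (adjoint_mat Y *\<^sub>v u)) v
       = cnj (cinner (gpow Y k *\<^sub>v (Y *\<^sub>v v)) u)"
proof -
  have Y': "adjoint_mat Y \<in> carrier_mat e d" using Y by simp
  have Yu: "adjoint_mat Y *\<^sub>v u \<in> carrier_vec e" and Yv: "Y *\<^sub>v v \<in> carrier_vec d"
    using Y Y' u v by (auto intro: mult_mat_vec_carrier)
  have "cinner (gpow (adjoint_mat Y) k *\<^sub>v (adjoint_mat Y *\<^sub>v u)) v
      = cinner (adjoint_mat Y *\<^sub>v u) (gpow (adjoint_mat Y) k *\<^sub>v v)"
    by (rule cinner_gpow_swap[OF Y' Yu v])
  also have "\<dots> = cinner u (Y *\<^sub>v (gpow (adjoint_mat Y) k *\<^sub>v v))"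
    using cinner_mult_mat_vec[OF Y' u, of "gpow (adjoint_mat Y) k *\<^sub>v v"]
      mult_mat_vec_carrier[OF gpow_carrier[OF Y'] v] by simp
  also have "Y *\<^sub>v (gpow (adjoint_mat Y) k *\<^sub>v v) = gpow Y k *\<^sub>v (Y *\<^sub>v v)"
    using gpow_mult_swap[OF Y, of k] assoc_mult_mat_vec[OF gpow_carrier[OF Y] Y v]
      assoc_mult_mat_vec[OF Y gpow_carrier[OF Y'] v] by metis
  also have "cinner u (gpow Y k *\<^sub>v (Y *\<^sub>v v)) = cnj (cinner (gpow Y k *\<^sub>v (Y *\<^sub>v v)) u)"
    by (rule cinner_commute[OF _ u]) (rule mult_mat_vec_carrier[OF gpow_carrier[OF Y] Yv])
  finally show ?thesis .
qed

lemma gpow_Suc_vec: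
  assumes Y: "Y \<in> carrier_mat d e" and p: "p \<in> carrier_vec d"
  shows "gpow Y (Suc k) *\<^sub>v p = gpow Y k *\<^sub>v (Y *\<^sub>v (adjoint_mat Y *\<^sub>v p))"
proof -
  have "gpow Y (Suc k) *\<^sub>v p = gpow Y k *\<^sub>v ((Y * adjoint_mat Y) *\<^sub>v p)"
    unfolding gpow_Suc by (rule assoc_mult_mat_vec[of _ d d _ d]) (use Y p in auto)
  also have "(Y * adjoint_mat Y) *\<^sub>v p = Y *\<^sub>v (adjoint_mat Y *\<^sub>v p)"
    by (rule assoc_mult_mat_vec[of _ d e _ d]) (use Y p in auto)
  finally show ?thesis .
qed

lemma mult_mat_vec_smult:
  fixes c :: complex
  assumes "A \<in> carrier_mat n m" "w \<in> carrier_vec m"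
  shows "A *\<^sub>v (c \<cdot>\<^sub>v w) = c \<cdot>\<^sub>v (A *\<^sub>v w)"
  using assms by (rule mult_mat_vec)

text \<open>The Neumann expansion of the singular vector equations of a rank-one perturbation,
  stopped after \<^term>\<open>K\<close> terms.\<close>
lemma singular_vector_expansion:
  assumes Y: "Y \<in> carrier_mat d e" and u: "u \<in> carrier_vec d" and v: "v \<in> carrier_vec e"
    and p: "p \<in> carrier_vec d" and q: "q \<in> carrier_vec e" and s: "s > 0"
    and eq1: "complex_of_real s \<cdot>\<^sub>v p = \<beta> \<cdot>\<^sub>v u + Y *\<^sub>v q"
    and eq2: "complex_of_real s \<cdot>\<^sub>v q = \<alpha> \<cdot>\<^sub>v v + adjoint_mat Y *\<^sub>v p"
  shows "cinner p u = (\<Sum>j<K. \<beta> * cinner (gpow Y j *\<^sub>v u) u / complex_of_real (s ^ (2 * j + 1))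
             + \<alpha> * cinner (gpow Y j *\<^sub>v (Y *\<^sub>v v)) u / complex_of_real (s ^ (2 * j + 2)))
           + cinner (gpow Y K *\<^sub>v p) u / complex_of_real (s ^ (2 * K))"
proof (induction K)
  case 0
  then show ?case using Y p by simp
next
  case (Suc K)
  have Yq: "Y *\<^sub>v q \<in> carrier_vec d" and Yv: "Y *\<^sub>v v \<in> carrier_vec d"
    and Yp: "adjoint_mat Y *\<^sub>v p \<in> carrier_vec e" using Y p q v by (auto intro: mult_mat_vec_carrier)
  have YYp: "Y *\<^sub>v (adjoint_mat Y *\<^sub>v p) \<in> carrier_vec d" using Y Yp by (auto intro: mult_mat_vec_carrier)
  let ?G = "\<lambda>w. cinner (gpow Y K *\<^sub>v w) u"
  have Gadd: "?G (w + w') = ?G w + ?G w'" if "w \<in> carrier_vec d" "w' \<in> carrier_vec d" for w w'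
  proof -
    have "gpow Y K *\<^sub>v (w + w') = gpow Y K *\<^sub>v w + gpow Y K *\<^sub>v w'"
      by (rule mult_add_distrib_mat_vec[OF gpow_carrier[OF Y] that])
    then show ?thesis
      using that Y by (simp add: cinner_add_left[OF mult_mat_vec_carrier[OF gpow_carrier[OF Y]] mult_mat_vec_carrier[OF gpow_carrier[OF Y]]])
  qed
  have Gsm: "?G (c \<cdot>\<^sub>v w) = c * ?G w" if "w \<in> carrier_vec d" for c w
    by (simp add: mult_mat_vec_smult[OF gpow_carrier[OF Y] that] cinner_smult_left)
  have "complex_of_real s * ?G p = ?G (\<beta> \<cdot>\<^sub>v u + Y *\<^sub>v q)"
    using Gsm[OF p] eq1 by metis
  also have "\<dots> = \<beta> * ?G u + ?G (Y *\<^sub>v q)" using Gadd u Yq Gsm by simp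
  \<comment> \<open>Each round uses both singular vector equations: the first turns \<open>p\<close>
    into \<open>q\<close>, and after a second multiplication by \<open>s\<close> the other one turns
    \<open>q\<close> back into \<open>p\<close>, at the price of one Gram factor.\<close>
  finally have "complex_of_real s * (complex_of_real s * ?G p) = complex_of_real s * (\<beta> * ?G u) + complex_of_real s * ?G (Y *\<^sub>v q)"
    by (simp add: algebra_simps)
  moreover have "complex_of_real s * ?G (Y *\<^sub>v q) = ?G (Y *\<^sub>v (\<alpha> \<cdot>\<^sub>v v + adjoint_mat Y *\<^sub>v p))"
    using Gsm[OF Yq] mult_mat_vec_smult[OF Y q] eq2 by metis
  moreover have "Y *\<^sub>v (\<alpha> \<cdot>\<^sub>v v + adjoint_mat Y *\<^sub>v p) = \<alpha> \<cdot>\<^sub>v (Y *\<^sub>v v) + Y *\<^sub>v (adjoint_mat Y *\<^sub>v p)"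
    using mult_add_distrib_mat_vec[OF Y _ Yp, of "\<alpha> \<cdot>\<^sub>v v"] v mult_mat_vec_smult[OF Y v] by simp
  moreover have "?G (\<alpha> \<cdot>\<^sub>v (Y *\<^sub>v v) + Y *\<^sub>v (adjoint_mat Y *\<^sub>v p)) = \<alpha> * ?G (Y *\<^sub>v v) + cinner (gpow Y (Suc K) *\<^sub>v p) u"
    using Gadd Gsm Yv YYp gpow_Suc_vec[OF Y p] by simp
  ultimately have "?G p = \<beta> * ?G u / complex_of_real s + \<alpha> * ?G (Y *\<^sub>v v) / (complex_of_real s)\<^sup>2
      + cinner (gpow Y (Suc K) *\<^sub>v p) u / (complex_of_real s)\<^sup>2"
    using s by (simp add: field_simps power2_eq_square)
  then have "?G p / complex_of_real (s ^ (2 * K)) = \<beta> * ?G u / complex_of_real (s ^ (2 * K + 1))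
      + \<alpha> * ?G (Y *\<^sub>v v) / complex_of_real (s ^ (2 * K + 2)) + cinner (gpow Y (Suc K) *\<^sub>v p) u / complex_of_real (s ^ (2 * Suc K))"
    using s by (simp add: field_simps power2_eq_square)
  then show ?case using Suc by simp
qed

lemma vnorm_gpow_le:
  assumes svd: "is_svd rK Y s x y" and Y: "Y \<in> carrier_mat d e" and de: "0 < d" "0 < e" and p: "p \<in> carrier_vec d"
  shows "vnorm (gpow Y K *\<^sub>v p) \<le> s 0 ^ (2 * K) * vnorm p"
  using p
proof (induction K arbitrary: p)
  case 0
  then show ?case using Y by simp
next
  case (Suc K)
  have s0: "0 \<le> s 0" using is_svd_nonneg[OF svd Y] de by simp
  have Yp: "adjoint_mat Y *\<^sub>v p \<in> carrier_vec e" using Y Suc.prems by (auto intro: mult_mat_vec_carrier)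
  have YYp: "Y *\<^sub>v (adjoint_mat Y *\<^sub>v p) \<in> carrier_vec d" using Y Yp by (auto intro: mult_mat_vec_carrier)
  have "vnorm (gpow Y (Suc K) *\<^sub>v p) \<le> s 0 ^ (2 * K) * vnorm (Y *\<^sub>v (adjoint_mat Y *\<^sub>v p))"
    unfolding gpow_Suc_vec[OF Y Suc.prems] by (rule Suc.IH[OF YYp])
  also have "\<dots> \<le> s 0 ^ (2 * K) * (s 0 * vnorm (adjoint_mat Y *\<^sub>v p))"
    by (intro mult_left_mono svd_op_bound[OF svd Y Yp de]) (use s0 in auto)
  also have "\<dots> \<le> s 0 ^ (2 * K) * (s 0 * (s 0 * vnorm p))"
    by (intro mult_left_mono svd_op_bound[OF is_svd_adjoint[OF is_svd_FalseI[OF svd]] _ Suc.prems de(2,1)]) (use s0 Y in auto)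
  finally show ?case by (simp add: algebra_simps)
qed

text \<open>The remainder is at most \<open>(t 0 / s) ^ (2 * K)\<close>, hence negligible for large
  K once \<open>s\<close> exceeds the norm \<open>t 0\<close> of the unperturbed matrix.\<close>

lemma cmod_cinner_overlap_le:
  assumes Y: "Y \<in> carrier_mat d e" and u: "u \<in> carrier_vec d" "vnorm u = 1" and v: "v \<in> carrier_vec e"
    and p: "p \<in> carrier_vec d" "vnorm p = 1" and q: "q \<in> carrier_vec e" and s: "s > 0"
    and svd: "is_svd rK Y t x y" and de: "0 < d" "0 < e"
    and eq1: "complex_of_real s \<cdot>\<^sub>v p = \<beta> \<cdot>\<^sub>v u + Y *\<^sub>v q"
    and eq2: "complex_of_real s \<cdot>\<^sub>v q = \<alpha> \<cdot>\<^sub>v v + adjoint_mat Y *\<^sub>v p"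
  shows "cmod (cinner p u) \<le> (\<Sum>j<K. cmod \<beta> * cmod (cinner (gpow Y j *\<^sub>v u) u) / s ^ (2 * j + 1)
             + cmod \<alpha> * cmod (cinner (gpow Y j *\<^sub>v (Y *\<^sub>v v)) u) / s ^ (2 * j + 2))
           + (t 0 / s) ^ (2 * K)"
proof -
  have "cmod (cinner (gpow Y K *\<^sub>v p) u) \<le> vnorm (gpow Y K *\<^sub>v p) * vnorm u"
    by (rule cinner_Cauchy_Schwarz[OF _ u(1)]) (rule mult_mat_vec_carrier[OF gpow_carrier[OF Y] p(1)])
  also have "\<dots> \<le> t 0 ^ (2 * K)" using vnorm_gpow_le[OF svd Y de p(1)] u p by simp
  finally have K: "cmod (cinner (gpow Y K *\<^sub>v p) u / complex_of_real (s ^ (2 * K))) \<le> (t 0 / s) ^ (2 * K)"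
    using s by (simp add: norm_divide norm_power power_divide divide_right_mono)
  show ?thesis
    unfolding singular_vector_expansion[OF Y u(1) v p(1) q s eq1 eq2, of K]
    by (intro order_trans[OF norm_triangle_ineq] add_mono K order_trans[OF norm_sum] sum_mono)
      (use s in \<open>auto simp: norm_divide norm_mult norm_power intro!: order_trans[OF norm_triangle_ineq]\<close>)
qed

subsection \<open>Trial vectors\<close>

text \<open>Together with its mirror image q, which is
  \<open>trial (adjoint_mat Y) v u t s z L\<close>, this is the L-term Neumann approximation to the
  solution of z p = s u + Y q, z q = t v + Y^H p. With s = \<theta> <q,v> and t = \<theta> <p,u> an
  exact solution would be a singular pair of the spiked matrix for the value z.\<close>

definition trial :: "complex mat \<Rightarrow> complex vec \<Rightarrow> complex vec \<Rightarrow> real \<Rightarrow> real \<Rightarrow> real \<Rightarrow> nat \<Rightarrow> complex vec" where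
  "trial Y u v s t z L =
     lincomb (dim_row Y) L (\<lambda>j. complex_of_real (s / z ^ (2 * j + 1))) (\<lambda>j. gpow Y j *\<^sub>v u)
   + lincomb (dim_row Y) L (\<lambda>j. complex_of_real (t / z ^ (2 * j + 2))) (\<lambda>j. gpow Y j *\<^sub>v (Y *\<^sub>v v))"

lemma trial_carrier [simp]: "Y \<in> carrier_mat d e \<Longrightarrow> trial Y u v s t z L \<in> carrier_vec d"
  by (auto simp: trial_def)

lemma cinner_trial:
  assumes Y: "Y \<in> carrier_mat d e" and u: "u \<in> carrier_vec d" and v: "v \<in> carrier_vec e"
  shows "cinner (trial Y u v s t z L) w = (\<Sum>j<L. complex_of_real (s / z ^ (2 * j + 1)) * cinner (gpow Y j *\<^sub>v u) w
     + complex_of_real (t / z ^ (2 * j + 2)) * cinner (gpow Y j *\<^sub>v (Y *\<^sub>v v)) w)"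
proof -
  have c: "gpow Y j *\<^sub>v u \<in> carrier_vec d" "gpow Y j *\<^sub>v (Y *\<^sub>v v) \<in> carrier_vec d" for j
    using mult_mat_vec_carrier[OF gpow_carrier[OF Y]] u mult_mat_vec_carrier[OF Y v] by auto
  have "dim_row Y = d" using Y by simp
  then show ?thesis
    unfolding trial_def
    by (subst cinner_add_left[of _ d]) (use c in \<open>auto simp: cinner_lincomb_left sum.distrib simp del: of_real_divide\<close>)
qed

text \<open>The difference telescopes: the terms with weight \<open>t\<close> cancel, and of those
  with weight \<open>s\<close> only the first and the last Gram power survive.\<close>

lemma trial_identity:
  assumes Y: "Y \<in> carrier_mat d e" and u: "u \<in> carrier_vec d" and v: "v \<in> carrier_vec e"
    and w: "w \<in> carrier_vec d" and z: "z > 0"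
  shows "complex_of_real z * cinner (trial Y u v s t z L) w
       - cinner (Y *\<^sub>v trial (adjoint_mat Y) v u t s z L) w
       = complex_of_real s * cinner u w - complex_of_real (s / z ^ (2 * L)) * cinner (gpow Y L *\<^sub>v u) w"
proof -
  have Y': "adjoint_mat Y \<in> carrier_mat e d" using Y by simp
  have Yw: "adjoint_mat Y *\<^sub>v w \<in> carrier_vec e" and Yv: "Y *\<^sub>v v \<in> carrier_vec d"
    and Yu: "adjoint_mat Y *\<^sub>v u \<in> carrier_vec e" using Y Y' u v w by (auto intro: mult_mat_vec_carrier)
  have move: "cinner (gpow (adjoint_mat Y) j *\<^sub>v x) (adjoint_mat Y *\<^sub>v w) = cinner (gpow Y j *\<^sub>v (Y *\<^sub>v x)) w"
    if x: "x \<in> carrier_vec e" for j x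
  proof -
    have "cinner (gpow (adjoint_mat Y) j *\<^sub>v x) (adjoint_mat Y *\<^sub>v w) = cinner (Y *\<^sub>v (gpow (adjoint_mat Y) j *\<^sub>v x)) w"
      by (rule cinner_mult_mat_vec[OF Y _ w, symmetric]) (rule mult_mat_vec_carrier[OF gpow_carrier[OF Y'] x])
    also have "Y *\<^sub>v (gpow (adjoint_mat Y) j *\<^sub>v x) = gpow Y j *\<^sub>v (Y *\<^sub>v x)"
      using gpow_mult_swap[OF Y, of j] assoc_mult_mat_vec[OF gpow_carrier[OF Y] Y x]
        assoc_mult_mat_vec[OF Y gpow_carrier[OF Y'] x] by metis
    finally show ?thesis .
  qed
  have "cinner (Y *\<^sub>v trial (adjoint_mat Y) v u t s z L) w = cinner (trial (adjoint_mat Y) v u t s z L) (adjoint_mat Y *\<^sub>v w)"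
    by (rule cinner_mult_mat_vec[OF Y _ w]) (use Y' in auto)
  also have "\<dots> = (\<Sum>j<L. complex_of_real (t / z ^ (2 * j + 1)) * cinner (gpow Y j *\<^sub>v (Y *\<^sub>v v)) w
     + complex_of_real (s / z ^ (2 * j + 2)) * cinner (gpow Y (Suc j) *\<^sub>v u) w)"
    unfolding cinner_trial[OF Y' v u] move[OF v] move[OF Yu] gpow_Suc_vec[OF Y u] ..
  finally have e: "cinner (Y *\<^sub>v trial (adjoint_mat Y) v u t s z L) w = \<dots>" .
  show ?thesis
    unfolding e cinner_trial[OF Y u v]
  proof (induction L)
    case 0
    then show ?case using Y u by simp
  next
    case (Suc L)
    have step: "complex_of_real z * (complex_of_real (s / z ^ (2 * L + 1)) * a + complex_of_real (t / z ^ (2 * L + 2)) * b)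
        - (complex_of_real (t / z ^ (2 * L + 1)) * b + complex_of_real (s / z ^ (2 * L + 2)) * c)
        = complex_of_real (s / z ^ (2 * L)) * a - complex_of_real (s / z ^ (2 * Suc L)) * c" for a b c
      using z by (simp add: field_simps)
    have combine: "Z * (S1 + x) - (S2 + y) = E - d" if "Z * S1 - S2 = E - f" "Z * x - y = f - d" for Z S1 S2 x y E f d :: complex
    proof -
      have "Z * (S1 + x) - (S2 + y) = (Z * S1 - S2) + (Z * x - y)" by (simp add: algebra_simps)
      then show ?thesis unfolding that by simp
    qed
    show ?case
      unfolding sum.lessThan_Suc by (rule combine[OF Suc step])
  qed
qed

text \<open>For the spiked matrix B, 2 Re <B q, p> <= 2 z |p| |q| <= z (|p|^2 + |q|^2). Eliminating
  both squared norms by \<open>trial_identity\<close> leaves only inner products whose limits are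
  known.\<close>

lemma trial_inequality:
  assumes A: "A \<in> carrier_mat n m" and u: "u \<in> carrier_vec n" and v: "v \<in> carrier_vec m"
    and svd: "is_svd rK (spiked A \<theta> u v) g x y" and nm: "0 < n" "0 < m" and z: "z > 0" and gz: "g 0 \<le> z"
    and p: "p = trial A u v s t z L" and q: "q = trial (adjoint_mat A) v u t s z L"
  shows "2 * \<theta> * Re (cinner q v * cnj (cinner p u)) \<le>
     Re (complex_of_real s * cnj (cinner p u)) - Re (complex_of_real (s / z ^ (2 * L)) * cnj (cinner p (gpow A L *\<^sub>v u)))
   + Re (complex_of_real t * cnj (cinner q v)) - Re (complex_of_real (t / z ^ (2 * L)) * cnj (cinner q (gpow (adjoint_mat A) L *\<^sub>v v)))"
proof -
  have A': "adjoint_mat A \<in> carrier_mat m n" using A by simp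
  have pc: "p \<in> carrier_vec n" and qc: "q \<in> carrier_vec m" using A A' by (auto simp: p q)
  have Aq: "A *\<^sub>v q \<in> carrier_vec n" and Ap: "adjoint_mat A *\<^sub>v p \<in> carrier_vec m"
    using A A' pc qc by (auto intro: mult_mat_vec_carrier)
  have Gu: "gpow A L *\<^sub>v u \<in> carrier_vec n" and Gv: "gpow (adjoint_mat A) L *\<^sub>v v \<in> carrier_vec m"
    using mult_mat_vec_carrier[OF gpow_carrier[OF A] u] mult_mat_vec_carrier[OF gpow_carrier[OF A'] v] by auto
  have g0: "0 \<le> g 0" using is_svd_nonneg[OF svd spiked_carrier[OF A]] nm by simp
  have sp: "spiked A \<theta> u v *\<^sub>v q \<in> carrier_vec n" using spiked_carrier[OF A] qc by (rule mult_mat_vec_carrier)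
  have "Re (cinner (spiked A \<theta> u v *\<^sub>v q) p) \<le> cmod (cinner (spiked A \<theta> u v *\<^sub>v q) p)"
    by (rule complex_Re_le_cmod)
  also have "\<dots> \<le> vnorm (spiked A \<theta> u v *\<^sub>v q) * vnorm p"
    by (rule cinner_Cauchy_Schwarz[OF sp pc])
  also have "\<dots> \<le> (z * vnorm q) * vnorm p"
    by (intro mult_right_mono order_trans[OF svd_op_bound[OF svd spiked_carrier[OF A] qc nm]] gz) auto
  finally have "2 * Re (cinner (spiked A \<theta> u v *\<^sub>v q) p) \<le> z * (2 * vnorm p * vnorm q)"
    by (simp add: algebra_simps)
  also have "\<dots> \<le> z * ((vnorm p)\<^sup>2 + (vnorm q)\<^sup>2)"
    using z sum_squares_bound[of "vnorm p" "vnorm q"] by (intro mult_left_mono) auto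
  finally have 1: "2 * Re (cinner (spiked A \<theta> u v *\<^sub>v q) p) \<le> z * (vnorm p)\<^sup>2 + z * (vnorm q)\<^sup>2"
    by (simp add: algebra_simps)
  have "cinner (spiked A \<theta> u v *\<^sub>v q) p = complex_of_real \<theta> * cinner q v * cinner u p + cinner (A *\<^sub>v q) p"
    unfolding spiked_mult_vec[OF A u v qc]
    by (subst cinner_add_left[of _ n]) (use u Aq in \<open>auto simp: cinner_smult_left\<close>)
  moreover have "cinner u p = cnj (cinner p u)" by (rule cinner_commute[OF pc u])
  ultimately have 2: "2 * Re (cinner (spiked A \<theta> u v *\<^sub>v q) p)
      = 2 * \<theta> * Re (cinner q v * cnj (cinner p u)) + 2 * Re (cinner (A *\<^sub>v q) p)"
    by (simp add: algebra_simps)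
  have "cinner (A *\<^sub>v q) p = cinner q (adjoint_mat A *\<^sub>v p)" by (rule cinner_mult_mat_vec[OF A qc pc])
  also have "\<dots> = cnj (cinner (adjoint_mat A *\<^sub>v p) q)" by (rule cinner_commute[OF Ap qc])
  finally have 3: "Re (cinner (A *\<^sub>v q) p) = Re (cinner (adjoint_mat A *\<^sub>v p) q)" by simp
  have "complex_of_real z * cinner p p - cinner (A *\<^sub>v q) p
      = complex_of_real s * cinner u p - complex_of_real (s / z ^ (2 * L)) * cinner (gpow A L *\<^sub>v u) p"
    using trial_identity[OF A u v pc z, of s t L] p q by simp
  then have "complex_of_real z * cinner p p - cinner (A *\<^sub>v q) p
      = complex_of_real s * cnj (cinner p u) - complex_of_real (s / z ^ (2 * L)) * cnj (cinner p (gpow A L *\<^sub>v u))"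
    using cinner_commute[OF pc u] cinner_commute[OF pc Gu] by simp
  then have "Re (complex_of_real z * cinner p p - cinner (A *\<^sub>v q) p)
      = Re (complex_of_real s * cnj (cinner p u) - complex_of_real (s / z ^ (2 * L)) * cnj (cinner p (gpow A L *\<^sub>v u)))"
    by (rule arg_cong)
  then have 4: "z * (vnorm p)\<^sup>2 - Re (cinner (A *\<^sub>v q) p)
      = Re (complex_of_real s * cnj (cinner p u)) - Re (complex_of_real (s / z ^ (2 * L)) * cnj (cinner p (gpow A L *\<^sub>v u)))"
    unfolding cinner_self by simp
  have "complex_of_real z * cinner q q - cinner (adjoint_mat A *\<^sub>v p) q
      = complex_of_real t * cinner v q - complex_of_real (t / z ^ (2 * L)) * cinner (gpow (adjoint_mat A) L *\<^sub>v v) q"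
    using trial_identity[OF A' v u qc z, of t s L] p q by simp
  then have "complex_of_real z * cinner q q - cinner (adjoint_mat A *\<^sub>v p) q
      = complex_of_real t * cnj (cinner q v) - complex_of_real (t / z ^ (2 * L)) * cnj (cinner q (gpow (adjoint_mat A) L *\<^sub>v v))"
    using cinner_commute[OF qc v] cinner_commute[OF qc Gv] by simp
  then have "Re (complex_of_real z * cinner q q - cinner (adjoint_mat A *\<^sub>v p) q)
      = Re (complex_of_real t * cnj (cinner q v) - complex_of_real (t / z ^ (2 * L)) * cnj (cinner q (gpow (adjoint_mat A) L *\<^sub>v v)))"
    by (rule arg_cong)
  then have 5: "z * (vnorm q)\<^sup>2 - Re (cinner (adjoint_mat A *\<^sub>v p) q)
      = Re (complex_of_real t * cnj (cinner q v)) - Re (complex_of_real (t / z ^ (2 * L)) * cnj (cinner q (gpow (adjoint_mat A) L *\<^sub>v v)))"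
    unfolding cinner_self by simp
  show ?thesis using 1 2 3 4 5 by linarith
qed

section \<open>Upper and lower bounds for the largest singular value on one sample path\<close>

lemma subseq_of_frequently:
  fixes P :: "nat \<Rightarrow> bool"
  assumes "\<not> eventually (\<lambda>N. \<not> P N) sequentially"
  shows "\<exists>r :: nat \<Rightarrow> nat. strict_mono r \<and> (\<forall>k. P (r k)) \<and> (\<forall>k. r k \<ge> 1)"
proof -
  have "infinite {N. P N \<and> N \<ge> 1}"
  proof
    assume "finite {N. P N \<and> N \<ge> 1}"
    then obtain B where "\<forall>N\<in>{N. P N \<and> N \<ge> 1}. N \<le> B" using finite_nat_set_iff_bounded_le by blast
    then have "\<forall>N\<ge>Suc B. \<not> P N" by force
    then show False using assms unfolding eventually_sequentially by blast
  qed
  then obtain r :: "nat \<Rightarrow> nat" where "strict_mono r" "\<forall>k. r k \<in> {N. P N \<and> N \<ge> 1}"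
    using infinite_enumerate by blast
  then show ?thesis by auto
qed

lemma LIMSEQ_subseq:
  fixes r :: "nat \<Rightarrow> nat"
  assumes "f \<longlonglongrightarrow> l" "strict_mono r" shows "(\<lambda>k. f (r k)) \<longlonglongrightarrow> l"
  using LIMSEQ_subseq_LIMSEQ[OF assms] by (simp add: o_def)

text \<open>Two limits in succession: along the subsequence with the truncation order K fixed, which
  removes the mixed forms, and then in K, which removes the remainder because b < s'.\<close>

lemma overlap_bound_limit:
  fixes a b' s :: "nat \<Rightarrow> real"
  assumes r: "strict_mono (r :: nat \<Rightarrow> nat)"
    and lim: "a \<longlonglongrightarrow> a'" "b' \<longlonglongrightarrow> b''" "s \<longlonglongrightarrow> s'" and s': "s' > b" "s' > 0" and b: "0 \<le> b"
    and mu: "\<And>j. (\<lambda>k. f j (r k)) \<longlonglongrightarrow> complex_of_real (Mu' j)" and Mu': "\<And>j. 0 \<le> Mu' j"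
    and ga: "\<And>j. (\<lambda>k. h j (r k)) \<longlonglongrightarrow> (0::complex)"
    and t: "(\<lambda>k. t (r k)) \<longlonglongrightarrow> b"
    and le: "\<And>k K. a k \<le> (\<Sum>j<K. b' k * cmod (f j (r k)) / s k ^ (2 * j + 1) + a k * cmod (h j (r k)) / s k ^ (2 * j + 2))
        + (t (r k) / s k) ^ (2 * K)"
    and b'': "0 \<le> b''" and \<alpha>: "\<And>K. (\<Sum>j<K. Mu' j / s' ^ (2 * j + 1)) \<le> \<alpha>"
  shows "a' \<le> b'' * \<alpha>"
proof -
  have "a' \<le> b'' * \<alpha> + (b / s') ^ (2 * K)" for K
  proof -
    have "(\<lambda>k. (\<Sum>j<K. b' k * cmod (f j (r k)) / s k ^ (2 * j + 1) + a k * cmod (h j (r k)) / s k ^ (2 * j + 2))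
        + (t (r k) / s k) ^ (2 * K)) \<longlonglongrightarrow>
      (\<Sum>j<K. b'' * cmod (complex_of_real (Mu' j)) / s' ^ (2 * j + 1) + a' * cmod 0 / s' ^ (2 * j + 2)) + (b / s') ^ (2 * K)"
      by (intro tendsto_intros lim mu ga t) (use s' in auto)
    then have "a' \<le> (\<Sum>j<K. b'' * cmod (complex_of_real (Mu' j)) / s' ^ (2 * j + 1) + a' * cmod 0 / s' ^ (2 * j + 2)) + (b / s') ^ (2 * K)"
      by (rule LIMSEQ_le[OF lim(1)]) (use le in auto)
    also have "\<dots> = b'' * (\<Sum>j<K. Mu' j / s' ^ (2 * j + 1)) + (b / s') ^ (2 * K)"
      using Mu' by (simp add: sum_distrib_left)
    also have "\<dots> \<le> b'' * \<alpha> + (b / s') ^ (2 * K)"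
      by (intro add_right_mono mult_left_mono \<alpha> b'')
    finally show ?thesis .
  qed
  moreover have "(\<lambda>K. b'' * \<alpha> + (b / s') ^ (2 * K)) \<longlonglongrightarrow> b'' * \<alpha> + 0"
  proof (intro tendsto_add tendsto_const)
    have "(\<lambda>K. ((b / s')\<^sup>2) ^ K) \<longlonglongrightarrow> 0"
      by (rule LIMSEQ_power_zero) (use b s' in \<open>simp add: power_less_one_iff abs_square_less_1\<close>)
    then show "(\<lambda>K. (b / s') ^ (2 * K)) \<longlonglongrightarrow> 0" by (simp add: power_mult)
  qed
  ultimately show ?thesis by (intro LIMSEQ_le_const[of _ "b'' * \<alpha>"]) auto
qed

text \<open>All that is retained of a sample path. \<open>Mu\<close> and \<open>Nu\<close> are the
  limiting moments of the spectral measures of A A^H at u and of A^H A at v. The conditions on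
  \<open>u N\<close> and \<open>v N\<close> start at N = 1 because dimension 0 has no unit
  vector.\<close>

locale moment_limits =
  fixes A :: "nat \<Rightarrow> complex mat" and m :: "nat \<Rightarrow> nat" and u v :: "nat \<Rightarrow> complex vec"
    and Mu Nu :: "nat \<Rightarrow> real" and b :: real
  assumes A: "\<And>N. A N \<in> carrier_mat N (m N)" and m_ge: "\<And>N. N \<le> m N"
    and u: "\<And>N. N \<ge> 1 \<Longrightarrow> u N \<in> carrier_vec N" "\<And>N. N \<ge> 1 \<Longrightarrow> vnorm (u N) = 1"
    and v: "\<And>N. N \<ge> 1 \<Longrightarrow> v N \<in> carrier_vec (m N)" "\<And>N. N \<ge> 1 \<Longrightarrow> vnorm (v N) = 1"
    and mu: "\<And>k. (\<lambda>N. cinner (gpow (A N) k *\<^sub>v u N) (u N)) \<longlonglongrightarrow> complex_of_real (Mu k)"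
    and nu: "\<And>k. (\<lambda>N. cinner (gpow (adjoint_mat (A N)) k *\<^sub>v v N) (v N)) \<longlonglongrightarrow> complex_of_real (Nu k)"
    and cross: "\<And>k. (\<lambda>N. cinner (gpow (A N) k *\<^sub>v (A N *\<^sub>v v N)) (u N)) \<longlonglongrightarrow> 0"
    and top: "(\<lambda>N. sing_vals (A N) 0) \<longlonglongrightarrow> b"
    and Mu_nonneg: "\<And>k. 0 \<le> Mu k" and Nu_nonneg: "\<And>k. 0 \<le> Nu k"
    and Mu_0: "Mu 0 = 1" and Nu_0: "Nu 0 = 1"
begin

abbreviation perturbed :: "real \<Rightarrow> nat \<Rightarrow> complex mat" where
  "perturbed \<theta> N \<equiv> spiked (A N) \<theta> (u N) (v N)"

abbreviation u_form :: "nat \<Rightarrow> nat \<Rightarrow> complex" where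
  "u_form N k \<equiv> cinner (gpow (A N) k *\<^sub>v u N) (u N)"

abbreviation v_form :: "nat \<Rightarrow> nat \<Rightarrow> complex" where
  "v_form N k \<equiv> cinner (gpow (adjoint_mat (A N)) k *\<^sub>v v N) (v N)"

abbreviation uv_form :: "nat \<Rightarrow> nat \<Rightarrow> complex" where
  "uv_form N k \<equiv> cinner (gpow (A N) k *\<^sub>v (A N *\<^sub>v v N)) (u N)"

abbreviation vu_form :: "nat \<Rightarrow> nat \<Rightarrow> complex" where
  "vu_form N k \<equiv> cinner (gpow (adjoint_mat (A N)) k *\<^sub>v (adjoint_mat (A N) *\<^sub>v u N)) (v N)"

abbreviation sv0 :: "nat \<Rightarrow> real" where
  "sv0 N \<equiv> sing_vals (A N) 0"

definition g :: "real \<Rightarrow> nat \<Rightarrow> real" where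
  "g \<theta> N = sing_vals (perturbed \<theta> N) 0"

lemma spiked_svd: "\<exists>x y. is_svd False (perturbed \<theta> N) (sing_vals (perturbed \<theta> N)) x y"
  by (rule sing_vals_svd[OF spiked_carrier[OF A] m_ge])

lemma g_nonneg:
  assumes "N \<ge> 1" shows "0 \<le> g \<theta> N"
proof -
  obtain x y where "is_svd False (perturbed \<theta> N) (sing_vals (perturbed \<theta> N)) x y"
    using spiked_svd by blast
  from is_svd_nonneg[OF this spiked_carrier[OF A]] show ?thesis
    using assms m_ge[of N] by (simp add: g_def)
qed

lemma spiked_0: "N \<ge> 1 \<Longrightarrow> perturbed 0 N = A N"
  using A[of N] u[of N] v[of N] by (intro eq_matI) (auto simp: spiked_def outer_def)

lemma g_0: "(\<lambda>N. g 0 N) \<longlonglongrightarrow> b"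
  by (rule Lim_transform_eventually[OF top])
    (use eventually_ge_at_top[of 1] in eventually_elim, simp add: g_def spiked_0)

lemma form_le_g:
  assumes N: "N \<ge> 1" and p: "p \<in> carrier_vec N" and q: "q \<in> carrier_vec (m N)"
  shows "Re (cinner (perturbed \<theta> N *\<^sub>v q) p) \<le> g \<theta> N * (vnorm q * vnorm p)"
proof -
  obtain x y where svd: "is_svd False (perturbed \<theta> N) (sing_vals (perturbed \<theta> N)) x y"
    using spiked_svd by blast
  have "Re (cinner (perturbed \<theta> N *\<^sub>v q) p) \<le> cmod (cinner (perturbed \<theta> N *\<^sub>v q) p)"
    by (rule complex_Re_le_cmod)
  also have "\<dots> \<le> vnorm (perturbed \<theta> N *\<^sub>v q) * vnorm p"
    by (rule cinner_Cauchy_Schwarz[OF mult_mat_vec_carrier[OF spiked_carrier[OF A] q] p])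
  also have "\<dots> \<le> (g \<theta> N * vnorm q) * vnorm p"
    unfolding g_def
    by (intro mult_right_mono svd_op_bound[OF svd spiked_carrier[OF A] q]) (use N m_ge[of N] in auto)
  finally show ?thesis by (simp add: mult.assoc)
qed

lemma form_shift:
  assumes N: "N \<ge> 1" and p: "p \<in> carrier_vec N" and q: "q \<in> carrier_vec (m N)"
  shows "cinner (perturbed \<theta> N *\<^sub>v q) p
       = complex_of_real \<theta> * (cinner q (v N) * cinner (u N) p) + cinner (A N *\<^sub>v q) p"
  unfolding spiked_mult_vec[OF A u(1)[OF N] v(1)[OF N] q]
  by (subst cinner_add_left[of _ N])
    (use u(1)[OF N] mult_mat_vec_carrier[OF A q] in \<open>auto simp: cinner_smult_left\<close>)

lemma top_singular_vectors:
  assumes svd: "is_svd rK (perturbed \<theta> N) s x y" and N: "N \<ge> 1"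
  shows "s 0 = g \<theta> N" "x 0 \<in> carrier_vec N" "vnorm (x 0) = 1" "y 0 \<in> carrier_vec (m N)" "vnorm (y 0) = 1"
    "perturbed \<theta> N *\<^sub>v y 0 = complex_of_real (g \<theta> N) \<cdot>\<^sub>v x 0"
    "adjoint_mat (perturbed \<theta> N) *\<^sub>v x 0 = complex_of_real (g \<theta> N) \<cdot>\<^sub>v y 0"
proof -
  have q: "0 < min N (m N)" using N m_ge[of N] by simp
  show s0: "s 0 = g \<theta> N"
    unfolding g_def by (rule svd_eq_sing_vals[OF svd spiked_carrier[OF A] m_ge]) (use N in simp)
  show "x 0 \<in> carrier_vec N" "vnorm (x 0) = 1" "y 0 \<in> carrier_vec (m N)" "vnorm (y 0) = 1"
    using is_svd_orthonormal[OF svd spiked_carrier[OF A]] q unfolding vnorm_eq_1_iff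
    by (auto simp: orthonormal_fam_def)
  show "perturbed \<theta> N *\<^sub>v y 0 = complex_of_real (g \<theta> N) \<cdot>\<^sub>v x 0"
    using svd_right_vec[OF svd spiked_carrier[OF A] q] s0 by simp
  show "adjoint_mat (perturbed \<theta> N) *\<^sub>v x 0 = complex_of_real (g \<theta> N) \<cdot>\<^sub>v y 0"
    using svd_right_vec[OF is_svd_adjoint[OF is_svd_FalseI[OF svd]], of "m N" N 0] q s0 A[of N]
    by (simp add: min.commute)
qed

text \<open>The largest singular value is a supremum of affine functions of \<^term>\<open>\<theta>\<close>.\<close>
lemma g_subgradient:
  assumes svd: "is_svd rK (perturbed \<theta> N) s x y" and N: "N \<ge> 1"
  shows "g \<theta> N + (\<theta>' - \<theta>) * Re (cinner (y 0) (v N) * cinner (u N) (x 0)) \<le> g \<theta>' N"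
proof -
  note t = top_singular_vectors[OF svd N]
  let ?z = "cinner (y 0) (v N) * cinner (u N) (x 0)"
  have x1: "cinner (x 0) (x 0) = 1" using t(3) by (simp add: vnorm_eq_1_iff)
  have "Re (cinner (perturbed \<theta>' N *\<^sub>v y 0) (x 0)) \<le> g \<theta>' N"
    using form_le_g[OF N t(2,4), of \<theta>'] t(3,5) by simp
  moreover have "Re (cinner (perturbed \<theta> N *\<^sub>v y 0) (x 0)) = g \<theta> N"
    unfolding t(6) by (simp add: cinner_smult_left x1)
  moreover have "Re (cinner (perturbed \<theta>' N *\<^sub>v y 0) (x 0)) - Re (cinner (perturbed \<theta> N *\<^sub>v y 0) (x 0))
     = (\<theta>' - \<theta>) * Re ?z"
    unfolding form_shift[OF N t(2,4)] by (simp add: algebra_simps)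
  ultimately show ?thesis by linarith
qed

text \<open>One subgradient at 0, tested at \<theta> and at -\<theta>; the slope terms
  cancel.\<close>

lemma g_midpoint:
  assumes N: "N \<ge> 1"
  shows "2 * g 0 N \<le> g \<theta> N + g (- \<theta>) N"
proof -
  obtain x y where svd: "is_svd False (perturbed 0 N) (sing_vals (perturbed 0 N)) x y"
    using spiked_svd by blast
  show ?thesis using g_subgradient[OF svd N, of \<theta>] g_subgradient[OF svd N, of "- \<theta>"] by simp
qed

lemma b_nonneg: "0 \<le> b"
  by (rule LIMSEQ_le_const[OF g_0]) (use g_nonneg in blast)

lemma cross_adjoint:
  "(\<lambda>N. vu_form N k) \<longlonglongrightarrow> 0"
proof (rule Lim_transform_eventually)
  show "(\<lambda>N. cnj (uv_form N k)) \<longlonglongrightarrow> 0"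
    using tendsto_cnj[OF cross[of k]] by simp
  show "\<forall>\<^sub>F N in sequentially. cnj (uv_form N k)
      = vu_form N k"
    using eventually_ge_at_top[of 1]
    by eventually_elim (simp add: cinner_gpow_adjoint[OF A u(1) v(1)])
qed

text \<open>If g stays at or above z along a subsequence, the limits a' and b'' of the two overlaps
  satisfy a' <= |\<theta>| \<alpha> b'' and b'' <= |\<theta>| \<beta> a'. Since \<theta>^2 \<alpha>
  \<beta> < 1, this forces a' = 0. Without overlap the perturbation adds nothing to the norm, so the
  limit of g is at most b, contrary to b < z.\<close>

lemma g_upper:
  assumes z: "b < z" and \<alpha>: "\<And>K. (\<Sum>j<K. Mu j / z ^ (2 * j + 1)) \<le> \<alpha>" and \<beta>: "\<And>K. (\<Sum>j<K. Nu j / z ^ (2 * j + 1)) \<le> \<beta>"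
    and sub: "\<theta>\<^sup>2 * (\<alpha> * \<beta>) < 1"
  shows "\<forall>\<^sub>F N in sequentially. g \<theta> N < z"
proof (rule ccontr)
  assume "\<not> ?thesis"
  then have "\<not> eventually (\<lambda>N. \<not> z \<le> g \<theta> N) sequentially" by (simp add: not_le)
  then obtain r :: "nat \<Rightarrow> nat" where r: "strict_mono r" "\<And>k. z \<le> g \<theta> (r k)" "\<And>k. r k \<ge> 1"
    by (auto dest!: subseq_of_frequently)
  have z0: "0 < z" using z b_nonneg by simp
  have "\<exists>t x y. is_svd False (perturbed \<theta> N) t x y" for N using spiked_svd by blast
  then obtain x y where svd: "\<And>N. \<exists>t. is_svd False (perturbed \<theta> N) t (x N) (y N)" by metis
  define p q where "p = (\<lambda>N. x N 0)" and "q = (\<lambda>N. y N 0)"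
  have pq: "p N \<in> carrier_vec N" "vnorm (p N) = 1" "q N \<in> carrier_vec (m N)" "vnorm (q N) = 1"
    "perturbed \<theta> N *\<^sub>v q N = complex_of_real (g \<theta> N) \<cdot>\<^sub>v p N"
    "adjoint_mat (perturbed \<theta> N) *\<^sub>v p N = complex_of_real (g \<theta> N) \<cdot>\<^sub>v q N" if "N \<ge> 1" for N
  proof -
    obtain t where "is_svd False (perturbed \<theta> N) t (x N) (y N)" using svd by blast
    from top_singular_vectors[OF this that] show "p N \<in> carrier_vec N" "vnorm (p N) = 1" "q N \<in> carrier_vec (m N)" "vnorm (q N) = 1"
      "perturbed \<theta> N *\<^sub>v q N = complex_of_real (g \<theta> N) \<cdot>\<^sub>v p N"
      "adjoint_mat (perturbed \<theta> N) *\<^sub>v p N = complex_of_real (g \<theta> N) \<cdot>\<^sub>v q N"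
      unfolding p_def q_def by simp_all
  qed
  define a b' where "a = (\<lambda>N. cmod (cinner (p N) (u N)))" and "b' = (\<lambda>N. cmod (cinner (q N) (v N)))"
  have ab1: "a N \<le> 1" "b' N \<le> 1" if "N \<ge> 1" for N
    using cinner_Cauchy_Schwarz[OF pq(1)[OF that] u(1)[OF that]] cinner_Cauchy_Schwarz[OF pq(3)[OF that] v(1)[OF that]]
    by (simp_all add: a_def b'_def pq(2,4)[OF that] u(2)[OF that] v(2)[OF that])
  have ab0: "0 \<le> a N" "0 \<le> b' N" for N by (auto simp: a_def b'_def)
  define tA where "tA = (\<lambda>N. sing_vals (A N))"
  have "\<forall>N. \<exists>x y. is_svd False (A N) (tA N) x y" using sing_vals_svd[OF A m_ge] unfolding tA_def by blast
  then obtain xA yA where "\<forall>N. is_svd False (A N) (tA N) (xA N) (yA N)" by metis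
  then have svdA: "tA N = sing_vals (A N)" "is_svd False (A N) (tA N) (xA N) (yA N)" for N by (auto simp: tA_def)
  have eqs: "complex_of_real (g \<theta> N) \<cdot>\<^sub>v p N = (complex_of_real \<theta> * cinner (q N) (v N)) \<cdot>\<^sub>v u N + A N *\<^sub>v q N"
    "complex_of_real (g \<theta> N) \<cdot>\<^sub>v q N = (complex_of_real \<theta> * cinner (p N) (u N)) \<cdot>\<^sub>v v N + adjoint_mat (A N) *\<^sub>v p N" if N: "N \<ge> 1" for N
  proof -
    show "complex_of_real (g \<theta> N) \<cdot>\<^sub>v p N = (complex_of_real \<theta> * cinner (q N) (v N)) \<cdot>\<^sub>v u N + A N *\<^sub>v q N"
      using spiked_mult_vec[OF A u(1)[OF N] v(1)[OF N] pq(3)[OF N], of \<theta>] pq(5)[OF N] by simp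
    have A': "adjoint_mat (A N) \<in> carrier_mat (m N) N" using A by simp
    show "complex_of_real (g \<theta> N) \<cdot>\<^sub>v q N = (complex_of_real \<theta> * cinner (p N) (u N)) \<cdot>\<^sub>v v N + adjoint_mat (A N) *\<^sub>v p N"
      using spiked_mult_vec[OF A' v(1)[OF N] u(1)[OF N] pq(1)[OF N], of \<theta>] pq(6)[OF N]
      by (simp add: adjoint_spiked[OF A u(1)[OF N] v(1)[OF N]])
  qed
  have le_a: "a N \<le> (\<Sum>j<K. \<bar>\<theta>\<bar> * b' N * cmod (u_form N j) / g \<theta> N ^ (2 * j + 1)
       + \<bar>\<theta>\<bar> * a N * cmod (uv_form N j) / g \<theta> N ^ (2 * j + 2))
      + (sv0 N / g \<theta> N) ^ (2 * K)" if N: "N \<ge> 1" and g: "z \<le> g \<theta> N" for N K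
    using cmod_cinner_overlap_le[OF A u[OF N] v(1)[OF N] pq(1,2,3)[OF N] _ svdA(2) _ _ eqs[OF N], of K] g z0 N m_ge[of N]
    by (simp add: a_def b'_def norm_mult svdA(1))
  have le_b: "b' N \<le> (\<Sum>j<K. \<bar>\<theta>\<bar> * a N * cmod (v_form N j) / g \<theta> N ^ (2 * j + 1)
       + \<bar>\<theta>\<bar> * b' N * cmod (vu_form N j) / g \<theta> N ^ (2 * j + 2))
      + (sv0 N / g \<theta> N) ^ (2 * K)" if N: "N \<ge> 1" and g: "z \<le> g \<theta> N" for N K
  proof -
    have A': "adjoint_mat (A N) \<in> carrier_mat (m N) N" using A by simp
    have eq: "complex_of_real (g \<theta> N) \<cdot>\<^sub>v p N = (complex_of_real \<theta> * cinner (q N) (v N)) \<cdot>\<^sub>v u N + adjoint_mat (adjoint_mat (A N)) *\<^sub>v q N"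
      using eqs(1)[OF N] by simp
    show ?thesis
      using cmod_cinner_overlap_le[OF A' v[OF N] u(1)[OF N] pq(3,4,1)[OF N] _ is_svd_adjoint[OF svdA(2)] _ _ eqs(2)[OF N] eq, of K]
        g z0 N m_ge[of N]
      by (simp add: a_def b'_def norm_mult svdA(1))
  qed
  \<comment> \<open>Used twice: it bounds \<open>g \<theta>\<close> along the subsequence, and at
    the end it keeps the limit at or below \<open>b\<close> when an overlap vanishes.\<close>
  have g_le: "g \<theta> N \<le> sv0 N + \<bar>\<theta>\<bar> * (a N * b' N)" if N: "N \<ge> 1" for N
  proof -
    have "complex_of_real (g \<theta> N) = cinner (perturbed \<theta> N *\<^sub>v q N) (p N)"
      unfolding pq(5)[OF N] using pq(2)[OF N] by (simp add: cinner_smult_left vnorm_eq_1_iff)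
    also have "\<dots> = complex_of_real \<theta> * (cinner (q N) (v N) * cinner (u N) (p N)) + cinner (A N *\<^sub>v q N) (p N)"
      by (rule form_shift[OF N pq(1,3)[OF N]])
    finally have "cmod (complex_of_real (g \<theta> N)) \<le> cmod (complex_of_real \<theta> * (cinner (q N) (v N) * cinner (u N) (p N))) + cmod (cinner (A N *\<^sub>v q N) (p N))"
      by (metis norm_triangle_ineq)
    moreover have "cmod (cinner (u N) (p N)) = a N"
      unfolding a_def cinner_commute[OF pq(1)[OF N] u(1)[OF N]] by simp
    moreover have "cmod (cinner (A N *\<^sub>v q N) (p N)) \<le> sv0 N"
    proof -
      have "cmod (cinner (A N *\<^sub>v q N) (p N)) \<le> vnorm (A N *\<^sub>v q N) * vnorm (p N)"
        by (rule cinner_Cauchy_Schwarz[OF mult_mat_vec_carrier[OF A pq(3)[OF N]] pq(1)[OF N]])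
      also have "\<dots> \<le> tA N 0" using svd_op_bound[OF svdA(2) A pq(3)[OF N]] N m_ge[of N] pq[OF N] by simp
      finally show ?thesis by (simp add: svdA(1))
    qed
    ultimately show ?thesis by (simp add: norm_mult b'_def mult_ac)
  qed
  \<comment> \<open>One compactness argument for both overlaps and the singular value
    together.\<close>
  define w where "w = (\<lambda>k. (a (r k), b' (r k), g \<theta> (r k)))"
  have "bounded (range (\<lambda>k. sv0 (r k)))"
    using convergent_imp_bounded[OF LIMSEQ_subseq[OF top r(1)]] .
  then obtain B where B: "\<And>k. \<bar>sv0 (r k)\<bar> \<le> B" unfolding bounded_iff by auto
  have "w k \<in> {0..1::real} \<times> {0..1::real} \<times> {z..B + \<bar>\<theta>\<bar>}" for k
  proof -
    have "\<bar>\<theta>\<bar> * (a (r k) * b' (r k)) \<le> \<bar>\<theta>\<bar> * (1 * 1)"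
      using ab0 ab1[OF r(3)] by (intro mult_left_mono mult_mono) auto
    then show ?thesis
      using ab0 ab1[OF r(3)[of k]] r(2)[of k] g_le[OF r(3), of k] B[of k] by (auto simp: w_def)
  qed
  moreover have "compact ({0..1::real} \<times> {0..1::real} \<times> {z..B + \<bar>\<theta>\<bar>})" by (intro compact_Times compact_Icc)
  ultimately obtain l r' where l: "l \<in> {0..1} \<times> {0..1} \<times> {z..B + \<bar>\<theta>\<bar>}" "strict_mono (r' :: nat \<Rightarrow> nat)" "(w \<circ> r') \<longlonglongrightarrow> l"
    unfolding compact_def by blast
  obtain a' b'' s where l_eq: "l = (a', b'', s)" by (cases l)
  define R where "R = r \<circ> r'"
  have R: "strict_mono R" unfolding R_def by (rule strict_mono_o[OF r(1) l(2)])
  have R1: "R k \<ge> 1" and Rz: "z \<le> g \<theta> (R k)" for k using r by (auto simp: R_def)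
  have lims: "(\<lambda>k. a (R k)) \<longlonglongrightarrow> a'" "(\<lambda>k. b' (R k)) \<longlonglongrightarrow> b''" "(\<lambda>k. g \<theta> (R k)) \<longlonglongrightarrow> s"
    using tendsto_fst[OF l(3)] tendsto_fst[OF tendsto_snd[OF l(3)]] tendsto_snd[OF tendsto_snd[OF l(3)]]
    by (simp_all add: l_eq w_def R_def o_def)
  have s: "z \<le> s" and ab': "0 \<le> a'" "0 \<le> b''" using l(1) l_eq by auto
  \<comment> \<open>Of the limit \<open>s\<close> only z <= s is known; the sums decrease in their
    argument, so the bounds at \<open>z\<close> carry over.\<close>
  have mono: "(\<Sum>j<K. f j / s ^ (2 * j + 1)) \<le> (\<Sum>j<K. f j / z ^ (2 * j + 1))" if "\<And>j. 0 \<le> f j" for f :: "nat \<Rightarrow> real" and K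
    using s z0 that by (intro sum_mono divide_left_mono power_mono mult_pos_pos zero_less_power) auto
  have 1: "a' \<le> (\<bar>\<theta>\<bar> * b'') * \<alpha>"
  proof (rule overlap_bound_limit[where a = "\<lambda>k. a (R k)" and b' = "\<lambda>k. \<bar>\<theta>\<bar> * b' (R k)" and s = "\<lambda>k. g \<theta> (R k)"
        and r = R and s' = s and Mu' = Mu and f = "\<lambda>j N. u_form N j"
        and h = "\<lambda>j N. \<bar>\<theta>\<bar> * uv_form N j" and t = "\<lambda>N. sv0 N"])
    show "(\<lambda>k. complex_of_real \<bar>\<theta>\<bar> * uv_form (R k) j) \<longlonglongrightarrow> 0" for j
      using tendsto_mult[OF tendsto_const LIMSEQ_subseq[OF cross R]] by simp
    show "a (R k) \<le> (\<Sum>j<K. \<bar>\<theta>\<bar> * b' (R k) * cmod (u_form (R k) j) / g \<theta> (R k) ^ (2 * j + 1)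
       + a (R k) * cmod (complex_of_real \<bar>\<theta>\<bar> * uv_form (R k) j) / g \<theta> (R k) ^ (2 * j + 2))
       + (sv0 (R k) / g \<theta> (R k)) ^ (2 * K)" for k K
      using le_a[OF R1 Rz] by (simp add: norm_mult mult_ac)
  qed (use lims s z z0 b_nonneg ab' Mu_nonneg LIMSEQ_subseq[OF mu R] LIMSEQ_subseq[OF top R]
        order_trans[OF mono[OF Mu_nonneg] \<alpha>] R in \<open>auto intro!: tendsto_intros\<close>)
  have 2: "b'' \<le> (\<bar>\<theta>\<bar> * a') * \<beta>"
  proof (rule overlap_bound_limit[where a = "\<lambda>k. b' (R k)" and b' = "\<lambda>k. \<bar>\<theta>\<bar> * a (R k)" and s = "\<lambda>k. g \<theta> (R k)"
        and r = R and s' = s and Mu' = Nu and f = "\<lambda>j N. v_form N j"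
        and h = "\<lambda>j N. \<bar>\<theta>\<bar> * vu_form N j" and t = "\<lambda>N. sv0 N"])
    show "(\<lambda>k. complex_of_real \<bar>\<theta>\<bar> * vu_form (R k) j) \<longlonglongrightarrow> 0" for j
      using tendsto_mult[OF tendsto_const LIMSEQ_subseq[OF cross_adjoint R]] by simp
    show "b' (R k) \<le> (\<Sum>j<K. \<bar>\<theta>\<bar> * a (R k) * cmod (v_form (R k) j) / g \<theta> (R k) ^ (2 * j + 1)
       + b' (R k) * cmod (complex_of_real \<bar>\<theta>\<bar> * vu_form (R k) j) / g \<theta> (R k) ^ (2 * j + 2))
       + (sv0 (R k) / g \<theta> (R k)) ^ (2 * K)" for k K
      using le_b[OF R1 Rz] by (simp add: norm_mult mult_ac)
  qed (use lims s z z0 b_nonneg ab' Nu_nonneg LIMSEQ_subseq[OF nu R] LIMSEQ_subseq[OF top R]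
        order_trans[OF mono[OF Nu_nonneg] \<beta>] R in \<open>auto intro!: tendsto_intros\<close>)
  have \<alpha>0: "0 \<le> \<alpha>" using \<alpha>[of 0] by simp
  have "a' \<le> \<bar>\<theta>\<bar> * ((\<bar>\<theta>\<bar> * a') * \<beta>) * \<alpha>"
    by (rule order_trans[OF 1]) (intro mult_right_mono mult_left_mono 2 \<alpha>0, simp)
  then have "a' * (1 - \<theta>\<^sup>2 * (\<alpha> * \<beta>)) \<le> 0" by (simp add: algebra_simps power2_eq_square flip: abs_mult)
  then have "a' = 0" using sub ab' by (simp add: mult_le_0_iff)
  have "(\<lambda>k. sv0 (R k) + \<bar>\<theta>\<bar> * (a (R k) * b' (R k))) \<longlonglongrightarrow> b + \<bar>\<theta>\<bar> * (a' * b'')"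
    by (intro tendsto_intros lims LIMSEQ_subseq[OF top R])
  then have "s \<le> b + \<bar>\<theta>\<bar> * (a' * b'')"
    by (rule LIMSEQ_le[OF lims(3)]) (use g_le[OF R1] in auto)
  then show False using \<open>a' = 0\<close> s z by simp
qed

text \<open>If g were at most z infinitely often, trial vectors built at the value z would give
  \<theta> sqrt (\<alpha> \<beta>) <= 1 in the limit, where \<alpha> and \<beta> are the truncated
  sums.\<close>

lemma g_lower:
  assumes \<theta>: "0 < \<theta>" and z: "0 < z"
    and super: "1 < \<theta>\<^sup>2 * ((\<Sum>j<L. Mu j / z ^ (2 * j + 1)) * (\<Sum>j<L. Nu j / z ^ (2 * j + 1)))"
  shows "\<forall>\<^sub>F N in sequentially. z < g \<theta> N"
proof (rule ccontr)
  assume "\<not> ?thesis"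
  then have "\<not> eventually (\<lambda>N. \<not> g \<theta> N \<le> z) sequentially" by (simp add: not_le)
  then obtain r :: "nat \<Rightarrow> nat" where r: "strict_mono r" "\<And>k. g \<theta> (r k) \<le> z" "\<And>k. r k \<ge> 1"
    by (auto dest!: subseq_of_frequently)
  define \<alpha> \<beta> where "\<alpha> = (\<Sum>j<L. Mu j / z ^ (2 * j + 1))" and "\<beta> = (\<Sum>j<L. Nu j / z ^ (2 * j + 1))"
  have nonneg: "0 \<le> \<alpha>" "0 \<le> \<beta>" unfolding \<alpha>_def \<beta>_def by (intro sum_nonneg divide_nonneg_nonneg Mu_nonneg Nu_nonneg; use z in simp)+
  have "\<alpha> \<noteq> 0" "\<beta> \<noteq> 0" using super unfolding \<alpha>_def[symmetric] \<beta>_def[symmetric] by auto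
  then have pos: "0 < \<alpha>" "0 < \<beta>" using nonneg by auto
  \<comment> \<open>These weights balance the two sides: s^2 \<alpha> = t^2 \<beta> = \<alpha>
    \<beta>. Then \<open>s * t\<close> is sqrt (\<alpha> \<beta>) and the comparison is
    sharp.\<close>
  define s t where "s = sqrt \<beta>" and "t = sqrt \<alpha>"
  have st: "0 < s" "0 < t" "s\<^sup>2 = \<beta>" "t\<^sup>2 = \<alpha>" using pos by (auto simp: s_def t_def)
  define p q where "p = (\<lambda>N. trial (A N) (u N) (v N) s t z L)" and "q = (\<lambda>N. trial (adjoint_mat (A N)) (v N) (u N) t s z L)"
  have limit: "(\<lambda>k. \<Sum>j<L. complex_of_real (\<sigma> / z ^ (2 * j + 1)) * f (r k) (M + j)
     + complex_of_real (\<tau> / z ^ (2 * j + 2)) * h (r k) (M + j)) \<longlonglongrightarrow> complex_of_real (\<sigma> * (\<Sum>j<L. Mu' (M + j) / z ^ (2 * j + 1)))"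
    if "\<And>j. (\<lambda>N. f N j) \<longlonglongrightarrow> complex_of_real (Mu' j)" "\<And>j. (\<lambda>N. h N j) \<longlonglongrightarrow> 0" for f h :: "nat \<Rightarrow> nat \<Rightarrow> complex" and Mu' M \<sigma> \<tau>
  proof -
    have "(\<lambda>k. \<Sum>j<L. complex_of_real (\<sigma> / z ^ (2 * j + 1)) * f (r k) (M + j)
     + complex_of_real (\<tau> / z ^ (2 * j + 2)) * h (r k) (M + j)) \<longlonglongrightarrow> (\<Sum>j<L. complex_of_real (\<sigma> / z ^ (2 * j + 1)) * complex_of_real (Mu' (M + j))
     + complex_of_real (\<tau> / z ^ (2 * j + 2)) * 0)"
      by (intro tendsto_sum tendsto_add tendsto_mult tendsto_const LIMSEQ_subseq[OF _ r(1)] that)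
    then show ?thesis by (simp add: sum_distrib_left)
  qed
  have A': "adjoint_mat (A N) \<in> carrier_mat (m N) N" for N using A by simp
  have pu_lim: "(\<lambda>k. cinner (p (r k)) (gpow (A (r k)) M *\<^sub>v u (r k))) \<longlonglongrightarrow> complex_of_real (s * (\<Sum>j<L. Mu (M + j) / z ^ (2 * j + 1)))" for M
  proof (rule Lim_transform_eventually[OF limit[OF mu cross]], rule always_eventually, rule allI)
    fix k
    have c: "A (r k) *\<^sub>v v (r k) \<in> carrier_vec (r k)" using mult_mat_vec_carrier[OF A v(1)[OF r(3)]] .
    show "(\<Sum>j<L. complex_of_real (s / z ^ (2 * j + 1)) * u_form (r k) (M + j)
     + complex_of_real (t / z ^ (2 * j + 2)) * uv_form (r k) (M + j))
     = cinner (p (r k)) (gpow (A (r k)) M *\<^sub>v u (r k))"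
      unfolding p_def cinner_trial[OF A u(1)[OF r(3)] v(1)[OF r(3)]] cinner_gpow_gpow[OF A u(1)[OF r(3)] u(1)[OF r(3)]]
        cinner_gpow_gpow[OF A c u(1)[OF r(3)]] ..
  qed
  have qv_lim: "(\<lambda>k. cinner (q (r k)) (gpow (adjoint_mat (A (r k))) M *\<^sub>v v (r k))) \<longlonglongrightarrow> complex_of_real (t * (\<Sum>j<L. Nu (M + j) / z ^ (2 * j + 1)))" for M
  proof (rule Lim_transform_eventually[OF limit[OF nu cross_adjoint]], rule always_eventually, rule allI)
    fix k
    have c: "adjoint_mat (A (r k)) *\<^sub>v u (r k) \<in> carrier_vec (m (r k))" using mult_mat_vec_carrier[OF A' u(1)[OF r(3)]] .
    show "(\<Sum>j<L. complex_of_real (t / z ^ (2 * j + 1)) * v_form (r k) (M + j)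
     + complex_of_real (s / z ^ (2 * j + 2)) * vu_form (r k) (M + j))
     = cinner (q (r k)) (gpow (adjoint_mat (A (r k))) M *\<^sub>v v (r k))"
      unfolding q_def cinner_trial[OF A' v(1)[OF r(3)] u(1)[OF r(3)]] cinner_gpow_gpow[OF A' v(1)[OF r(3)] v(1)[OF r(3)]]
        cinner_gpow_gpow[OF A' c v(1)[OF r(3)]] ..
  qed
  have pu0: "(\<lambda>k. cinner (p (r k)) (u (r k))) \<longlonglongrightarrow> complex_of_real (s * \<alpha>)"
    using pu_lim[of 0] gpow_0[OF A] u(1)[OF r(3)] by (simp add: \<alpha>_def)
  have qv0: "(\<lambda>k. cinner (q (r k)) (v (r k))) \<longlonglongrightarrow> complex_of_real (t * \<beta>)"
    using qv_lim[of 0] gpow_0[OF A'] v(1)[OF r(3)] by (simp add: \<beta>_def)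
  define e1 e2 where "e1 = s * (\<Sum>j<L. Mu (L + j) / z ^ (2 * j + 1))" and "e2 = t * (\<Sum>j<L. Nu (L + j) / z ^ (2 * j + 1))"
  have e: "0 \<le> e1" "0 \<le> e2"
    unfolding e1_def e2_def using st z by (auto intro!: mult_nonneg_nonneg sum_nonneg divide_nonneg_nonneg Mu_nonneg Nu_nonneg)
  define lhs where "lhs = (\<lambda>a b. 2 * \<theta> * Re (b * cnj a))"
  define rhs where "rhs = (\<lambda>a b a' b'. Re (complex_of_real s * cnj a) - Re (complex_of_real (s / z ^ (2 * L)) * cnj a')
     + Re (complex_of_real t * cnj b) - Re (complex_of_real (t / z ^ (2 * L)) * cnj b'))"
  define pu qv pu' qv' where "pu = (\<lambda>k. cinner (p (r k)) (u (r k)))" and "qv = (\<lambda>k. cinner (q (r k)) (v (r k)))"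
    and "pu' = (\<lambda>k. cinner (p (r k)) (gpow (A (r k)) L *\<^sub>v u (r k)))"
    and "qv' = (\<lambda>k. cinner (q (r k)) (gpow (adjoint_mat (A (r k))) L *\<^sub>v v (r k)))"
  have "lhs (complex_of_real (s * \<alpha>)) (complex_of_real (t * \<beta>))
      \<le> rhs (complex_of_real (s * \<alpha>)) (complex_of_real (t * \<beta>)) (complex_of_real e1) (complex_of_real e2)"
  proof (rule LIMSEQ_le)
    show "(\<lambda>k. lhs (pu k) (qv k)) \<longlonglongrightarrow> lhs (complex_of_real (s * \<alpha>)) (complex_of_real (t * \<beta>))"
      unfolding lhs_def pu_def qv_def
      by (intro tendsto_mult tendsto_const tendsto_Re tendsto_cnj pu0 qv0)
    show "(\<lambda>k. rhs (pu k) (qv k) (pu' k) (qv' k)) \<longlonglongrightarrow>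
       rhs (complex_of_real (s * \<alpha>)) (complex_of_real (t * \<beta>)) (complex_of_real e1) (complex_of_real e2)"
      unfolding rhs_def pu_def qv_def pu'_def qv'_def e1_def e2_def
      by (intro tendsto_add tendsto_diff tendsto_mult tendsto_const tendsto_Re tendsto_cnj pu_lim qv_lim pu0 qv0)
    show "\<exists>K. \<forall>k\<ge>K. lhs (pu k) (qv k) \<le> rhs (pu k) (qv k) (pu' k) (qv' k)"
    proof (intro exI allI impI)
      fix k
      obtain x y where svd: "is_svd False (perturbed \<theta> (r k)) (sing_vals (perturbed \<theta> (r k))) x y"
        using spiked_svd by blast
      show "lhs (pu k) (qv k) \<le> rhs (pu k) (qv k) (pu' k) (qv' k)"
        unfolding lhs_def rhs_def pu_def qv_def pu'_def qv'_def
        by (rule trial_inequality[OF A u(1)[OF r(3)] v(1)[OF r(3)] svd _ _ z])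
          (use r(2,3)[of k] m_ge[of "r k"] in \<open>auto simp: g_def p_def q_def\<close>)
    qed
  qed
  moreover have "0 \<le> s / z ^ (2 * L) * e1" "0 \<le> t / z ^ (2 * L) * e2" using e st z by auto
  ultimately have "2 * \<theta> * (t * \<beta> * (s * \<alpha>)) \<le> s * (s * \<alpha>) + t * (t * \<beta>)"
    unfolding lhs_def rhs_def by (simp del: of_real_mult of_real_divide of_real_power)
  also have "\<dots> = 2 * (\<alpha> * \<beta>)"
    using st by (simp add: power2_eq_square flip: mult.assoc)
  finally have "(\<theta> * (s * t)) * (\<alpha> * \<beta>) \<le> 1 * (\<alpha> * \<beta>)" by (simp add: algebra_simps)
  then have "\<theta> * (s * t) \<le> 1" using pos by (simp only: mult_le_cancel_right) (auto simp: not_less)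
  then have "(\<theta> * (s * t))\<^sup>2 \<le> 1" using \<theta> st by (intro power_le_one) auto
  then have "\<theta>\<^sup>2 * (\<alpha> * \<beta>) \<le> 1" using st by (simp add: power_mult_distrib mult_ac)
  then show False using super unfolding \<alpha>_def \<beta>_def by linarith
qed

end

section \<open>The outlier location as a function of the signal strength\<close>

text \<open>What the phase transition takes from the D-transform: a positive, strictly decreasing
  function that vanishes at infinity and has infinite slope at the edge.\<close>

locale spike_transform =
  fixes D :: "real \<Rightarrow> real" and b :: real
  assumes b_nonneg: "0 \<le> b"
    and D_pos: "\<And>z. b < z \<Longrightarrow> 0 < D z"
    and D_differentiable: "\<And>z. b < z \<Longrightarrow> D differentiable (at z)"
    and deriv_neg: "\<And>z. b < z \<Longrightarrow> deriv D z < 0"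
    and D_at_top: "(D \<longlongrightarrow> 0) at_top"
    and deriv_at_b: "filterlim (deriv D) at_bot (at_right b)"
begin

text \<open>Being above the threshold is phrased as solvability of the outlier equation;
  \<open>Lim_at_b\<close> matches this with the comparison against D(b+).\<close>

definition super :: "real \<Rightarrow> bool" where
  "super \<theta> \<longleftrightarrow> (\<exists>z>b. D z = 1 / \<theta>\<^sup>2)"

text \<open>The predicted limit of the largest singular value, continued by \<open>b\<close> below
  the threshold to give a single function that can be differentiated across it.\<close>

definition G :: "real \<Rightarrow> real" where
  "G \<theta> = (if super \<theta> then (THE z. b < z \<and> D z = 1 / \<theta>\<^sup>2) else b)"

lemma D_deriv: "b < z \<Longrightarrow> (D has_real_derivative deriv D z) (at z)"
  using D_differentiable DERIV_deriv_iff_real_differentiable by blast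

lemma D_continuous: "continuous_on {b<..} D"
  by (intro continuous_at_imp_continuous_on ballI DERIV_isCont[OF D_deriv]) simp

lemma D_less: "b < x \<Longrightarrow> x < y \<Longrightarrow> D y < D x"
  by (rule DERIV_neg_imp_decreasing) (use D_deriv deriv_neg in \<open>auto intro: order_less_le_trans\<close>)

lemma D_less_iff: "b < x \<Longrightarrow> b < y \<Longrightarrow> D y < D x \<longleftrightarrow> x < y"
  using D_less by (metis linorder_neqE_linordered_idom order_less_asym)

lemma D_inj: "b < x \<Longrightarrow> b < y \<Longrightarrow> D x = D y \<Longrightarrow> x = y"
  using D_less_iff by (metis linorder_neqE_linordered_idom order_less_irrefl)

text \<open>The inequality can be strict because D is strictly decreasing on an open interval and
  does not attain its supremum. The converse is the intermediate value theorem, as D is small far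
  out.\<close>

lemma super_iff_less:
  assumes "0 < \<theta>"
  shows "super \<theta> \<longleftrightarrow> (\<exists>z>b. 1 / \<theta>\<^sup>2 < D z)"
proof
  assume "super \<theta>"
  then obtain z where z: "b < z" "D z = 1 / \<theta>\<^sup>2" by (auto simp: super_def)
  obtain y where "b < y" "y < z" using dense[OF z(1)] by blast
  then show "\<exists>z>b. 1 / \<theta>\<^sup>2 < D z" using D_less[of y z] z by auto
next
  assume "\<exists>z>b. 1 / \<theta>\<^sup>2 < D z"
  then obtain z where z: "b < z" "1 / \<theta>\<^sup>2 < D z" by blast
  have "\<forall>\<^sub>F y in at_top. D y < 1 / \<theta>\<^sup>2"
    by (rule order_tendstoD(2)[OF D_at_top]) (use assms in simp)
  then obtain B where B: "\<And>y. B \<le> y \<Longrightarrow> D y < 1 / \<theta>\<^sup>2" by (auto simp: eventually_at_top_linorder)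
  define y where "y = max B z"
  have "\<exists>x\<ge>z. x \<le> y \<and> D x = 1 / \<theta>\<^sup>2"
    by (rule IVT2') (use z B[of y] in \<open>auto simp: y_def intro: continuous_on_subset[OF D_continuous]\<close>)
  then show "super \<theta>" using z unfolding super_def by (metis order_less_le_trans)
qed

lemma G_super:
  assumes "super \<theta>"
  shows "b < G \<theta>" "D (G \<theta>) = 1 / \<theta>\<^sup>2"
proof -
  obtain z where z: "b < z" "D z = 1 / \<theta>\<^sup>2" using assms by (auto simp: super_def)
  have "b < (THE z. b < z \<and> D z = 1 / \<theta>\<^sup>2) \<and> D (THE z. b < z \<and> D z = 1 / \<theta>\<^sup>2) = 1 / \<theta>\<^sup>2"
    by (rule theI[of _ z]) (use z D_inj in auto)
  then show "b < G \<theta>" "D (G \<theta>) = 1 / \<theta>\<^sup>2" using assms by (auto simp: G_def)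
qed

lemma G_eqI:
  assumes "b < z" "D z = 1 / \<theta>\<^sup>2"
  shows "G \<theta> = z"
proof -
  have "super \<theta>" using assms by (auto simp: super_def)
  then show ?thesis using G_super[of \<theta>] D_inj[OF _ assms(1)] assms by metis
qed

lemma b_le_G: "b \<le> G \<theta>"
  using G_super(1)[of \<theta>] by (cases "super \<theta>") (auto simp: G_def)

lemma D_above_G:
  assumes "0 < \<theta>" "G \<theta> < z"
  shows "\<theta>\<^sup>2 * D z < 1"
proof -
  have z: "b < z" using assms(2) b_le_G[of \<theta>] by simp
  have "D z < 1 / \<theta>\<^sup>2"
  proof (cases "super \<theta>")
    case True
    then show ?thesis using G_super[OF True] D_less[of "G \<theta>" z] assms(2) by simp
  next
    case False
    then show ?thesis
      using super_iff_less[OF assms(1)] z unfolding super_def by (metis linorder_neqE_linordered_idom)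
  qed
  then show ?thesis using assms(1) by (simp add: field_simps)
qed

lemma D_below_G:
  assumes "0 < \<theta>" "b < z" "z < G \<theta>"
  shows "1 < \<theta>\<^sup>2 * D z"
proof -
  have s: "super \<theta>" using assms by (auto simp: G_def split: if_splits)
  have "1 / \<theta>\<^sup>2 < D z" using G_super[OF s] D_less[of z "G \<theta>"] assms by simp
  then show ?thesis using assms(1) by (simp add: field_simps)
qed

text \<open>Since D decreases, its right limit at b is the supremum L of its values, possibly
  infinite; L > 1/\<theta>^2 holds exactly if some value exceeds 1/\<theta>^2. Positivity of L makes
  taking the inverse harmless.\<close>

lemma Lim_at_b:
  assumes "0 < \<theta>"
  shows "inverse (Lim (at_right b) (\<lambda>z. ereal (D z))) < ereal (\<theta>\<^sup>2) \<longleftrightarrow> super \<theta>"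
proof -
  define L where "L = (SUP z\<in>{b<..}. ereal (D z))"
  have "((\<lambda>z. ereal (D z)) \<longlongrightarrow> L) (at_right b)"
  proof (rule order_tendstoI)
    fix a assume "a < L"
    then obtain z where z: "b < z" "a < ereal (D z)" by (auto simp: L_def less_SUP_iff)
    have "\<forall>\<^sub>F y in at_right b. y \<in> {b<..<z}" by (rule eventually_at_right_real[OF z(1)])
    then show "\<forall>\<^sub>F y in at_right b. a < ereal (D y)"
    proof eventually_elim
      case (elim y)
      then have "ereal (D z) < ereal (D y)" using D_less[of y z] by simp
      then show ?case using z(2) by (rule order_less_trans[rotated])
    qed
  next
    fix a assume a: "L < a"
    have "\<forall>\<^sub>F y in at_right b. b < y" by (simp add: eventually_at_right_less)
    then show "\<forall>\<^sub>F y in at_right b. ereal (D y) < a"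
    proof eventually_elim
      case (elim y)
      then have "ereal (D y) \<le> L" unfolding L_def by (intro SUP_upper) auto
      then show ?case using a by (rule order_le_less_trans)
    qed
  qed
  then have Lim: "Lim (at_right b) (\<lambda>z. ereal (D z)) = L" by (intro tendsto_Lim) auto
  have "ereal 0 < ereal (D (b + 1))" using D_pos[of "b + 1"] by simp
  also have "\<dots> \<le> L" unfolding L_def by (intro SUP_upper) auto
  finally have L0: "0 < L" by (simp add: zero_ereal_def)
  have "inverse L < ereal (\<theta>\<^sup>2) \<longleftrightarrow> ereal (1 / \<theta>\<^sup>2) < L"
  proof (cases L)
    case (real r)
    then show ?thesis using L0 assms by (auto simp: field_simps)
  qed (use L0 assms in auto)
  also have "\<dots> \<longleftrightarrow> (\<exists>z>b. 1 / \<theta>\<^sup>2 < D z)" by (auto simp: L_def less_SUP_iff)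
  also have "\<dots> \<longleftrightarrow> super \<theta>" using super_iff_less[OF assms] by simp
  finally show ?thesis unfolding Lim .
qed

text \<open>Above the threshold G inverts z -> D(z)^(-1/2), whose derivative at \<rho> is -(1/2)
  \<theta>^3 D'(\<rho>) because D(\<rho>) = 1/\<theta>^2.\<close>

lemma G_deriv_super:
  assumes \<theta>: "0 < \<theta>" and s: "super \<theta>"
  shows "(G has_real_derivative - 2 / (\<theta> ^ 3 * deriv D (G \<theta>))) (at \<theta>)"
proof -
  define \<rho> where "\<rho> = G \<theta>"
  have \<rho>: "b < \<rho>" "D \<rho> = 1 / \<theta>\<^sup>2" using G_super[OF s] by (auto simp: \<rho>_def)
  define f where "f = (\<lambda>z. D z powr (-1/2))"
  have f\<rho>: "f \<rho> = \<theta>"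
    using \<theta> by (simp add: f_def \<rho>(2) powr_minus powr_divide flip: powr_half_sqrt)
  have Gf: "G (f z) = z" if "z \<in> {b<..}" for z
  proof (rule G_eqI)
    have p: "0 < D z" using that D_pos by simp
    have "(f z)\<^sup>2 = inverse (D z)"
      using p by (simp add: f_def powr_minus power_inverse powr_half_sqrt)
    then show "D z = 1 / (f z)\<^sup>2" by (simp add: field_simps)
  qed (use that in simp)
  have "(f has_real_derivative (-1/2) * D \<rho> powr (-1/2 - 1) * deriv D \<rho>) (at \<rho>)"
    unfolding f_def using DERIV_fun_powr[OF D_deriv[OF \<rho>(1)] D_pos[OF \<rho>(1)], of "-1/2"] by simp
  moreover have "D \<rho> powr (-1/2 - 1) = \<theta> ^ 3"
  proof -
    have "D \<rho> powr (-1/2 - 1) = f \<rho> * inverse (D \<rho>)"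
      unfolding f_def powr_diff[of "D \<rho>" "-1/2" 1] using D_pos[OF \<rho>(1)] by (simp only: powr_one divide_inverse less_imp_le)
    then show ?thesis unfolding f\<rho> \<rho>(2) by (simp add: power2_eq_square power3_eq_cube)
  qed
  ultimately have f': "(f has_real_derivative (-1/2) * \<theta> ^ 3 * deriv D \<rho>) (at \<rho>)" by simp
  have "continuous_on {b<..} f"
    unfolding f_def by (intro continuous_intros D_continuous) (use D_pos in force)
  moreover define e where "e = (-1/2) * \<theta> ^ 3 * deriv D \<rho>"
  moreover have "e \<noteq> 0" using \<theta> deriv_neg[OF \<rho>(1)] by (simp add: e_def)
  ultimately have "(G has_derivative (*) (inverse e)) (at (f \<rho>))"
    using f' \<rho>(1) Gf
    by (intro has_derivative_inverse_strong[where S = "{b<..}" and f = f and f' = "(*) e"])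
      (auto simp: has_field_derivative_def)
  then have "(G has_real_derivative inverse e) (at \<theta>)" by (simp add: has_field_derivative_def f\<rho>)
  moreover have "inverse e = - 2 / (\<theta> ^ 3 * deriv D \<rho>)"
    using \<theta> deriv_neg[OF \<rho>(1)] by (simp add: e_def field_simps)
  ultimately show ?thesis by (simp add: \<rho>_def)
qed

text \<open>At the threshold itself the derivative from the right vanishes only because
  \<^term>\<open>deriv D\<close> tends to minus infinity at \<^term>\<open>b\<close>.\<close>
lemma G_deriv_sub:
  assumes \<theta>: "0 < \<theta>" and s: "\<not> super \<theta>"
  shows "(G has_real_derivative 0) (at \<theta>)"
proof -
  have le: "D z \<le> 1 / \<theta>\<^sup>2" if "b < z" for z
    using s super_iff_less[OF \<theta>] that by (metis not_less)
  have Gb: "G \<theta> = b" using s by (simp add: G_def)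
  \<comment> \<open>Subcriticality is inherited by smaller parameters, so G is constant on the left
    and only difference quotients from the right need work.\<close>
  have G_left: "G t = b" if "0 < t" "t \<le> \<theta>" for t
  proof -
    have "1 / \<theta>\<^sup>2 \<le> 1 / t\<^sup>2" using that by (intro divide_left_mono power_mono) auto
    then have "\<not> super t" using super_iff_less[OF that(1)] le by (meson not_less order_trans)
    then show ?thesis by (simp add: G_def)
  qed
  have "\<forall>\<^sub>F t in at \<theta>. \<bar>(G t - G \<theta>) / (t - \<theta>)\<bar> < \<epsilon>" if \<epsilon>: "\<epsilon> > 0" for \<epsilon>
  proof -
    \<comment> \<open>Any constant above 2/\<theta>^3 would do: C bounds the difference quotients of
      -1/t^2 near \<theta>, whose limit is 2/\<theta>^3.\<close>
    define C where "C = 3 / \<theta> ^ 3"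
    have C: "C > 0" using \<theta> by (simp add: C_def)
    define N where "N = C / \<epsilon>"
    have N: "N > 0" using C \<epsilon> by (simp add: N_def)
    have "\<forall>\<^sub>F z in at_right b. deriv D z \<le> - N" using deriv_at_b by (simp add: filterlim_at_bot)
    then obtain d where d: "b < d" "\<And>z. b < z \<Longrightarrow> z < d \<Longrightarrow> deriv D z \<le> - N"
      unfolding eventually_at_right_field by blast
    \<comment> \<open>Mean value theorem between y and z, then y tends to b. The bound D y <=
      1/\<theta>^2 stands in for a value of D at the edge, and no such value need exist.\<close>
    have key: "N * (z - b) \<le> 1 / \<theta>\<^sup>2 - 1 / t\<^sup>2" if z: "b < z" "z < d" "1 / t\<^sup>2 \<le> D z" for z t
    proof -
      have "N * (z - y) \<le> 1 / \<theta>\<^sup>2 - 1 / t\<^sup>2" if y: "b < y" "y < z" for y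
      proof -
        obtain x where x: "y < x" "x < z" "D z - D y = (z - y) * deriv D x"
          using MVT2[OF y(2), of D "deriv D"] D_deriv y by force
        have "deriv D x \<le> - N" using d(2) x y z by simp
        then have "(z - y) * deriv D x \<le> (z - y) * (- N)" using y by (intro mult_left_mono) auto
        then show ?thesis using x(3) le[OF y(1)] z(3) by (simp add: algebra_simps)
      qed
      note bound = this
      have "\<forall>\<^sub>F y in at_right b. N * (z - y) \<le> 1 / \<theta>\<^sup>2 - 1 / t\<^sup>2"
        using eventually_at_right_real[OF z(1)] by eventually_elim (use bound in auto)
      moreover have "((\<lambda>y. N * (z - y)) \<longlongrightarrow> N * (z - b)) (at_right b)" by (intro tendsto_intros)
      ultimately show ?thesis by (intro tendsto_upperbound[of _ _ "at_right b"]) auto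
    qed
    have lim: "((\<lambda>t. 1 / \<theta>\<^sup>2 - 1 / t\<^sup>2) \<longlongrightarrow> 1 / \<theta>\<^sup>2 - 1 / \<theta>\<^sup>2) (at \<theta>)" using \<theta> by (intro tendsto_intros) auto
    have ev1: "\<forall>\<^sub>F t in at \<theta>. 1 / \<theta>\<^sup>2 - 1 / t\<^sup>2 < N * ((d - b) / 2)"
      by (rule order_tendstoD(2)[OF lim]) (use d N in simp)
    have "((\<lambda>t. 1 / t\<^sup>2) has_real_derivative (- 2 / \<theta> ^ 3)) (at \<theta>)"
      using \<theta> by (auto intro!: derivative_eq_intros simp: power2_eq_square power3_eq_cube)
    then have "((\<lambda>t. (1 / t\<^sup>2 - 1 / \<theta>\<^sup>2) / (t - \<theta>)) \<longlongrightarrow> (- 2 / \<theta> ^ 3)) (at \<theta>)"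
      by (simp add: has_field_derivative_iff)
    then have ev2: "\<forall>\<^sub>F t in at \<theta>. - C < (1 / t\<^sup>2 - 1 / \<theta>\<^sup>2) / (t - \<theta>)"
      by (rule order_tendstoD) (use \<theta> in \<open>simp add: C_def divide_strict_right_mono\<close>)
    have ev3: "\<forall>\<^sub>F t in at \<theta>. 0 < t"
      using order_tendstoD(1)[OF tendsto_ident_at \<theta>] .
    have ev4: "\<forall>\<^sub>F t in at \<theta>. t \<noteq> \<theta>" by (simp add: eventually_at_filter)
    show ?thesis
      using ev1 ev2 ev3 ev4
    proof eventually_elim
      case (elim t)
      show ?case
      proof (cases "t \<le> \<theta>")
        case True
        then show ?thesis using G_left[OF elim(3)] Gb \<epsilon> by simp
      next
        case t: False
        show ?thesis
        proof (cases "super t")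
          case False
          then show ?thesis using Gb \<epsilon> by (simp add: G_def)
        next
          case True
          define z where "z = G t"
          have z: "b < z" "D z = 1 / t\<^sup>2" using G_super[OF True] by (auto simp: z_def)
          \<comment> \<open>For t close to \<theta> the outlier lies where the slope bound is valid;
            otherwise \<open>key\<close> at the midpoint of b and d would contradict the closeness
            of t.\<close>
          have "z < d"
          proof (rule ccontr)
            assume "\<not> z < d"
            then have "(b + d) / 2 < z" using d by simp
            then have "N * ((b + d) / 2 - b) \<le> 1 / \<theta>\<^sup>2 - 1 / t\<^sup>2"
              using key[of "(b + d) / 2" t] D_less[of "(b + d) / 2" z] d z by simp
            moreover have "(b + d) / 2 - b = (d - b) / 2" by (simp add: field_simps)
            ultimately show False using elim(1) by simp
          qed
          then have "N * (z - b) \<le> 1 / \<theta>\<^sup>2 - 1 / t\<^sup>2" using key[of z t] z by simp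
          also have "\<dots> < C * (t - \<theta>)" using elim(2) t by (simp add: field_simps)
          finally have "C * (z - b) < C * (\<epsilon> * (t - \<theta>))" using \<epsilon> by (simp add: N_def field_simps)
          then have "z - b < \<epsilon> * (t - \<theta>)" using C by simp
          then show ?thesis using t z by (simp add: Gb z_def[symmetric] divide_less_eq abs_div_pos)
        qed
      qed
    qed
  qed
  then have "((\<lambda>t. (G t - G \<theta>) / (t - \<theta>)) \<longlongrightarrow> 0) (at \<theta>)"
    by (intro tendstoI) (simp add: dist_real_def)
  then show ?thesis by (simp add: has_field_derivative_iff)
qed

end

text \<open>Griffiths' lemma.\<close>
lemma subgradient_tendsto:
  fixes g :: "real \<Rightarrow> nat \<Rightarrow> real"
  assumes lim: "\<forall>\<^sub>F t in at \<theta>. g t \<longlonglongrightarrow> G t" and lim\<theta>: "g \<theta> \<longlonglongrightarrow> G \<theta>"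
    and sub: "\<forall>\<^sub>F n in sequentially. \<forall>t. g \<theta> n + (t - \<theta>) * d n \<le> g t n"
    and deriv: "(G has_real_derivative D) (at \<theta>)"
  shows "d \<longlonglongrightarrow> D"
proof -
  have q: "((\<lambda>t. (G t - G \<theta>) / (t - \<theta>)) \<longlongrightarrow> D) (at \<theta>)"
    using deriv by (simp add: has_field_derivative_iff)
  have quot: "(\<lambda>n. (g t n - g \<theta> n) / (t - \<theta>)) \<longlonglongrightarrow> (G t - G \<theta>) / (t - \<theta>)" if "g t \<longlonglongrightarrow> G t" "t \<noteq> \<theta>" for t
    by (intro tendsto_intros that lim\<theta>) (use that in simp)
  show ?thesis
  proof (rule order_tendstoI)
    \<comment> \<open>A point t to the left bounds the subgradients from below, because dividing by
      the negative t - \<theta> reverses the subgradient inequality. A point to the right gives the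
      upper bound.\<close>
    fix a assume "a < D"
    then have "\<forall>\<^sub>F t in at \<theta>. a < (G t - G \<theta>) / (t - \<theta>)" by (rule order_tendstoD[OF q])
    then have "\<forall>\<^sub>F t in at \<theta>. a < (G t - G \<theta>) / (t - \<theta>) \<and> g t \<longlonglongrightarrow> G t" using lim by eventually_elim simp
    then have "\<forall>\<^sub>F t in at_left \<theta>. a < (G t - G \<theta>) / (t - \<theta>) \<and> g t \<longlonglongrightarrow> G t"
      unfolding eventually_at_split by blast
    moreover have "\<forall>\<^sub>F t in at_left \<theta>. t < \<theta>" by (simp add: eventually_at_filter)
    ultimately have "\<forall>\<^sub>F t in at_left \<theta>. (a < (G t - G \<theta>) / (t - \<theta>) \<and> g t \<longlonglongrightarrow> G t) \<and> t < \<theta>"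
      by (rule eventually_conj)
    then obtain t where t: "a < (G t - G \<theta>) / (t - \<theta>)" "g t \<longlonglongrightarrow> G t" "t < \<theta>"
      using eventually_happens[of _ "at_left \<theta>"] by fastforce
    have "\<forall>\<^sub>F n in sequentially. a < (g t n - g \<theta> n) / (t - \<theta>)"
      by (rule order_tendstoD(1)[OF quot t(1)]) (use t in auto)
    then show "\<forall>\<^sub>F n in sequentially. a < d n" using sub
    proof eventually_elim
      case (elim n)
      have "(t - \<theta>) * d n \<le> g t n - g \<theta> n" using spec[OF elim(2), of t] by simp
      then have "(g t n - g \<theta> n) / (t - \<theta>) \<le> d n" using t(3) by (simp add: divide_le_eq mult.commute)
      then show ?case using elim(1) by simp
    qed
  next
    fix a assume "D < a"
    then have "\<forall>\<^sub>F t in at \<theta>. (G t - G \<theta>) / (t - \<theta>) < a" by (rule order_tendstoD[OF q])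
    then have "\<forall>\<^sub>F t in at \<theta>. (G t - G \<theta>) / (t - \<theta>) < a \<and> g t \<longlonglongrightarrow> G t" using lim by eventually_elim simp
    then have "\<forall>\<^sub>F t in at_right \<theta>. (G t - G \<theta>) / (t - \<theta>) < a \<and> g t \<longlonglongrightarrow> G t"
      unfolding eventually_at_split by blast
    moreover have "\<forall>\<^sub>F t in at_right \<theta>. \<theta> < t" by (simp add: eventually_at_filter)
    ultimately have "\<forall>\<^sub>F t in at_right \<theta>. ((G t - G \<theta>) / (t - \<theta>) < a \<and> g t \<longlonglongrightarrow> G t) \<and> \<theta> < t"
      by (rule eventually_conj)
    then obtain t where t: "(G t - G \<theta>) / (t - \<theta>) < a" "g t \<longlonglongrightarrow> G t" "\<theta> < t"
      using eventually_happens[of _ "at_right \<theta>"] by fastforce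
    have "\<forall>\<^sub>F n in sequentially. (g t n - g \<theta> n) / (t - \<theta>) < a"
      by (rule order_tendstoD(2)[OF quot t(1)]) (use t in auto)
    then show "\<forall>\<^sub>F n in sequentially. d n < a" using sub
    proof eventually_elim
      case (elim n)
      have "(t - \<theta>) * d n \<le> g t n - g \<theta> n" using spec[OF elim(2), of t] by simp
      then have "d n \<le> (g t n - g \<theta> n) / (t - \<theta>)" using t(3) by (simp add: le_divide_eq mult.commute)
      then show ?case using elim(1) by simp
    qed
  qed
qed

subsection \<open>The D-transform as a function of even moments\<close>

locale even_moments = real_distribution \<mu> for \<mu> +
  fixes b c :: real
  assumes bounded: "AE t in \<mu>. 0 \<le> t \<and> t \<le> b" and b_nonneg: "0 \<le> b" and c: "0 \<le> c" "c \<le> 1"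
begin

definition moment :: "nat \<Rightarrow> real" where
  "moment k = (\<integral>t. t ^ (2 * k) \<partial>\<mu>)"

lemma integrable_moment: "integrable \<mu> (\<lambda>t. t ^ (2 * k))"
proof (rule integrable_const_bound)
  show "AE t in \<mu>. norm (t ^ (2 * k)) \<le> b ^ (2 * k)"
    using bounded by eventually_elim (simp add: power_mono)
qed simp

lemma moment_nonneg: "0 \<le> moment k"
  unfolding moment_def by (rule integral_nonneg_AE) simp

lemma moment_le: "moment k \<le> b ^ (2 * k)"
proof -
  have "moment k \<le> (\<integral>t. b ^ (2 * k) \<partial>\<mu>)"
    unfolding moment_def
  proof (rule integral_mono_AE[OF integrable_moment])
    show "AE t in \<mu>. t ^ (2 * k) \<le> b ^ (2 * k)"
      using bounded by eventually_elim (simp add: power_mono)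
  qed simp
  then show ?thesis using prob_space by simp
qed

lemma moment_0: "moment 0 = 1"
  using prob_space by (simp add: moment_def)

lemma summable_moment:
  assumes "b < z"
  shows "summable (\<lambda>k. moment k * (1 / z\<^sup>2) ^ k)"
proof (rule summable_comparison_test')
  have z: "0 < z" using assms b_nonneg by simp
  show "summable (\<lambda>k. ((b / z)\<^sup>2) ^ k)"
    by (rule summable_geometric) (use assms b_nonneg z in \<open>simp add: power_less_one_iff abs_square_less_1\<close>)
  fix k :: nat
  have "moment k * (1 / z\<^sup>2) ^ k \<le> b ^ (2 * k) * (1 / z\<^sup>2) ^ k"
    by (rule mult_right_mono[OF moment_le]) simp
  also have "\<dots> = ((b / z)\<^sup>2) ^ k" by (simp add: power_divide power_mult)
  finally show "norm (moment k * (1 / z\<^sup>2) ^ k) \<le> ((b / z)\<^sup>2) ^ k" using moment_nonneg[of k] by simp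
qed

text \<open>The generating function of the even moments in the variable w = 1/z^2. Power series
  theory then supplies the derivative of D, with no differentiation under the integral.\<close>

definition F :: "real \<Rightarrow> real" where
  "F w = (\<Sum>k. moment k * w ^ k)"

lemma F_sums: "b < z \<Longrightarrow> (\<lambda>k. moment k * (1 / z\<^sup>2) ^ k) sums F (1 / z\<^sup>2)"
  unfolding F_def by (rule summable_sums[OF summable_moment])

text \<open>The geometric series of z/(z^2 - t^2) is integrated term by term; t <= b < z makes it
  absolutely summable.\<close>

lemma phi_sums:
  assumes z: "b < z"
  shows "(\<lambda>k. moment k / z ^ (2 * k + 1)) sums phi_tr \<mu> z"
proof -
  have z0: "0 < z" using assms b_nonneg by simp
  have ratio: "norm (t\<^sup>2 / z\<^sup>2) < 1" if "0 \<le> t" "t \<le> b" for t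
  proof -
    have "t\<^sup>2 < z\<^sup>2" using that z by (intro power_strict_mono) auto
    then show ?thesis using z0 by simp
  qed
  have term_eq: "t ^ (2 * k) / z ^ (2 * k + 1) = (1 / z) * (t\<^sup>2 / z\<^sup>2) ^ k" for t k
    by (simp add: power_divide power_mult)
  have sums: "(\<lambda>k. t ^ (2 * k) / z ^ (2 * k + 1)) sums (z / (z\<^sup>2 - t\<^sup>2))" if "0 \<le> t" "t \<le> b" for t
  proof -
    have "t\<^sup>2 < z\<^sup>2" using that z by (intro power_strict_mono) auto
    then have "(1 / z) * (1 / (1 - t\<^sup>2 / z\<^sup>2)) = z / (z\<^sup>2 - t\<^sup>2)"
      using z0 by (simp add: field_simps power2_eq_square)
    then show ?thesis
      unfolding term_eq using sums_mult[OF geometric_sums[OF ratio[OF that]], of "1 / z"] by simp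
  qed
  have int: "(\<integral>t. t ^ (2 * k) / z ^ (2 * k + 1) \<partial>\<mu>) = moment k / z ^ (2 * k + 1)" for k
    unfolding moment_def by simp
  have "(\<lambda>k. \<integral>t. t ^ (2 * k) / z ^ (2 * k + 1) \<partial>\<mu>) sums (\<integral>t. (\<Sum>k. t ^ (2 * k) / z ^ (2 * k + 1)) \<partial>\<mu>)"
  proof (rule sums_integral)
    show "integrable \<mu> (\<lambda>t. t ^ (2 * k) / z ^ (2 * k + 1))" for k
      using integrable_moment by simp
    show "AE t in \<mu>. summable (\<lambda>k. norm (t ^ (2 * k) / z ^ (2 * k + 1)))"
      using bounded
    proof eventually_elim
      case (elim t)
      have "summable (\<lambda>k. norm ((1 / z) * (t\<^sup>2 / z\<^sup>2) ^ k))"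
        using summable_geometric[of "norm (t\<^sup>2 / z\<^sup>2)"] ratio[of t] elim
        by (auto simp: norm_mult norm_power intro!: summable_mult)
      then show ?case unfolding term_eq .
    qed
    have "(\<integral>t. norm (t ^ (2 * k) / z ^ (2 * k + 1)) \<partial>\<mu>) = (1 / z) * (moment k * (1 / z\<^sup>2) ^ k)" for k
      using int[of k] z0 by (simp add: power_mult power_divide)
    then show "summable (\<lambda>k. \<integral>t. norm (t ^ (2 * k) / z ^ (2 * k + 1)) \<partial>\<mu>)"
      using summable_mult[OF summable_moment[OF z], of "1 / z"] by simp
  qed
  moreover have "(\<integral>t. (\<Sum>k. t ^ (2 * k) / z ^ (2 * k + 1)) \<partial>\<mu>) = phi_tr \<mu> z"
    unfolding phi_tr_def
  proof (rule integral_cong_AE)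
    have suminf: "(\<Sum>k. t ^ (2 * k) / z ^ (2 * k + 1)) = z / (z\<^sup>2 - t\<^sup>2)" if "0 \<le> t" "t \<le> b" for t
      by (rule sums_unique[OF sums[OF that], symmetric])
    show "AE t in \<mu>. (\<Sum>k. t ^ (2 * k) / z ^ (2 * k + 1)) = z / (z\<^sup>2 - t\<^sup>2)"
      using bounded by eventually_elim (use suminf in blast)
  qed simp_all
  ultimately show ?thesis unfolding int by simp
qed

lemma phi_eq_F:
  assumes z: "b < z"
  shows "phi_tr \<mu> z = F (1 / z\<^sup>2) / z"
proof -
  have "(\<lambda>k. moment k * (1 / z\<^sup>2) ^ k / z) sums (F (1 / z\<^sup>2) / z)"
    by (rule sums_divide[OF F_sums[OF z]])
  then have "(\<lambda>k. moment k / z ^ (2 * k + 1)) sums (F (1 / z\<^sup>2) / z)"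
    by (simp add: power_divide mult_ac flip: power_mult)
  then show ?thesis using phi_sums[OF z] sums_unique2 by blast
qed

lemma F_ge_1:
  assumes z: "b < z"
  shows "1 \<le> F (1 / z\<^sup>2)"
proof -
  have "(\<Sum>k<1. moment k * (1 / z\<^sup>2) ^ k) \<le> F (1 / z\<^sup>2)"
    unfolding F_def by (rule sum_le_suminf[OF summable_moment[OF z]]) (use moment_nonneg in auto)
  then show ?thesis by (simp add: moment_0)
qed

lemma F_mono:
  assumes "b < y" "y \<le> z"
  shows "F (1 / z\<^sup>2) \<le> F (1 / y\<^sup>2)"
  unfolding F_def
proof (rule suminf_le)
  fix k
  have "1 / z\<^sup>2 \<le> 1 / y\<^sup>2"
    using assms b_nonneg by (intro divide_left_mono power_mono) auto
  then show "moment k * (1 / z\<^sup>2) ^ k \<le> moment k * (1 / y\<^sup>2) ^ k"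
    by (intro mult_left_mono power_mono moment_nonneg) auto
qed (use assms summable_moment in auto)

text \<open>The coefficients are nonnegative, hence so is the derivative. An intermediate y with b <
  y < z puts 1/z^2 strictly inside the disc of convergence.\<close>

lemma F_deriv:
  assumes z: "b < z"
  shows "\<exists>F'\<ge>0. (F has_real_derivative F') (at (1 / z\<^sup>2))"
proof -
  obtain y where y: "b < y" "y < z" using dense[OF z] by blast
  have less: "norm (1 / z\<^sup>2) < norm (1 / y\<^sup>2)"
    using y b_nonneg by (auto intro!: divide_strict_left_mono power_strict_mono)
  have "(F has_real_derivative (\<Sum>n. diffs moment n * (1 / z\<^sup>2) ^ n)) (at (1 / z\<^sup>2))"
    unfolding F_def by (rule termdiffs_strong[OF summable_moment[OF y(1)] less])
  moreover have "0 \<le> (\<Sum>n. diffs moment n * (1 / z\<^sup>2) ^ n)"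
  proof (rule suminf_nonneg)
    show "summable (\<lambda>n. diffs moment n * (1 / z\<^sup>2) ^ n)"
    proof (rule termdiff_converges[OF less])
      fix x :: real assume "norm x < norm (1 / y\<^sup>2)"
      then show "summable (\<lambda>n. moment n * x ^ n)"
        by (rule powser_inside[OF summable_moment[OF y(1)]])
    qed
  qed (use moment_nonneg in \<open>simp add: diffs_def\<close>)
  ultimately show ?thesis by blast
qed

text \<open>D in the variable w = 1/z^2; the factor w collects the 1/z contributed by each of the
  two factors of D.\<close>

definition h :: "real \<Rightarrow> real" where
  "h w = w * (F w * (c * F w + (1 - c)))"

lemma D_eq_h:
  assumes z: "b < z"
  shows "D_tr c \<mu> z = h (1 / z\<^sup>2)"
proof -
  have "0 < z" using z b_nonneg by simp
  then show ?thesis by (simp add: D_tr_def h_def phi_eq_F[OF z] field_simps power2_eq_square)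
qed

lemma D_deriv_neg:
  assumes z: "b < z"
  shows "\<exists>d<0. (D_tr c \<mu> has_real_derivative d) (at z)"
proof -
  have z0: "0 < z" using z b_nonneg by simp
  obtain F' where F': "0 \<le> F'" "(F has_real_derivative F') (at (1 / z\<^sup>2))" using F_deriv[OF z] by blast
  let ?w = "1 / z\<^sup>2"
  define e where "e = F ?w * (c * F ?w + (1 - c)) + ?w * (F' * (c * F ?w + (1 - c)) + F ?w * (c * F'))"
  have h': "(h has_real_derivative e) (at ?w)"
    unfolding h_def[abs_def] e_def by (auto intro!: derivative_eq_intros F'(2) simp: algebra_simps)
  have "((\<lambda>z. 1 / z\<^sup>2) has_real_derivative (- 2 / z ^ 3)) (at z)"
    using z0 by (auto intro!: derivative_eq_intros simp: power2_eq_square power3_eq_cube)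
  from DERIV_chain2[OF h' this] have "((\<lambda>z. h (1 / z\<^sup>2)) has_real_derivative e * (- 2 / z ^ 3)) (at z)" .
  then have "(D_tr c \<mu> has_real_derivative e * (- 2 / z ^ 3)) (at z)"
    by (rule has_field_derivative_transform_within_open[of _ _ _ "{b<..}"]) (use z D_eq_h in auto)
  \<comment> \<open>The first summand of \<open>e\<close> is positive because F >= 1, and the second
    is nonnegative.\<close>
  moreover have "e > 0"
  proof -
    have F1: "1 \<le> F ?w" by (rule F_ge_1[OF z])
    have "c \<le> c * F ?w" using mult_left_mono[OF F1 c(1)] by simp
    then have "0 < c * F ?w + (1 - c)" by simp
    then have "0 < F ?w * (c * F ?w + (1 - c))" using F1 by (intro mult_pos_pos) auto
    moreover have "0 \<le> ?w * (F' * (c * F ?w + (1 - c)) + F ?w * (c * F'))"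
      using \<open>0 < c * F ?w + (1 - c)\<close> F' F1 c by (intro mult_nonneg_nonneg add_nonneg_nonneg) auto
    ultimately show ?thesis unfolding e_def by simp
  qed
  ultimately show ?thesis using z0 by (intro exI[of _ "e * (- 2 / z ^ 3)"]) (auto simp: divide_less_0_iff mult_less_0_iff)
qed

lemma D_pos:
  assumes z: "b < z"
  shows "0 < D_tr c \<mu> z"
proof -
  have F1: "1 \<le> F (1 / z\<^sup>2)" by (rule F_ge_1[OF z])
  have "c \<le> c * F (1 / z\<^sup>2)" using mult_left_mono[OF F1 c(1)] by simp
  then show ?thesis
    unfolding D_eq_h[OF z] h_def using F1 z b_nonneg by (intro mult_pos_pos) auto
qed

lemma D_tendsto_0: "(D_tr c \<mu> \<longlongrightarrow> 0) at_top"
proof (rule tendsto_sandwich[OF _ _ tendsto_const])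
  define B where "B = F (1 / (b + 1)\<^sup>2)"
  have ev: "\<forall>\<^sub>F z in at_top. b + 1 \<le> z" by (rule eventually_ge_at_top)
  then show "\<forall>\<^sub>F z in at_top. 0 \<le> D_tr c \<mu> z"
    by eventually_elim (use D_pos in \<open>auto intro: less_imp_le\<close>)
  show "\<forall>\<^sub>F z in at_top. D_tr c \<mu> z \<le> 1 / z\<^sup>2 * (B * (c * B + (1 - c)))"
    using ev
  proof eventually_elim
    case (elim z)
    then have z: "b < z" by simp
    have "F (1 / z\<^sup>2) \<le> B" unfolding B_def by (rule F_mono) (use elim in auto)
    then show ?case
      unfolding D_eq_h[OF z] h_def using F_ge_1[OF z] c
      by (intro mult_left_mono mult_mono add_mono) auto
  qed
  have "((\<lambda>z::real. 1 / z\<^sup>2) \<longlongrightarrow> 0) at_top"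
    by (intro tendsto_divide_0[OF tendsto_const] filterlim_at_top_imp_at_infinity filterlim_pow_at_top filterlim_ident) simp
  then show "((\<lambda>z. 1 / z\<^sup>2 * (B * (c * B + (1 - c)))) \<longlongrightarrow> 0) at_top"
    using tendsto_mult_left_zero by blast
qed

lemma spike_transform_D:
  assumes "filterlim (deriv (D_tr c \<mu>)) at_bot (at_right b)"
  shows "spike_transform (D_tr c \<mu>) b"
proof
  fix z assume z: "b < z"
  obtain d where d: "d < 0" "(D_tr c \<mu> has_real_derivative d) (at z)" using D_deriv_neg[OF z] by blast
  show "D_tr c \<mu> differentiable (at z)" using d(2) real_differentiable_def by blast
  show "deriv (D_tr c \<mu>) z < 0" using DERIV_imp_deriv[OF d(2)] d(1) by simp
qed (use b_nonneg D_pos D_tendsto_0 assms in auto)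

text \<open>The second factor of D is the same transform seen from v. A^H A has the n eigenvalues of
  A A^H together with m - n zeros, so the limiting law there is c \<mu> plus mass 1 - c at 0, and
  the extra mass shows only in the moment of order 0.\<close>

lemma weighted_moment_sums:
  assumes z: "b < z"
  shows "(\<lambda>k. (if k = 0 then 1 else c * moment k) / z ^ (2 * k + 1)) sums (c * phi_tr \<mu> z + (1 - c) / z)"
proof -
  have "(\<lambda>k. if k = 0 then (1 - c) / z else 0) sums ((1 - c) / z)"
    using sums_single[of 0 "\<lambda>_. (1 - c) / z"] by simp
  from sums_add[OF sums_mult[OF phi_sums[OF z], of c] this]
  show ?thesis by (rule sums_cong[THEN iffD1, rotated]) (auto simp: moment_0 simp flip: add_divide_distrib)
qed

end

section \<open>Limits of the top singular value, the overlap and the error\<close>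

lemma top_value_and_overlap_limits:
  assumes em: "even_moments \<mu> b c"
    and ml: "moment_limits A m u v (even_moments.moment \<mu>) (\<lambda>k. if k = 0 then 1 else c * even_moments.moment \<mu> k) b"
    and blow: "filterlim (deriv (D_tr c \<mu>)) at_bot (at_right b)"
    and \<theta>: "0 < \<theta>"
    and svd: "\<And>N. N \<ge> 1 \<Longrightarrow> is_svd rK (spiked (A N) \<theta> (u N) (v N)) (s N) (x N) (y N)"
  defines "\<rho> \<equiv> spike_transform.G (D_tr c \<mu>) b \<theta>"
  shows "(\<lambda>N. s N 0) \<longlonglongrightarrow> \<rho>"
    and "(\<lambda>N. \<theta> * Re (cinner (y N 0) (v N) * cinner (u N) (x N 0)))
      \<longlonglongrightarrow> (if spike_transform.super (D_tr c \<mu>) b \<theta> then - 2 / (\<theta>\<^sup>2 * deriv (D_tr c \<mu>) \<rho>) else 0)"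
proof -
  interpret even_moments \<mu> b c by (rule em)
  interpret moment_limits A m u v moment "\<lambda>k. if k = 0 then 1 else c * moment k" b by (rule ml)
  interpret D: spike_transform "D_tr c \<mu>" b by (rule spike_transform_D[OF blow])
  define \<phi> where "\<phi> = phi_tr \<mu>"
  define \<psi> where "\<psi> = (\<lambda>z. c * phi_tr \<mu> z + (1 - c) / z)"
  have D: "D_tr c \<mu> z = \<phi> z * \<psi> z" for z by (simp add: D_tr_def \<phi>_def \<psi>_def)
  have sums: "(\<lambda>k. moment k / z ^ (2 * k + 1)) sums \<phi> z"
    "(\<lambda>k. (if k = 0 then 1 else c * moment k) / z ^ (2 * k + 1)) sums \<psi> z" if "b < z" for z
    using phi_sums[OF that] weighted_moment_sums[OF that] by (auto simp: \<phi>_def \<psi>_def)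
  have b0: "0 \<le> b" by (rule even_moments.b_nonneg[OF em])
  have partial: "(\<Sum>k<K. moment k / z ^ (2 * k + 1)) \<le> \<phi> z"
    "(\<Sum>k<K. (if k = 0 then 1 else c * moment k) / z ^ (2 * k + 1)) \<le> \<psi> z" if "b < z" for z K
    using sum_le_suminf[OF sums_summable[OF sums(1)[OF that]], of "{..<K}"]
      sum_le_suminf[OF sums_summable[OF sums(2)[OF that]], of "{..<K}"]
      sums_unique[OF sums(1)[OF that]] sums_unique[OF sums(2)[OF that]] that b0 moment_nonneg Nu_nonneg
    by auto
  \<comment> \<open>The bound depends on t^2 only and is therefore available for negative t, as the
    midpoint argument requires.\<close>
  have upper: "\<forall>\<^sub>F N in sequentially. g t N < z" if "D.G \<bar>t\<bar> < z" "t \<noteq> 0" for t z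
  proof -
    have z: "b < z" using that(1) D.b_le_G[of "\<bar>t\<bar>"] by simp
    have "t\<^sup>2 * (\<phi> z * \<psi> z) < 1" using D.D_above_G[of "\<bar>t\<bar>" z] that by (simp add: D)
    from g_upper[OF z partial[OF z] this] show ?thesis .
  qed
  have lower: "\<forall>\<^sub>F N in sequentially. z < g t N" if t: "0 < t" and z: "b < z" "z < D.G t" for t z
  proof -
    have z0: "0 < z" using z b0 by simp
    have "1 < t\<^sup>2 * (\<phi> z * \<psi> z)" using D.D_below_G[OF t z] by (simp add: D)
    \<comment> \<open>\<open>g_lower\<close> takes truncated sums; the strict inequality for the
      full series already holds for some partial sum.\<close>
    moreover have "(\<lambda>K. t\<^sup>2 * ((\<Sum>k<K. moment k / z ^ (2 * k + 1)) * (\<Sum>k<K. (if k = 0 then 1 else c * moment k) / z ^ (2 * k + 1))))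
        \<longlonglongrightarrow> t\<^sup>2 * (\<phi> z * \<psi> z)"
      using sums[OF z(1)] unfolding sums_def by (intro tendsto_intros)
    ultimately have "\<forall>\<^sub>F K in sequentially. 1 < t\<^sup>2 * ((\<Sum>k<K. moment k / z ^ (2 * k + 1)) * (\<Sum>k<K. (if k = 0 then 1 else c * moment k) / z ^ (2 * k + 1)))"
      by (intro order_tendstoD)
    then obtain K where "1 < t\<^sup>2 * ((\<Sum>k<K. moment k / z ^ (2 * k + 1)) * (\<Sum>k<K. (if k = 0 then 1 else c * moment k) / z ^ (2 * k + 1)))"
      using eventually_happens'[OF sequentially_bot] by blast
    from g_lower[OF t z0 this] show ?thesis .
  qed
  have g_lim: "g t \<longlonglongrightarrow> D.G t" if t: "0 < t" for t
  proof (rule order_tendstoI)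
    fix a assume "D.G t < a"
    then show "\<forall>\<^sub>F N in sequentially. g t N < a" using upper[of t a] t by simp
  next
    fix a assume a: "a < D.G t"
    show "\<forall>\<^sub>F N in sequentially. a < g t N"
    proof (cases "D.super t")
      case True
      then have "max a b < D.G t" using a D.G_super(1) by simp
      then obtain z where z: "max a b < z" "z < D.G t" using dense by blast
      have "\<forall>\<^sub>F N in sequentially. z < g t N" using lower[OF t _ z(2)] z by simp
      then show ?thesis by eventually_elim (use z in simp)
    next
      case False
      then have G: "D.G t = b" by (simp add: D.G_def)
      \<comment> \<open>With this margin, convexity gives g t >= 2 g 0 - g (-t) > 2 (b - e) - (b +
        e) = b - 3 e = a.\<close>
      define e where "e = (b - a) / 3"
      have e: "0 < e" using a G by (simp add: e_def)
      have "\<forall>\<^sub>F N in sequentially. g (- t) N < b + e" using upper[of "- t" "b + e"] t G e by simp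
      moreover have "\<forall>\<^sub>F N in sequentially. b - e < g 0 N" using order_tendstoD(1)[OF g_0, of "b - e"] e by simp
      moreover have "\<forall>\<^sub>F N in sequentially. N \<ge> (1::nat)" by (rule eventually_ge_at_top)
      ultimately show ?thesis
      proof eventually_elim
        case (elim N)
        have "3 * e = b - a" by (simp add: e_def)
        then show ?case using elim g_midpoint[OF elim(3), of t] by linarith
      qed
    qed
  qed
  have lim: "g \<theta> \<longlonglongrightarrow> \<rho>" unfolding \<rho>_def by (rule g_lim[OF \<theta>])
  show "(\<lambda>N. s N 0) \<longlonglongrightarrow> \<rho>"
    by (rule Lim_transform_eventually[OF lim])
      (use eventually_ge_at_top[of 1] in eventually_elim, use top_singular_vectors(1)[OF svd] in simp)
  define d where "d = (\<lambda>N. Re (cinner (y N 0) (v N) * cinner (u N) (x N 0)))"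
  have ev: "\<forall>\<^sub>F t in at \<theta>. g t \<longlonglongrightarrow> D.G t"
    using order_tendstoD(1)[OF tendsto_ident_at \<theta>] by eventually_elim (rule g_lim)
  have sub: "\<forall>\<^sub>F N in sequentially. \<forall>t. g \<theta> N + (t - \<theta>) * d N \<le> g t N"
    using eventually_ge_at_top[of 1] by eventually_elim (use g_subgradient[OF svd] in \<open>auto simp: d_def\<close>)
  show "(\<lambda>N. \<theta> * Re (cinner (y N 0) (v N) * cinner (u N) (x N 0)))
      \<longlonglongrightarrow> (if D.super \<theta> then - 2 / (\<theta>\<^sup>2 * deriv (D_tr c \<mu>) \<rho>) else 0)"
  proof (cases "D.super \<theta>")
    case True
    have "d \<longlonglongrightarrow> - 2 / (\<theta> ^ 3 * deriv (D_tr c \<mu>) \<rho>)"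
      unfolding \<rho>_def by (rule subgradient_tendsto[OF ev g_lim[OF \<theta>] sub D.G_deriv_super[OF \<theta> True]])
    from tendsto_mult_left[OF this, of \<theta>] show ?thesis
      using True \<theta> by (simp add: d_def power2_eq_square power3_eq_cube mult.assoc)
  next
    case False
    have "d \<longlonglongrightarrow> 0" by (rule subgradient_tendsto[OF ev g_lim[OF \<theta>] sub D.G_deriv_sub[OF \<theta> False]])
    from tendsto_mult_left[OF this, of \<theta>] show ?thesis using False by (simp add: d_def)
  qed
qed

text \<open>The cross term factors into the product of the two overlaps, in which a common phase of
  the singular pair cancels; this is why the arbitrary choice of singular vectors does no
  harm.\<close>

lemma mse1_quadratic:
  assumes "u \<in> carrier_vec n" "vnorm u = 1" "v \<in> carrier_vec m" "vnorm v = 1"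
    and "x \<in> carrier_vec n" "vnorm x = 1" "y \<in> carrier_vec m" "vnorm y = 1"
  shows "mse1 (complex_of_real \<theta> \<cdot>\<^sub>m outer u v) x y w
       = \<theta>\<^sup>2 - 2 * w * (\<theta> * Re (cinner y v * cinner u x)) + w\<^sup>2"
proof -
  have sq: "(\<Sum>i<n. (cmod (z $ i))\<^sup>2) = 1" if "z \<in> carrier_vec n" "vnorm z = 1" for z and n
    using vnorm_sq[of z] that by simp
  have entry: "(cmod (complex_of_real \<theta> * (p * cnj q) - complex_of_real w * (r * cnj s)))\<^sup>2
     = \<theta>\<^sup>2 * ((cmod p)\<^sup>2 * (cmod q)\<^sup>2) - 2 * w * \<theta> * Re ((p * cnj r) * (s * cnj q)) + w\<^sup>2 * ((cmod r)\<^sup>2 * (cmod s)\<^sup>2)" for p q r s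
  proof -
    have "(cmod (a - b))\<^sup>2 = (cmod a)\<^sup>2 - 2 * Re (a * cnj b) + (cmod b)\<^sup>2" for a b
      unfolding cmod_power2 by (simp add: algebra_simps power2_eq_square)
    then have "(cmod (complex_of_real \<theta> * (p * cnj q) - complex_of_real w * (r * cnj s)))\<^sup>2
        = (cmod (complex_of_real \<theta> * (p * cnj q)))\<^sup>2
          - 2 * Re ((complex_of_real \<theta> * (p * cnj q)) * cnj (complex_of_real w * (r * cnj s)))
          + (cmod (complex_of_real w * (r * cnj s)))\<^sup>2" .
    moreover have "(complex_of_real \<theta> * (p * cnj q)) * cnj (complex_of_real w * (r * cnj s))
        = complex_of_real (w * \<theta>) * ((p * cnj r) * (s * cnj q))"
      by simp
    then have "Re ((complex_of_real \<theta> * (p * cnj q)) * cnj (complex_of_real w * (r * cnj s)))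
        = w * \<theta> * Re ((p * cnj r) * (s * cnj q))"
      by (simp only: Re_complex_of_real Im_complex_of_real times_complex.sel mult_zero_left diff_zero)
    ultimately show ?thesis by (simp add: norm_mult power_mult_distrib)
  qed
  have "mse1 (complex_of_real \<theta> \<cdot>\<^sub>m outer u v) x y w
      = (\<Sum>i<n. \<Sum>j<m. (cmod (complex_of_real \<theta> * (u $ i * cnj (v $ j)) - complex_of_real w * (x $ i * cnj (y $ j))))\<^sup>2)"
    unfolding mse1_def fro_sq_def using assms by (simp add: outer_def)
  also have "\<dots> = \<theta>\<^sup>2 * (\<Sum>i<n. \<Sum>j<m. (cmod (u $ i))\<^sup>2 * (cmod (v $ j))\<^sup>2)
      - 2 * w * \<theta> * Re (\<Sum>i<n. \<Sum>j<m. (u $ i * cnj (x $ i)) * (y $ j * cnj (v $ j)))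
      + w\<^sup>2 * (\<Sum>i<n. \<Sum>j<m. (cmod (x $ i))\<^sup>2 * (cmod (y $ j))\<^sup>2)"
    unfolding entry by (simp only: sum.distrib sum_subtractf sum_distrib_left Re_sum)
  also have "(\<Sum>i<n. \<Sum>j<m. (cmod (u $ i))\<^sup>2 * (cmod (v $ j))\<^sup>2) = 1"
    unfolding sum_product[symmetric] using sq assms by simp
  also have "(\<Sum>i<n. \<Sum>j<m. (cmod (x $ i))\<^sup>2 * (cmod (y $ j))\<^sup>2) = 1"
    unfolding sum_product[symmetric] using sq assms by simp
  also have "(\<Sum>i<n. \<Sum>j<m. (u $ i * cnj (x $ i)) * (y $ j * cnj (v $ j))) = cinner u x * cinner y v"
    unfolding sum_product[symmetric] using assms by (simp add: cinner_eq_sum)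
  finally show ?thesis by (simp add: algebra_simps)
qed

text \<open>\<open>ARG_MIN\<close> picks some minimiser, so its value is pinned down by uniqueness:
  over the half-line it is the vertex \<tau> of the parabola, or 0 when \<tau> is negative.\<close>

lemma wopt1_eq:
  assumes "\<And>w. mse1 S x y w = K - 2 * w * \<tau> + w\<^sup>2"
  shows "wopt1 S x y = max 0 \<tau>"
proof -
  have q: "mse1 S x y w = (w - \<tau>)\<^sup>2 + (K - \<tau>\<^sup>2)" for w
    unfolding assms by (simp add: power2_eq_square algebra_simps)
  have min: "(max 0 \<tau> - \<tau>)\<^sup>2 \<le> (w - \<tau>)\<^sup>2" if "0 \<le> w" for w
    using that by (cases "0 \<le> \<tau>") (auto simp: power_mono[of "- \<tau>" "w - \<tau>" 2, simplified])
  have ex: "is_arg_min (mse1 S x y) (\<lambda>w. 0 \<le> w) (max 0 \<tau>)"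
    using min by (auto simp: is_arg_min_linorder q)
  have "is_arg_min (mse1 S x y) (\<lambda>w. 0 \<le> w) (wopt1 S x y)"
    unfolding wopt1_def arg_min_def by (rule someI[where P = "is_arg_min (mse1 S x y) (\<lambda>w. 0 \<le> w)", OF ex])
  then have w: "0 \<le> wopt1 S x y" "(wopt1 S x y - \<tau>)\<^sup>2 \<le> (max 0 \<tau> - \<tau>)\<^sup>2"
    by (auto simp: is_arg_min_linorder q)
  show ?thesis
  proof (cases "0 \<le> \<tau>")
    case False
    then have "max 0 \<tau> - \<tau> = - \<tau>" by simp
    then have "(wopt1 S x y - \<tau>)\<^sup>2 \<le> (- \<tau>)\<^sup>2" using w(2) by metis
    then have "wopt1 S x y - \<tau> \<le> - \<tau>" by (rule power2_le_imp_le) (use False in simp)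
    then have "wopt1 S x y = 0" using w(1) by linarith
    then show ?thesis using False by (simp only: max_def) simp
  next
    case True
    then have "max 0 \<tau> = \<tau>" by simp
    then have "(wopt1 S x y - \<tau>)\<^sup>2 \<le> 0" using w(2) by (simp only: diff_self power_zero_numeral)
    then have "wopt1 S x y - \<tau> = 0" by (simp only: power2_less_eq_zero_iff)
    then show ?thesis using \<open>max 0 \<tau> = \<tau>\<close> by linarith
  qed
qed

section \<open>Invariant random matrices\<close>

subsection \<open>Fourth moments of random sign sums\<close>

definition signs :: "nat \<Rightarrow> (nat \<Rightarrow> real) set" where
  "signs n = PiE {..<n} (\<lambda>_. {-1, 1})"

text \<open>Expectation over independent uniform signs, kept as a finite sum so that it commutes
  with integrals over the sample space by linearity.\<close>

definition sign_mean :: "nat \<Rightarrow> ((nat \<Rightarrow> real) \<Rightarrow> real) \<Rightarrow> real" where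
  "sign_mean n F = (\<Sum>\<epsilon>\<in>signs n. F \<epsilon>) / 2 ^ n"

lemma card_signs: "card (signs n) = 2 ^ n"
  by (simp add: signs_def card_PiE numeral_2_eq_2)

lemma signs_sq:
  assumes "\<epsilon> \<in> signs n" "i < n" shows "(\<epsilon> i)\<^sup>2 = 1"
proof -
  have "\<epsilon> i \<in> {-1, 1}" using assms by (auto simp: signs_def PiE_iff)
  then show ?thesis by auto
qed

lemma sign_mean_0: "sign_mean 0 F = F (\<lambda>_. undefined)"
  by (simp add: sign_mean_def signs_def)

text \<open>Conditioning on the last sign, which drives the moment inductions below.\<close>

lemma sign_mean_Suc:
  "sign_mean (Suc n) F = sign_mean n (\<lambda>\<epsilon>. (F (\<epsilon>(n := 1)) + F (\<epsilon>(n := -1))) / 2)"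
proof -
  have "signs (Suc n) = (\<lambda>(y, \<epsilon>). \<epsilon>(n := y)) ` ({-1, 1} \<times> signs n)"
    by (simp add: signs_def lessThan_Suc PiE_insert_eq)
  moreover have "inj_on (\<lambda>(y, \<epsilon>). \<epsilon>(n := y)) ({-1, 1} \<times> signs n)"
    unfolding signs_def by (rule inj_combinator) simp
  ultimately have "(\<Sum>\<epsilon>\<in>signs (Suc n). F \<epsilon>) = (\<Sum>(y, \<epsilon>)\<in>{-1, 1} \<times> signs n. F (\<epsilon>(n := y)))"
    by (simp add: sum.reindex case_prod_unfold)
  also have "\<dots> = (\<Sum>y\<in>{-1, 1}. \<Sum>\<epsilon>\<in>signs n. F (\<epsilon>(n := y)))"
    by (rule sum.cartesian_product[symmetric])
  also have "\<dots> = (\<Sum>\<epsilon>\<in>signs n. F (\<epsilon>(n := 1)) + F (\<epsilon>(n := -1)))"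
    by (simp add: sum.distrib)
  finally show ?thesis by (simp add: sign_mean_def sum_divide_distrib[symmetric] field_simps)
qed

lemma sign_mean_add: "sign_mean n (\<lambda>\<epsilon>. F \<epsilon> + F' \<epsilon>) = sign_mean n F + sign_mean n F'"
  by (simp add: sign_mean_def sum.distrib add_divide_distrib)

lemma sign_mean_cmult: "sign_mean n (\<lambda>\<epsilon>. c * F \<epsilon>) = c * sign_mean n F"
  by (simp add: sign_mean_def sum_distrib_left)

lemma sign_mean_const: "sign_mean n (\<lambda>\<epsilon>. c) = c"
  by (simp add: sign_mean_def card_signs)

lemma sign_mean_Cauchy_Schwarz:
  "(sign_mean n (\<lambda>\<epsilon>. F \<epsilon> * F' \<epsilon>))\<^sup>2 \<le> sign_mean n (\<lambda>\<epsilon>. (F \<epsilon>)\<^sup>2) * sign_mean n (\<lambda>\<epsilon>. (F' \<epsilon>)\<^sup>2)"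
proof -
  have "(\<Sum>\<epsilon>\<in>signs n. F \<epsilon> * F' \<epsilon>)\<^sup>2 \<le> (\<Sum>\<epsilon>\<in>signs n. (F \<epsilon>)\<^sup>2) * (\<Sum>\<epsilon>\<in>signs n. (F' \<epsilon>)\<^sup>2)"
    by (rule Cauchy_Schwarz_ineq_sum)
  then show ?thesis
    by (simp add: sign_mean_def power_divide divide_right_mono power2_eq_square flip: power_mult_distrib)
qed

lemma sum_upd_Suc:
  fixes a \<epsilon> :: "nat \<Rightarrow> real"
  shows "(\<Sum>i<Suc n. a i * (\<epsilon>(n := y)) i) = (\<Sum>i<n. a i * \<epsilon> i) + y * a n"
proof -
  have "(\<Sum>i<n. a i * (\<epsilon>(n := y)) i) = (\<Sum>i<n. a i * \<epsilon> i)" by (rule sum.cong) auto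
  then show ?thesis by simp
qed

lemma sign_sum_second_moment: "sign_mean n (\<lambda>\<epsilon>. (\<Sum>i<n. a i * \<epsilon> i)\<^sup>2) = (\<Sum>i<n. (a i)\<^sup>2)"
proof (induction n)
  case 0
  then show ?case by (simp add: sign_mean_0)
next
  case (Suc n)
  have expand: "((L + 1 * t)\<^sup>2 + (L + (-1) * t)\<^sup>2) / 2 = L\<^sup>2 + t\<^sup>2" for L t :: real
    by (simp add: power2_eq_square algebra_simps)
  show ?case
    unfolding sign_mean_Suc sum_upd_Suc expand sign_mean_add sign_mean_const Suc by simp
qed

text \<open>Averaging over the last sign kills odd powers and leaves L^4 + 6 t^2 L^2 + t^4. With the
  constant 3 the cross term 6 q t^2 is exactly the one in 3 (q + t^2)^2.\<close>

lemma sign_sum_fourth_moment: "sign_mean n (\<lambda>\<epsilon>. (\<Sum>i<n. a i * \<epsilon> i) ^ 4) \<le> 3 * (\<Sum>i<n. (a i)\<^sup>2)\<^sup>2"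
proof (induction n)
  case 0
  then show ?case by (simp add: sign_mean_0)
next
  case (Suc n)
  let ?q = "\<Sum>i<n. (a i)\<^sup>2"
  have expand: "((L + 1 * t) ^ 4 + (L + (-1) * t) ^ 4) / 2 = L ^ 4 + ((6 * t\<^sup>2) * L\<^sup>2 + t ^ 4)" for L t :: real
    by (simp add: power4_eq_xxxx power2_eq_square algebra_simps)
  have "sign_mean (Suc n) (\<lambda>\<epsilon>. (\<Sum>i<Suc n. a i * \<epsilon> i) ^ 4)
      = sign_mean n (\<lambda>\<epsilon>. (\<Sum>i<n. a i * \<epsilon> i) ^ 4) + (6 * (a n)\<^sup>2 * ?q + a n ^ 4)"
    unfolding sign_mean_Suc sum_upd_Suc expand sign_mean_add sign_mean_const sign_mean_cmult
      sign_sum_second_moment ..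
  also have "\<dots> \<le> 3 * ?q\<^sup>2 + (6 * (a n)\<^sup>2 * ?q + a n ^ 4)" using Suc by simp
  also have "\<dots> \<le> 3 * (?q + (a n)\<^sup>2)\<^sup>2"
  proof -
    have "a n ^ 4 = ((a n)\<^sup>2)\<^sup>2" by (simp flip: power_mult)
    moreover have "3 * q\<^sup>2 + (6 * t * q + t\<^sup>2) \<le> 3 * (q + t)\<^sup>2" for q t :: real
      by (simp add: power2_sum)
    ultimately show ?thesis by metis
  qed
  finally show ?case by simp
qed

text \<open>The last sign multiplies a linear form L, so averaging leaves Q^4 + 6 Q^2 L^2 + L^4. If
  C is the constant for Q, Cauchy--Schwarz bounds the middle term by 6 sqrt (C q^2 * 3 l^2), and the
  induction closes when 6 sqrt (3 C) <= 2 C; hence C = 27.\<close>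

lemma sign_chaos_fourth_moment:
  "sign_mean n (\<lambda>\<epsilon>. (\<Sum>i<n. \<Sum>j<i. B i j * \<epsilon> i * \<epsilon> j) ^ 4) \<le> 27 * (\<Sum>i<n. \<Sum>j<i. (B i j)\<^sup>2)\<^sup>2"
proof (induction n)
  case 0
  then show ?case by (simp add: sign_mean_0)
next
  case (Suc n)
  define Q where "Q = (\<lambda>\<epsilon>. \<Sum>i<n. \<Sum>j<i. B i j * \<epsilon> i * \<epsilon> j)"
  define L where "L = (\<lambda>\<epsilon>. \<Sum>j<n. B n j * \<epsilon> j)"
  define q l where "q = (\<Sum>i<n. \<Sum>j<i. (B i j)\<^sup>2)" and "l = (\<Sum>j<n. (B n j)\<^sup>2)"
  have ql: "0 \<le> q" "0 \<le> l" by (auto simp: q_def l_def intro!: sum_nonneg)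
  have Q4: "sign_mean n (\<lambda>\<epsilon>. Q \<epsilon> ^ 4) \<le> 27 * q\<^sup>2" using Suc by (simp add: Q_def q_def)
  have L4: "sign_mean n (\<lambda>\<epsilon>. L \<epsilon> ^ 4) \<le> 3 * l\<^sup>2" unfolding L_def l_def by (rule sign_sum_fourth_moment)
  have "(sign_mean n (\<lambda>\<epsilon>. (Q \<epsilon>)\<^sup>2 * (L \<epsilon>)\<^sup>2))\<^sup>2 \<le> sign_mean n (\<lambda>\<epsilon>. Q \<epsilon> ^ 4) * sign_mean n (\<lambda>\<epsilon>. L \<epsilon> ^ 4)"
    using sign_mean_Cauchy_Schwarz[of n "\<lambda>\<epsilon>. (Q \<epsilon>)\<^sup>2" "\<lambda>\<epsilon>. (L \<epsilon>)\<^sup>2"] by (simp flip: power_mult)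
  also have "\<dots> \<le> (27 * q\<^sup>2) * (3 * l\<^sup>2)"
    by (rule mult_mono[OF Q4 L4]) (auto simp: sign_mean_def intro!: divide_nonneg_nonneg sum_nonneg)
  also have "\<dots> = (9 * (q * l))\<^sup>2" by (simp add: power_mult_distrib)
  finally have QL: "sign_mean n (\<lambda>\<epsilon>. (Q \<epsilon>)\<^sup>2 * (L \<epsilon>)\<^sup>2) \<le> 9 * (q * l)"
    by (rule power2_le_imp_le) (use ql in simp)
  have upd: "(\<Sum>i<n. \<Sum>j<i. B i j * (\<epsilon>(n := y)) i * (\<epsilon>(n := y)) j) = Q \<epsilon>" for \<epsilon> y
    unfolding Q_def by (intro sum.cong refl) auto
  have upd': "(\<Sum>j<n. B n j * (\<epsilon>(n := y)) n * (\<epsilon>(n := y)) j) = y * L \<epsilon>" for \<epsilon> y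
    unfolding L_def sum_distrib_left by (intro sum.cong refl) auto
  have expand: "((a + t) ^ 4 + (a - t) ^ 4) / 2 = a ^ 4 + (6 * (a\<^sup>2 * t\<^sup>2) + t ^ 4)" for a t :: real
    by (simp add: power4_eq_xxxx power2_eq_square algebra_simps)
  have "sign_mean (Suc n) (\<lambda>\<epsilon>. (\<Sum>i<Suc n. \<Sum>j<i. B i j * \<epsilon> i * \<epsilon> j) ^ 4)
      = sign_mean n (\<lambda>\<epsilon>. ((Q \<epsilon> + L \<epsilon>) ^ 4 + (Q \<epsilon> - L \<epsilon>) ^ 4) / 2)"
    unfolding sign_mean_Suc sum.lessThan_Suc upd upd' by simp
  also have "\<dots> = sign_mean n (\<lambda>\<epsilon>. Q \<epsilon> ^ 4) + (6 * sign_mean n (\<lambda>\<epsilon>. (Q \<epsilon>)\<^sup>2 * (L \<epsilon>)\<^sup>2) + sign_mean n (\<lambda>\<epsilon>. L \<epsilon> ^ 4))"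
    unfolding expand sign_mean_add sign_mean_cmult ..
  also have "\<dots> \<le> 27 * q\<^sup>2 + (6 * (9 * (q * l)) + 3 * l\<^sup>2)"
    by (intro add_mono mult_left_mono Q4 L4 QL) auto
  also have "\<dots> \<le> 27 * (q + l)\<^sup>2"
    by (simp add: power2_eq_square algebra_simps)
  finally show ?case by (simp add: q_def l_def)
qed

text \<open>Squares of signs are 1, so the diagonal part is deterministic; the rest is folded onto
  the strict lower triangle and becomes a chaos.\<close>

lemma quadratic_form_split:
  fixes B :: "nat \<Rightarrow> nat \<Rightarrow> real"
  assumes "\<And>i. i < n \<Longrightarrow> (\<epsilon> i)\<^sup>2 = 1"
  shows "(\<Sum>i<n. \<Sum>j<n. B i j * \<epsilon> i * \<epsilon> j) = (\<Sum>i<n. B i i) + (\<Sum>i<n. \<Sum>j<i. (B i j + B j i) * \<epsilon> i * \<epsilon> j)"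
  using assms
proof (induction n)
  case (Suc n)
  have "(\<Sum>i<Suc n. \<Sum>j<Suc n. B i j * \<epsilon> i * \<epsilon> j)
      = (\<Sum>i<n. \<Sum>j<n. B i j * \<epsilon> i * \<epsilon> j) + (\<Sum>i<n. B i n * \<epsilon> i * \<epsilon> n) + (\<Sum>j<n. B n j * \<epsilon> n * \<epsilon> j) + B n n * (\<epsilon> n)\<^sup>2"
    by (simp add: sum.distrib power2_eq_square)
  also have "(\<epsilon> n)\<^sup>2 = 1" using Suc.prems by simp
  also have "(\<Sum>i<n. \<Sum>j<n. B i j * \<epsilon> i * \<epsilon> j) = (\<Sum>i<n. B i i) + (\<Sum>i<n. \<Sum>j<i. (B i j + B j i) * \<epsilon> i * \<epsilon> j)"
    using Suc by simp
  finally show ?case by (simp add: algebra_simps sum.distrib)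
qed simp

lemma sum_below_diagonal_le:
  fixes B :: "nat \<Rightarrow> nat \<Rightarrow> real"
  shows "(\<Sum>i<n. \<Sum>j<i. (B i j + B j i)\<^sup>2) \<le> 2 * (\<Sum>i<n. \<Sum>j<n. (B i j)\<^sup>2)"
proof (induction n)
  case (Suc n)
  have "(\<Sum>j<n. (B n j + B j n)\<^sup>2) \<le> (\<Sum>j<n. 2 * (B n j)\<^sup>2 + 2 * (B j n)\<^sup>2)"
  proof (rule sum_mono)
    fix j show "(B n j + B j n)\<^sup>2 \<le> 2 * (B n j)\<^sup>2 + 2 * (B j n)\<^sup>2"
      using sum_squares_bound[of "B n j" "B j n"] by (simp add: power2_sum)
  qed
  then have T: "(\<Sum>j<n. (B n j + B j n)\<^sup>2) \<le> 2 * (\<Sum>j<n. (B n j)\<^sup>2) + 2 * (\<Sum>j<n. (B j n)\<^sup>2)"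
    by (simp only: sum.distrib sum_distrib_left)
  have R: "(\<Sum>i<Suc n. \<Sum>j<Suc n. (B i j)\<^sup>2)
      = (\<Sum>i<n. \<Sum>j<n. (B i j)\<^sup>2) + (\<Sum>i<n. (B i n)\<^sup>2) + (\<Sum>j<n. (B n j)\<^sup>2) + (B n n)\<^sup>2"
    by (simp add: sum.distrib)
  have arith: "S + T \<le> 2 * R" if "S \<le> 2 * A" "T \<le> 2 * C + 2 * D" "R = A + D + C + E" "0 \<le> E" for S T R A C D E :: real
    using that by linarith
  show ?case
    unfolding sum.lessThan_Suc[of "\<lambda>i. \<Sum>j<i. (B i j + B j i)\<^sup>2" n]
    by (rule arith[OF Suc T R zero_le_power2])
qed simp

text \<open>Here 108 = 27 * 2^2, the factor 2 coming from
  \<open>sum_below_diagonal_le\<close>.\<close>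

lemma sign_quadratic_form_fourth_moment:
  "sign_mean n (\<lambda>\<epsilon>. ((\<Sum>i<n. \<Sum>j<n. B i j * \<epsilon> i * \<epsilon> j) - (\<Sum>i<n. B i i)) ^ 4)
    \<le> 108 * (\<Sum>i<n. \<Sum>j<n. (B i j)\<^sup>2)\<^sup>2"
proof -
  have "sign_mean n (\<lambda>\<epsilon>. ((\<Sum>i<n. \<Sum>j<n. B i j * \<epsilon> i * \<epsilon> j) - (\<Sum>i<n. B i i)) ^ 4)
      = sign_mean n (\<lambda>\<epsilon>. (\<Sum>i<n. \<Sum>j<i. (B i j + B j i) * \<epsilon> i * \<epsilon> j) ^ 4)"
    unfolding sign_mean_def by (simp add: quadratic_form_split signs_sq cong: sum.cong)
  also have "\<dots> \<le> 27 * (\<Sum>i<n. \<Sum>j<i. (B i j + B j i)\<^sup>2)\<^sup>2" by (rule sign_chaos_fourth_moment)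
  also have "\<dots> \<le> 27 * (2 * (\<Sum>i<n. \<Sum>j<n. (B i j)\<^sup>2))\<^sup>2"
    by (intro mult_left_mono power_mono sum_below_diagonal_le sum_nonneg) auto
  finally show ?thesis by (simp add: power_mult_distrib)
qed

subsection \<open>Unitary matrices\<close>

lemma unitary_carrier: "unitary_K rK d U \<Longrightarrow> U \<in> carrier_mat d d"
  by (simp add: unitary_K_def)

lemma unitary_left: "unitary_K rK d U \<Longrightarrow> U * adjoint_mat U = 1\<^sub>m d"
  by (simp add: unitary_K_def)

lemma unitary_right:
  assumes "unitary_K rK d U" shows "adjoint_mat U * U = 1\<^sub>m d"
  using mat_mult_left_right_inverse[of U d "adjoint_mat U"] assms by (auto simp: unitary_K_def)

lemma unitary_adjoint:
  assumes "unitary_K rK d U" shows "unitary_K rK d (adjoint_mat U)"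
  using assms unitary_right[OF assms] by (auto simp: unitary_K_def real_mat_def Reals_cnj_iff)

lemma unitary_one: "unitary_K rK d (1\<^sub>m d)"
  by (auto simp: unitary_K_def real_mat_def)

text \<open>The generalised Householder reflection \<open>I - w w\<^sup>H / \<kappa>\<close> with \<open>w = u - x\<close> and
  \<open>\<kappa> = w\<^sup>H u\<close>; it is unitary because the squared norm of \<open>w\<close> equals twice the real part of \<open>\<kappa>\<close>.\<close>
lemma exists_unitary_mapping:
  assumes u: "u \<in> carrier_vec d" "vnorm u = 1" and x: "x \<in> carrier_vec d" "vnorm x = 1"
    and real: "rK \<Longrightarrow> real_vec u" "rK \<Longrightarrow> real_vec x"
  shows "\<exists>U. unitary_K rK d U \<and> U *\<^sub>v u = x"
proof (cases "u = x")
  case True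
  then show ?thesis using u by (intro exI[of _ "1\<^sub>m d"]) (simp add: unitary_one)
next
  case False
  define w where "w = u - x"
  define \<kappa> where "\<kappa> = cinner u w"
  have w: "w \<in> carrier_vec d" using u x by (simp add: w_def)
  have wi: "w $ i = u $ i - x $ i" if "i < d" for i using that u x by (simp add: w_def)
  have nw: "(vnorm w)\<^sup>2 = 2 - 2 * Re (cinner u x)"
    unfolding w_def vnorm_minus_sq[OF u(1) x(1)] by (simp add: u x)
  have \<kappa>: "\<kappa> = 1 - cinner u x"
    unfolding \<kappa>_def w_def using u(2) by (simp add: cinner_minus_right[OF u(1) u(1) x(1)] vnorm_eq_1_iff)
  have re: "2 * Re \<kappa> = (vnorm w)\<^sup>2" by (simp add: nw \<kappa>)
  have \<kappa>0: "\<kappa> \<noteq> 0"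
  proof
    assume "\<kappa> = 0"
    then have "(vnorm (u - x))\<^sup>2 \<le> 0" using re by (simp add: w_def)
    then show False using vec_eqI_vnorm[OF u(1) x(1)] False by blast
  qed
  define U where "U = mat d d (\<lambda>(i,j). (if i = j then 1 else 0) - w $ i * cnj (w $ j) / \<kappa>)"
  have U: "U \<in> carrier_mat d d" by (simp add: U_def)
  \<comment> \<open>With this value of the squared norm, the quadratic term of U U^H cancels the two
    linear ones.\<close>
  have ww: "(\<Sum>l<d. cnj (w $ l) * w $ l) = \<kappa> + cnj \<kappa>"
  proof -
    have "(\<Sum>l<d. cnj (w $ l) * w $ l) = cinner w w" using w by (simp add: cinner_eq_sum mult.commute)
    also have "\<dots> = complex_of_real (2 * Re \<kappa>)" unfolding cinner_self re ..
    also have "\<dots> = \<kappa> + cnj \<kappa>" by (simp add: complex_add_cnj)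
    finally show ?thesis .
  qed
  have "U * adjoint_mat U = 1\<^sub>m d"
  proof (rule eq_matI)
    fix i j assume "i < dim_row (1\<^sub>m d)" "j < dim_col (1\<^sub>m d)"
    then have ij: "i < d" "j < d" by auto
    have "(U * adjoint_mat U) $$ (i,j) = (\<Sum>l<d. U $$ (i,l) * adjoint_mat U $$ (l,j))"
      by (rule mult_mat_index_sum) (use U ij in auto)
    also have "\<dots> = (\<Sum>l<d. ((if i = l then 1 else 0) - w $ i * cnj (w $ l) / \<kappa>) * ((if j = l then 1 else 0) - cnj (w $ j) * w $ l / cnj \<kappa>))"
      by (rule sum.cong) (use U ij in \<open>auto simp: U_def\<close>)
    also have "\<dots> = (\<Sum>l<d. (if l = i then (if i = j then 1 else 0) else 0) - (if l = i then cnj (w $ j) * w $ i / cnj \<kappa> else 0)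
        - (if l = j then w $ i * cnj (w $ j) / \<kappa> else 0) + (w $ i * cnj (w $ j) / (\<kappa> * cnj \<kappa>)) * (cnj (w $ l) * w $ l))"
      by (rule sum.cong) (auto simp: algebra_simps)
    also have "\<dots> = (if i = j then 1 else 0) - cnj (w $ j) * w $ i / cnj \<kappa> - w $ i * cnj (w $ j) / \<kappa>
        + (w $ i * cnj (w $ j) / (\<kappa> * cnj \<kappa>)) * (\<kappa> + cnj \<kappa>)"
      unfolding sum.distrib sum_subtractf sum_distrib_left[symmetric] ww using ij by simp
    also have "\<dots> = (if i = j then 1 else 0)" using \<kappa>0 by (simp add: field_simps)
    finally show "(U * adjoint_mat U) $$ (i,j) = 1\<^sub>m d $$ (i,j)" using ij by simp
  qed (use U in auto)
  moreover have "real_mat U" if rK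
  proof -
    have uv: "u $ i \<in> \<real>" "x $ i \<in> \<real>" if "i < d" for i
      using real[OF \<open>rK\<close>] that u x by (auto simp: real_vec_def)
    then have wr: "w $ i \<in> \<real>" if "i < d" for i using that by (simp add: wi)
    have "\<kappa> \<in> \<real>"
      unfolding \<kappa>_def cinner_eq_sum[OF u(1)] using uv wr by (auto intro!: sum_in_Reals Reals_mult simp: Reals_cnj_iff)
    then show ?thesis
      unfolding real_mat_def using U wr
      by (auto simp: U_def intro!: Reals_diff Reals_divide Reals_mult simp: Reals_cnj_iff)
  qed
  moreover have "U *\<^sub>v u = x"
  proof (rule eq_vecI)
    fix i assume "i < dim_vec x"
    then have i: "i < d" using x by simp
    have "(U *\<^sub>v u) $ i = (\<Sum>l<d. U $$ (i,l) * u $ l)" by (rule mult_mat_vec_index_sum[OF U u(1) i])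
    also have "\<dots> = (\<Sum>l<d. (if l = i then u $ i else 0) - (w $ i / \<kappa>) * (u $ l * cnj (w $ l)))"
      by (rule sum.cong) (use i in \<open>auto simp: U_def algebra_simps\<close>)
    also have "\<dots> = u $ i - (w $ i / \<kappa>) * \<kappa>"
      unfolding sum_subtractf sum_distrib_left[symmetric] \<kappa>_def cinner_eq_sum[OF u(1)] using i by simp
    also have "\<dots> = x $ i" using \<kappa>0 wi[OF i] by simp
    finally show "(U *\<^sub>v u) $ i = x $ i" .
  qed (use U x in auto)
  ultimately show ?thesis using U unfolding unitary_K_def by blast
qed

subsection \<open>Measurability of matrix expressions\<close>

abbreviation entry_space :: "nat \<Rightarrow> nat \<Rightarrow> (nat \<times> nat \<Rightarrow> complex) measure" where
  "entry_space d e \<equiv> PiM ({..<d} \<times> {..<e}) (\<lambda>_. borel)"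

definition entries :: "nat \<Rightarrow> nat \<Rightarrow> complex mat \<Rightarrow> nat \<times> nat \<Rightarrow> complex" where
  "entries d e A = restrict (\<lambda>(i,j). A $$ (i,j)) ({..<d} \<times> {..<e})"

lemma mat_entries: "A \<in> carrier_mat d e \<Longrightarrow> mat d e (entries d e A) = A"
  by (rule eq_matI) (auto simp: entries_def)

text \<open>Matrices of all dimensions share one type, so measurability is meant entrywise and laws
  live on the product space of the entries, as in the invariance hypothesis.\<close>

definition measurable_mat :: "'a measure \<Rightarrow> nat \<Rightarrow> nat \<Rightarrow> ('a \<Rightarrow> complex mat) \<Rightarrow> bool" where
  "measurable_mat N d e F \<longleftrightarrow> (\<forall>h\<in>space N. F h \<in> carrier_mat d e)
     \<and> (\<forall>i<d. \<forall>j<e. (\<lambda>h. F h $$ (i,j)) \<in> borel_measurable N)"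

lemma measurable_matD:
  assumes "measurable_mat N d e F"
  shows "h \<in> space N \<Longrightarrow> F h \<in> carrier_mat d e"
    and "i < d \<Longrightarrow> j < e \<Longrightarrow> (\<lambda>h. F h $$ (i,j)) \<in> borel_measurable N"
  using assms by (auto simp: measurable_mat_def)

lemma measurable_entries:
  assumes "measurable_mat N d e F"
  shows "(\<lambda>h. entries d e (F h)) \<in> measurable N (entry_space d e)"
  unfolding entries_def
  by (rule measurable_restrict) (use measurable_matD(2)[OF assms] in auto)

lemma measurable_mat_id: "measurable_mat (entry_space d e) d e (mat d e)"
  unfolding measurable_mat_def
  by (auto intro!: measurable_component_singleton)

lemma measurable_mat_const: "A \<in> carrier_mat d e \<Longrightarrow> measurable_mat N d e (\<lambda>_. A)"
  by (simp add: measurable_mat_def)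

lemma measurable_mat_mult:
  assumes "measurable_mat N d k F" "measurable_mat N k e F'"
  shows "measurable_mat N d e (\<lambda>h. F h * F' h)"
  unfolding measurable_mat_def
proof (intro conjI ballI allI impI)
  fix h assume "h \<in> space N"
  then show "F h * F' h \<in> carrier_mat d e"
    using measurable_matD(1)[OF assms(1)] measurable_matD(1)[OF assms(2)] by (intro mult_carrier_mat) auto
next
  fix i j assume ij: "i < d" "j < e"
  have "(\<lambda>h. \<Sum>l<k. F h $$ (i,l) * F' h $$ (l,j)) \<in> borel_measurable N"
    by (intro borel_measurable_sum borel_measurable_times)
      (use ij measurable_matD(2)[OF assms(1)] measurable_matD(2)[OF assms(2)] in auto)
  moreover have "(F h * F' h) $$ (i,j) = (\<Sum>l<k. F h $$ (i,l) * F' h $$ (l,j))" if "h \<in> space N" for h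
    by (rule mult_mat_index_sum[OF measurable_matD(1)[OF assms(1) that] measurable_matD(1)[OF assms(2) that] ij])
  ultimately show "(\<lambda>h. (F h * F' h) $$ (i,j)) \<in> borel_measurable N"
    using measurable_cong by force
qed

lemma borel_measurable_cnj: "f \<in> borel_measurable N \<Longrightarrow> (\<lambda>x. cnj (f x)) \<in> borel_measurable N"
  by (rule borel_measurable_continuous_on[where f = cnj]) (auto intro: continuous_intros)

lemma borel_measurable_Re': "f \<in> borel_measurable N \<Longrightarrow> (\<lambda>x. Re (f x)) \<in> borel_measurable N"
  by (rule borel_measurable_continuous_on[where f = Re]) (auto intro: continuous_intros)

lemma measurable_mat_adjoint:
  assumes "measurable_mat N d e F"
  shows "measurable_mat N e d (\<lambda>h. adjoint_mat (F h))"
  unfolding measurable_mat_def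
proof (intro conjI ballI allI impI)
  fix h assume "h \<in> space N"
  then show "adjoint_mat (F h) \<in> carrier_mat e d" using measurable_matD(1)[OF assms] by auto
next
  fix i j assume ij: "i < e" "j < d"
  have "(\<lambda>h. cnj (F h $$ (j,i))) \<in> borel_measurable N"
    by (rule borel_measurable_cnj[OF measurable_matD(2)[OF assms ij(2,1)]])
  moreover have "adjoint_mat (F h) $$ (i,j) = cnj (F h $$ (j,i))" if "h \<in> space N" for h
    using measurable_matD(1)[OF assms that] ij by (intro adjoint_index) auto
  ultimately show "(\<lambda>h. adjoint_mat (F h) $$ (i,j)) \<in> borel_measurable N"
    using measurable_cong by force
qed

lemma measurable_mat_gpow:
  assumes "measurable_mat N d e F"
  shows "measurable_mat N d d (\<lambda>h. gpow (F h) k)"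
proof (induction k)
  case 0
  have "\<forall>h\<in>space N. gpow (F h) 0 = 1\<^sub>m d" using gpow_0 measurable_matD(1)[OF assms] by blast
  moreover have "measurable_mat N d d (\<lambda>_. 1\<^sub>m d)" by (rule measurable_mat_const) simp
  ultimately show ?case by (simp add: measurable_mat_def cong: measurable_cong)
next
  case (Suc k)
  then show ?case
    unfolding gpow_Suc by (intro measurable_mat_mult[OF Suc] measurable_mat_mult[OF assms] measurable_mat_adjoint[OF assms])
qed

lemma measurable_cinner_mat:
  assumes F: "measurable_mat N d e F" and u: "u \<in> carrier_vec e"
  shows "(\<lambda>h. cinner (F h *\<^sub>v u) w) \<in> borel_measurable N"
proof -
  have "(\<lambda>h. \<Sum>i<d. (\<Sum>l<e. F h $$ (i,l) * u $ l) * cnj (w $ i)) \<in> borel_measurable N"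
    by (intro borel_measurable_sum borel_measurable_times borel_measurable_const) (use measurable_matD(2)[OF F] in auto)
  moreover have "cinner (F h *\<^sub>v u) w = (\<Sum>i<d. (\<Sum>l<e. F h $$ (i,l) * u $ l) * cnj (w $ i))" if "h \<in> space N" for h
    using measurable_matD(1)[OF F that] u
    by (subst cinner_eq_sum[of _ d]) (auto intro!: sum.cong simp del: index_mult_mat_vec simp: mult_mat_vec_index_sum)
  ultimately show ?thesis using measurable_cong by force
qed

lemma measurable_vnorm_sq_mat:
  assumes F: "measurable_mat N d e F" and u: "u \<in> carrier_vec e"
  shows "(\<lambda>h. (vnorm (F h *\<^sub>v u))\<^sup>2) \<in> borel_measurable N"
proof -
  have "(\<lambda>h. \<Sum>i<d. (cmod (\<Sum>l<e. F h $$ (i,l) * u $ l))\<^sup>2) \<in> borel_measurable N"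
    by (intro borel_measurable_sum borel_measurable_power borel_measurable_norm borel_measurable_times borel_measurable_const)
      (use measurable_matD(2)[OF F] in auto)
  moreover have "(vnorm (F h *\<^sub>v u))\<^sup>2 = (\<Sum>i<d. (cmod (\<Sum>l<e. F h $$ (i,l) * u $ l))\<^sup>2)" if "h \<in> space N" for h
    unfolding vnorm_sq using measurable_matD(1)[OF F that] u
    by (auto intro!: sum.cong simp del: index_mult_mat_vec simp: mult_mat_vec_index_sum)
  ultimately show ?thesis using measurable_cong by force
qed

lemma measurable_fro_sq:
  assumes F: "measurable_mat N d e F"
  shows "(\<lambda>h. fro_sq (F h)) \<in> borel_measurable N"
proof -
  have "(\<lambda>h. \<Sum>i<d. \<Sum>j<e. (cmod (F h $$ (i,j)))\<^sup>2) \<in> borel_measurable N"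
    by (intro borel_measurable_sum borel_measurable_power borel_measurable_norm) (use measurable_matD(2)[OF F] in auto)
  moreover have "fro_sq (F h) = (\<Sum>i<d. \<Sum>j<e. (cmod (F h $$ (i,j)))\<^sup>2)" if "h \<in> space N" for h
    using measurable_matD(1)[OF F that] by (auto simp: fro_sq_def)
  ultimately show ?thesis using measurable_cong by force
qed

subsection \<open>Averaging over signs\<close>

text \<open>Invariance on the right is exploited by applying this notion to the adjoint
  matrix.\<close>

definition left_invariant :: "'w measure \<Rightarrow> bool \<Rightarrow> nat \<Rightarrow> nat \<Rightarrow> ('w \<Rightarrow> complex mat) \<Rightarrow> bool" where
  "left_invariant M rK d e Y \<longleftrightarrow> measurable_mat M d e Y \<and>
     (\<forall>U. unitary_K rK d U \<longrightarrow>
        distr M (entry_space d e) (\<lambda>\<omega>. entries d e (U * Y \<omega>)) = distr M (entry_space d e) (\<lambda>\<omega>. entries d e (Y \<omega>)))"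

lemma left_invariant_nn_integral:
  assumes Y: "left_invariant M rK d e Y" and U: "unitary_K rK d U"
    and \<Phi>: "(\<lambda>h. \<Phi> (mat d e h)) \<in> borel_measurable (entry_space d e)"
  shows "(\<integral>\<^sup>+\<omega>. \<Phi> (U * Y \<omega>) \<partial>M) = (\<integral>\<^sup>+\<omega>. \<Phi> (Y \<omega>) \<partial>M)"
proof -
  have mY: "measurable_mat M d e Y" using Y by (simp add: left_invariant_def)
  have mUY: "measurable_mat M d e (\<lambda>\<omega>. U * Y \<omega>)"
    by (rule measurable_mat_mult[OF measurable_mat_const[OF unitary_carrier[OF U]] mY])
  have *: "(\<integral>\<^sup>+\<omega>. \<Phi> (Z \<omega>) \<partial>M) = (\<integral>\<^sup>+h. \<Phi> (mat d e h) \<partial>distr M (entry_space d e) (\<lambda>\<omega>. entries d e (Z \<omega>)))"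
    if Z: "measurable_mat M d e Z" for Z
  proof -
    have "(\<integral>\<^sup>+h. \<Phi> (mat d e h) \<partial>distr M (entry_space d e) (\<lambda>\<omega>. entries d e (Z \<omega>))) = (\<integral>\<^sup>+\<omega>. \<Phi> (mat d e (entries d e (Z \<omega>))) \<partial>M)"
      by (rule nn_integral_distr[OF measurable_entries[OF Z]]) (use \<Phi> in simp)
    also have "\<dots> = (\<integral>\<^sup>+\<omega>. \<Phi> (Z \<omega>) \<partial>M)"
      by (rule nn_integral_cong) (simp add: mat_entries[OF measurable_matD(1)[OF Z]])
    finally show ?thesis by simp
  qed
  show ?thesis using Y U by (simp add: *[OF mY] *[OF mUY] left_invariant_def)
qed

definition sign_vec :: "nat \<Rightarrow> (nat \<Rightarrow> real) \<Rightarrow> complex vec" where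
  "sign_vec d \<epsilon> = vec d (\<lambda>i. complex_of_real (\<epsilon> i / sqrt (real d)))"

lemma sign_vec_carrier [simp]: "sign_vec d \<epsilon> \<in> carrier_vec d"
  by (simp add: sign_vec_def)

lemma vnorm_sign_vec:
  assumes "\<epsilon> \<in> signs d" "0 < d"
  shows "vnorm (sign_vec d \<epsilon>) = 1"
proof -
  have "(vnorm (sign_vec d \<epsilon>))\<^sup>2 = (\<Sum>i<d. (\<epsilon> i)\<^sup>2 / real d)"
    unfolding vnorm_sq by (auto simp: sign_vec_def power_divide norm_divide intro!: sum.cong)
  also have "\<dots> = (\<Sum>i<d. 1 / real d)" by (rule sum.cong) (use signs_sq[OF assms(1)] in auto)
  also have "\<dots> = 1" using assms(2) by simp
  finally show ?thesis using vnorm_nonneg[of "sign_vec d \<epsilon>"] by (simp add: power2_eq_1_iff)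
qed

lemma real_vec_sign_vec: "real_vec (sign_vec d \<epsilon>)"
  by (simp add: real_vec_def sign_vec_def)

text \<open>For each sign vector x some unitary carries u to x, so by invariance the integrals of
  \<Phi> at x and at u agree. Averaging over all signs and exchanging the finite sum with the
  integral leaves a bound for each fixed matrix.\<close>

lemma nn_integral_le_sign_mean:
  assumes M: "prob_space M" and Y: "left_invariant M rK d e Y" and d: "0 < d"
    and u: "u \<in> carrier_vec d" "vnorm u = 1" "rK \<Longrightarrow> real_vec u"
    and meas: "\<And>x. x \<in> carrier_vec d \<Longrightarrow> (\<lambda>h. \<Phi> x (mat d e h)) \<in> borel_measurable (entry_space d e)"
    and nonneg: "\<And>x A. 0 \<le> \<Phi> x A"
    and equiv: "\<And>U x A. unitary_K rK d U \<Longrightarrow> x \<in> carrier_vec d \<Longrightarrow> A \<in> carrier_mat d e \<Longrightarrow>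
       \<Phi> x (U * A) = \<Phi> (adjoint_mat U *\<^sub>v x) A"
    and bound: "\<And>A. A \<in> carrier_mat d e \<Longrightarrow> sign_mean d (\<lambda>\<epsilon>. \<Phi> (sign_vec d \<epsilon>) A) \<le> K"
  shows "(\<integral>\<^sup>+\<omega>. ennreal (\<Phi> u (Y \<omega>)) \<partial>M) \<le> ennreal K"
proof -
  interpret prob_space M by (rule M)
  have mY: "measurable_mat M d e Y" using Y by (simp add: left_invariant_def)
  define I where "I = (\<integral>\<^sup>+\<omega>. ennreal (\<Phi> u (Y \<omega>)) \<partial>M)"
  have measM: "(\<lambda>\<omega>. \<Phi> x (Y \<omega>)) \<in> borel_measurable M" if x: "x \<in> carrier_vec d" for x
  proof -
    have "(\<lambda>\<omega>. \<Phi> x (mat d e (entries d e (Y \<omega>)))) \<in> borel_measurable M"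
      using measurable_compose[OF measurable_entries[OF mY] meas[OF x]] .
    then show ?thesis
      using measurable_cong[of M "\<lambda>\<omega>. \<Phi> x (mat d e (entries d e (Y \<omega>)))" "\<lambda>\<omega>. \<Phi> x (Y \<omega>)"]
      by (simp add: mat_entries[OF measurable_matD(1)[OF mY]])
  qed
  have I_eq: "(\<integral>\<^sup>+\<omega>. ennreal (\<Phi> (sign_vec d \<epsilon>) (Y \<omega>)) \<partial>M) = I" if \<epsilon>: "\<epsilon> \<in> signs d" for \<epsilon>
  proof -
    obtain U where U: "unitary_K rK d U" "U *\<^sub>v u = sign_vec d \<epsilon>"
      using exists_unitary_mapping[OF u(1,2) sign_vec_carrier vnorm_sign_vec[OF \<epsilon> d] u(3) real_vec_sign_vec] by blast
    have "I = (\<integral>\<^sup>+\<omega>. ennreal (\<Phi> u (adjoint_mat U * Y \<omega>)) \<partial>M)"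
      unfolding I_def
      by (rule left_invariant_nn_integral[OF Y unitary_adjoint[OF U(1)], symmetric]) (use meas[OF u(1)] in simp)
    also have "\<dots> = (\<integral>\<^sup>+\<omega>. ennreal (\<Phi> (sign_vec d \<epsilon>) (Y \<omega>)) \<partial>M)"
      using equiv[OF unitary_adjoint[OF U(1)] u(1) measurable_matD(1)[OF mY]] U(2)
      by (intro nn_integral_cong) simp
    finally show ?thesis by simp
  qed
  have "I = (\<Sum>\<epsilon>\<in>signs d. ennreal (1 / 2 ^ d) * I)"
  proof -
    have "(\<Sum>\<epsilon>\<in>signs d. ennreal (1 / 2 ^ d) * I) = (of_nat (2 ^ d) * ennreal (1 / 2 ^ d)) * I"
      by (simp add: card_signs mult.assoc)
    also have "of_nat (2 ^ d) * ennreal (1 / 2 ^ d) = ennreal (2 ^ d * (1 / 2 ^ d))"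
      by (subst ennreal_mult) (simp_all add: ennreal_of_nat_eq_real_of_nat)
    finally show ?thesis by simp
  qed
  also have "\<dots> = (\<Sum>\<epsilon>\<in>signs d. \<integral>\<^sup>+\<omega>. ennreal (\<Phi> (sign_vec d \<epsilon>) (Y \<omega>) / 2 ^ d) \<partial>M)"
  proof (rule sum.cong[OF refl])
    fix \<epsilon> assume \<epsilon>: "\<epsilon> \<in> signs d"
    have "ennreal (1 / 2 ^ d) * I = (\<integral>\<^sup>+\<omega>. ennreal (1 / 2 ^ d) * ennreal (\<Phi> (sign_vec d \<epsilon>) (Y \<omega>)) \<partial>M)"
      unfolding I_eq[OF \<epsilon>, symmetric]
      by (rule nn_integral_cmult[symmetric]) (use measM[OF sign_vec_carrier] in simp)
    also have "\<dots> = (\<integral>\<^sup>+\<omega>. ennreal (\<Phi> (sign_vec d \<epsilon>) (Y \<omega>) / 2 ^ d) \<partial>M)"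
      by (rule nn_integral_cong) (use nonneg in \<open>simp flip: ennreal_mult\<close>)
    finally show "ennreal (1 / 2 ^ d) * I = (\<integral>\<^sup>+\<omega>. ennreal (\<Phi> (sign_vec d \<epsilon>) (Y \<omega>) / 2 ^ d) \<partial>M)" .
  qed
  also have "\<dots> = (\<integral>\<^sup>+\<omega>. (\<Sum>\<epsilon>\<in>signs d. ennreal (\<Phi> (sign_vec d \<epsilon>) (Y \<omega>) / 2 ^ d)) \<partial>M)"
    by (rule nn_integral_sum[symmetric]) (use measM[OF sign_vec_carrier] in simp)
  also have "\<dots> = (\<integral>\<^sup>+\<omega>. ennreal (sign_mean d (\<lambda>\<epsilon>. \<Phi> (sign_vec d \<epsilon>) (Y \<omega>))) \<partial>M)"
    by (rule nn_integral_cong) (use nonneg in \<open>simp add: sign_mean_def sum_divide_distrib sum_ennreal\<close>)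
  also have "\<dots> \<le> (\<integral>\<^sup>+\<omega>. ennreal K \<partial>M)"
    by (rule nn_integral_mono) (use bound[OF measurable_matD(1)[OF mY]] in \<open>simp add: ennreal_leI\<close>)
  also have "\<dots> = ennreal K" by (simp add: emeasure_space_1)
  finally show ?thesis unfolding I_def .
qed

subsection \<open>Concentration of quadratic and bilinear forms\<close>

lemma gpow_unitary:
  assumes U: "unitary_K rK d U" and A: "A \<in> carrier_mat d e"
  shows "gpow (U * A) k = U * gpow A k * adjoint_mat U"
proof (induction k)
  case 0
  have UA: "U * A \<in> carrier_mat d e" using unitary_carrier[OF U] A by auto
  show ?case unfolding gpow_0[OF UA] gpow_0[OF A] using unitary_carrier[OF U] unitary_left[OF U] by simp
next
  case (Suc k)
  have c: "U \<in> carrier_mat d d" "adjoint_mat U \<in> carrier_mat d d" "gpow A k \<in> carrier_mat d d"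
    "A * adjoint_mat A \<in> carrier_mat d d" "adjoint_mat A \<in> carrier_mat e d"
    using unitary_carrier[OF U] A by auto
  have "(U * A) * adjoint_mat (U * A) = (U * A) * (adjoint_mat A * adjoint_mat U)"
    by (simp add: adjoint_mult[OF c(1) A])
  also have "\<dots> = U * (A * (adjoint_mat A * adjoint_mat U))"
    by (rule assoc_mult_mat[of _ d d _ e _ d]) (use c A in auto)
  also have "A * (adjoint_mat A * adjoint_mat U) = (A * adjoint_mat A) * adjoint_mat U"
    by (rule assoc_mult_mat[symmetric, of _ d e _ d _ d]) (use c A in auto)
  finally have P: "(U * A) * adjoint_mat (U * A) = U * ((A * adjoint_mat A) * adjoint_mat U)" .
  have cancel: "adjoint_mat U * (U * B) = B" if "B \<in> carrier_mat d d" for B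
    using assoc_mult_mat[OF c(2) c(1) that] unitary_right[OF U] that by simp
  let ?B = "(A * adjoint_mat A) * adjoint_mat U"
  have B: "?B \<in> carrier_mat d d" using c by auto
  have "gpow (U * A) (Suc k) = (U * gpow A k * adjoint_mat U) * (U * ?B)"
    unfolding gpow_Suc Suc P ..
  also have "\<dots> = (U * gpow A k) * (adjoint_mat U * (U * ?B))"
    by (rule assoc_mult_mat[of _ d d _ d _ d]) (use c B in auto)
  also have "adjoint_mat U * (U * ?B) = ?B" by (rule cancel[OF B])
  also have "(U * gpow A k) * ?B = ((U * gpow A k) * (A * adjoint_mat A)) * adjoint_mat U"
    by (rule assoc_mult_mat[symmetric, of _ d d _ d _ d]) (use c in auto)
  also have "(U * gpow A k) * (A * adjoint_mat A) = U * gpow A (Suc k)"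
    unfolding gpow_Suc by (rule assoc_mult_mat[of _ d d _ d _ d]) (use c in auto)
  finally show ?case .
qed

lemma trace_mult_comm:
  fixes A B :: "complex mat"
  assumes "A \<in> carrier_mat d e" "B \<in> carrier_mat e d"
  shows "(\<Sum>i<d. (A * B) $$ (i,i)) = (\<Sum>j<e. (B * A) $$ (j,j))"
proof -
  have "(\<Sum>i<d. (A * B) $$ (i,i)) = (\<Sum>i<d. \<Sum>j<e. A $$ (i,j) * B $$ (j,i))"
    by (rule sum.cong[OF refl], rule mult_mat_index_sum[OF assms]) auto
  also have "\<dots> = (\<Sum>j<e. \<Sum>i<d. B $$ (j,i) * A $$ (i,j))"
    by (subst sum.swap) (intro sum.cong refl mult.commute)
  also have "\<dots> = (\<Sum>j<e. (B * A) $$ (j,j))"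
    by (rule sum.cong[OF refl], rule mult_mat_index_sum[OF assms(2,1), symmetric]) auto
  finally show ?thesis .
qed

lemma trace_unitary:
  assumes U: "unitary_K rK d U" and B: "B \<in> carrier_mat d d"
  shows "(\<Sum>i<d. (U * B * adjoint_mat U) $$ (i,i)) = (\<Sum>i<d. B $$ (i,i))"
proof -
  have c: "U \<in> carrier_mat d d" "adjoint_mat U \<in> carrier_mat d d" using unitary_carrier[OF U] by auto
  have "(\<Sum>i<d. (U * B * adjoint_mat U) $$ (i,i)) = (\<Sum>i<d. (adjoint_mat U * (U * B)) $$ (i,i))"
    by (rule trace_mult_comm) (use c B in auto)
  also have "adjoint_mat U * (U * B) = B"
    using assoc_mult_mat[OF c(2) c(1) B] unitary_right[OF U] B by simp
  finally show ?thesis .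
qed

lemma fro_sq_unitary:
  assumes U: "unitary_K rK d U" and B: "B \<in> carrier_mat d d"
  shows "fro_sq (U * B * adjoint_mat U) = fro_sq B"
proof -
  have c: "U \<in> carrier_mat d d" "adjoint_mat U \<in> carrier_mat d d" "adjoint_mat B \<in> carrier_mat d d"
    using unitary_carrier[OF U] B by auto
  have UB: "U * B \<in> carrier_mat d d" using c B by auto
  have cancel: "adjoint_mat U * (U * C) = C" if "C \<in> carrier_mat d d" for C
    using assoc_mult_mat[OF c(2) c(1) that] unitary_right[OF U] that by simp
  have "adjoint_mat (U * B * adjoint_mat U) = U * (adjoint_mat B * adjoint_mat U)"
    using adjoint_mult[OF UB c(2)] adjoint_mult[OF c(1) B] by simp
  then have "(U * B * adjoint_mat U) * adjoint_mat (U * B * adjoint_mat U)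
      = (U * B * adjoint_mat U) * (U * (adjoint_mat B * adjoint_mat U))" by simp
  also have "\<dots> = (U * B) * (adjoint_mat U * (U * (adjoint_mat B * adjoint_mat U)))"
    by (rule assoc_mult_mat[of _ d d _ d _ d]) (use c B in auto)
  also have "\<dots> = (U * B) * (adjoint_mat B * adjoint_mat U)"
    by (subst cancel) (use c in auto)
  also have "\<dots> = ((U * B) * adjoint_mat B) * adjoint_mat U"
    by (rule assoc_mult_mat[symmetric, of _ d d _ d _ d]) (use c B in auto)
  also have "(U * B) * adjoint_mat B = U * (B * adjoint_mat B)"
    by (rule assoc_mult_mat[of _ d d _ d _ d]) (use c B in auto)
  finally have "(\<Sum>i<d. ((U * B * adjoint_mat U) * adjoint_mat (U * B * adjoint_mat U)) $$ (i,i))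
      = (\<Sum>i<d. (B * adjoint_mat B) $$ (i,i))"
    using trace_unitary[OF U, of "B * adjoint_mat B"] B by simp
  then show ?thesis
    using fro_sq_eq_trace[OF B] fro_sq_eq_trace[of "U * B * adjoint_mat U" d d] UB c by simp
qed

text \<open>The deviation from the normalised trace, to the fourth power. The denominator is at
  least 1, is unchanged by left multiplication with unitaries, and absorbs the Frobenius norm in the
  fourth-moment bound; the expectation is then O(1/d^2) whatever the law of the singular
  values.\<close>

definition quad_dev :: "nat \<Rightarrow> nat \<Rightarrow> complex vec \<Rightarrow> complex mat \<Rightarrow> real" where
  "quad_dev d k u A =
     (Re (cinner (gpow A k *\<^sub>v u) u) - Re (\<Sum>i<d. gpow A k $$ (i,i)) / real d) ^ 4
       / (1 + fro_sq (gpow A k) / real d)\<^sup>2"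

text \<open>The factor \<zeta> selects the real part for \<zeta> = 1 and the imaginary part for
  \<zeta> = -i. The denominator again contains only a norm that left unitaries preserve.\<close>

definition bilin_dev :: "complex \<Rightarrow> nat \<Rightarrow> complex vec \<Rightarrow> complex vec \<Rightarrow> complex mat \<Rightarrow> real" where
  "bilin_dev \<zeta> k v u A =
     (Re (\<zeta> * cinner (gpow A k *\<^sub>v (A *\<^sub>v v)) u)) ^ 4 / (1 + (vnorm (gpow A k *\<^sub>v (A *\<^sub>v v)))\<^sup>2)\<^sup>2"

lemma fro_sq_nonneg: "0 \<le> fro_sq A"
  by (auto simp: fro_sq_def intro!: sum_nonneg)

lemma measurable_quad_dev:
  assumes F: "measurable_mat N d e F" and x: "x \<in> carrier_vec d"
  shows "(\<lambda>h. quad_dev d k x (F h)) \<in> borel_measurable N"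
proof -
  have g: "measurable_mat N d d (\<lambda>h. gpow (F h) k)"
    by (rule measurable_mat_gpow[OF F])
  have "(\<lambda>h. \<Sum>i<d. gpow (F h) k $$ (i,i)) \<in> borel_measurable N"
    by (intro borel_measurable_sum measurable_matD(2)[OF g]) auto
  then show ?thesis
    unfolding quad_dev_def
    by (intro borel_measurable_divide borel_measurable_power borel_measurable_diff borel_measurable_add
        borel_measurable_const borel_measurable_Re' measurable_cinner_mat[OF g x] measurable_fro_sq[OF g])
qed

lemma measurable_bilin_dev:
  assumes F: "measurable_mat N d e F" and v: "v \<in> carrier_vec e"
  shows "(\<lambda>h. bilin_dev \<zeta> k v x (F h)) \<in> borel_measurable N"
proof -
  define H where "H = (\<lambda>h. gpow (F h) k * F h)"
  have g: "measurable_mat N d e H"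
    unfolding H_def by (rule measurable_mat_mult[OF measurable_mat_gpow[OF F] F])
  have "(\<lambda>h. (Re (\<zeta> * cinner (H h *\<^sub>v v) x)) ^ 4 / (1 + (vnorm (H h *\<^sub>v v))\<^sup>2)\<^sup>2) \<in> borel_measurable N"
    by (intro borel_measurable_divide borel_measurable_power borel_measurable_add borel_measurable_times
        borel_measurable_const borel_measurable_Re' measurable_cinner_mat[OF g v] measurable_vnorm_sq_mat[OF g v])
  moreover have "gpow (F h) k *\<^sub>v (F h *\<^sub>v v) = H h *\<^sub>v v" if "h \<in> space N" for h
    unfolding H_def
    using assoc_mult_mat_vec[OF gpow_carrier[OF measurable_matD(1)[OF F that]] measurable_matD(1)[OF F that] v] by simp
  ultimately show ?thesis unfolding bilin_dev_def by (simp cong: measurable_cong)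
qed

lemma quad_dev_bound:
  assumes M: "prob_space M" and Y: "left_invariant M rK d e Y" and d: "0 < d"
    and u: "u \<in> carrier_vec d" "vnorm u = 1" "rK \<Longrightarrow> real_vec u"
  shows "(\<integral>\<^sup>+\<omega>. ennreal (quad_dev d k u (Y \<omega>)) \<partial>M) \<le> ennreal (108 / (real d)\<^sup>2)"
proof (rule nn_integral_le_sign_mean[OF M Y d u])
  show "(\<lambda>h. quad_dev d k x (mat d e h)) \<in> borel_measurable (entry_space d e)" if "x \<in> carrier_vec d" for x
    by (rule measurable_quad_dev[OF measurable_mat_id that])
  show "0 \<le> quad_dev d k x A" for x A by (simp add: quad_dev_def)
  show "quad_dev d k x (U * A) = quad_dev d k (adjoint_mat U *\<^sub>v x) A"
    if U: "unitary_K rK d U" and x: "x \<in> carrier_vec d" and A: "A \<in> carrier_mat d e" for U x A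
  proof -
    have c: "U \<in> carrier_mat d d" "adjoint_mat U \<in> carrier_mat d d" using unitary_carrier[OF U] by auto
    have G: "gpow A k \<in> carrier_mat d d" using A by simp
    have Ux: "adjoint_mat U *\<^sub>v x \<in> carrier_vec d" using c x by (auto intro: mult_mat_vec_carrier)
    have "gpow (U * A) k *\<^sub>v x = (U * gpow A k) *\<^sub>v (adjoint_mat U *\<^sub>v x)"
      unfolding gpow_unitary[OF U A] by (rule assoc_mult_mat_vec[of _ d d _ d]) (use c G x in auto)
    also have "\<dots> = U *\<^sub>v (gpow A k *\<^sub>v (adjoint_mat U *\<^sub>v x))"
      by (rule assoc_mult_mat_vec[OF c(1) G Ux])
    finally have "cinner (gpow (U * A) k *\<^sub>v x) x = cinner (gpow A k *\<^sub>v (adjoint_mat U *\<^sub>v x)) (adjoint_mat U *\<^sub>v x)"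
      using cinner_mult_mat_vec[OF c(1) mult_mat_vec_carrier[OF G Ux] x] by simp
    then show ?thesis
      unfolding quad_dev_def gpow_unitary[OF U A] trace_unitary[OF U G] fro_sq_unitary[OF U G] by simp
  qed
  show "sign_mean d (\<lambda>\<epsilon>. quad_dev d k (sign_vec d \<epsilon>) A) \<le> 108 / (real d)\<^sup>2" if A: "A \<in> carrier_mat d e" for A
  proof -
    define W where "W = gpow A k"
    have W: "W \<in> carrier_mat d d" using A by (simp add: W_def)
    \<comment> \<open>With real signs, the real part of the form is the form of the real
      part.\<close>
    define B where "B = (\<lambda>i j. Re (W $$ (i,j)))"
    define f where "f = fro_sq W"
    have f0: "0 \<le> f" by (simp add: f_def fro_sq_nonneg)
    have form: "Re (cinner (W *\<^sub>v sign_vec d \<epsilon>) (sign_vec d \<epsilon>)) = (\<Sum>i<d. \<Sum>j<d. B i j * \<epsilon> i * \<epsilon> j) / real d" for \<epsilon>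
    proof -
      have "cinner (W *\<^sub>v sign_vec d \<epsilon>) (sign_vec d \<epsilon>)
          = (\<Sum>i<d. (\<Sum>j<d. W $$ (i,j) * sign_vec d \<epsilon> $ j) * cnj (sign_vec d \<epsilon> $ i))"
        using W by (subst cinner_eq_sum[of _ d])
          (auto intro!: sum.cong mult_mat_vec_carrier simp del: index_mult_mat_vec simp: mult_mat_vec_index_sum[OF W sign_vec_carrier])
      also have "\<dots> = (\<Sum>i<d. \<Sum>j<d. W $$ (i,j) * complex_of_real (\<epsilon> i * \<epsilon> j / real d))"
        unfolding sum_distrib_right
        by (intro sum.cong refl) (use d in \<open>auto simp: sign_vec_def field_simps simp flip: of_real_mult\<close>)
      finally show ?thesis by (simp add: B_def sum_divide_distrib mult.assoc)
    qed
    have tr: "Re (\<Sum>i<d. W $$ (i,i)) = (\<Sum>i<d. B i i)" by (simp add: B_def)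
    have "sign_mean d (\<lambda>\<epsilon>. quad_dev d k (sign_vec d \<epsilon>) A)
        = sign_mean d (\<lambda>\<epsilon>. (1 / (real d ^ 4 * (1 + f / real d)\<^sup>2)) * ((\<Sum>i<d. \<Sum>j<d. B i j * \<epsilon> i * \<epsilon> j) - (\<Sum>i<d. B i i)) ^ 4)"
      unfolding quad_dev_def W_def[symmetric] form tr f_def[symmetric]
      by (simp add: power_divide flip: diff_divide_distrib)
    also have "\<dots> = (1 / (real d ^ 4 * (1 + f / real d)\<^sup>2)) * sign_mean d (\<lambda>\<epsilon>. ((\<Sum>i<d. \<Sum>j<d. B i j * \<epsilon> i * \<epsilon> j) - (\<Sum>i<d. B i i)) ^ 4)"
      by (rule sign_mean_cmult)
    also have "\<dots> \<le> (1 / (real d ^ 4 * (1 + f / real d)\<^sup>2)) * (108 * (\<Sum>i<d. \<Sum>j<d. (B i j)\<^sup>2)\<^sup>2)"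
      by (rule mult_left_mono[OF sign_quadratic_form_fourth_moment]) simp
    also have "\<dots> \<le> (1 / (real d ^ 4 * (1 + f / real d)\<^sup>2)) * (108 * f\<^sup>2)"
    proof -
      have "(B i j)\<^sup>2 \<le> (cmod (W $$ (i,j)))\<^sup>2" for i j
        unfolding B_def cmod_power2 by simp
      then have "(\<Sum>i<d. \<Sum>j<d. (B i j)\<^sup>2) \<le> f"
        using W unfolding f_def fro_sq_def by (auto intro!: sum_mono)
      then show ?thesis by (intro mult_left_mono power_mono sum_nonneg) auto
    qed
    \<comment> \<open>Two powers of f/d are set against those of 1 + f/d, so the quotient is at most
      1 for every size of the squared Frobenius norm f.\<close>
    also have "\<dots> = 108 / (real d)\<^sup>2 * ((f / real d) / (1 + f / real d))\<^sup>2"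
    proof -
      have "real d ^ 4 = (real d)\<^sup>2 * (real d)\<^sup>2" by (simp flip: power_add)
      then show ?thesis unfolding power_divide by (simp only: times_divide_times_eq divide_divide_eq_left) (simp add: mult_ac)
    qed
    also have "\<dots> \<le> 108 / (real d)\<^sup>2 * 1"
    proof -
      have "0 \<le> t / (1 + t) \<and> t / (1 + t) \<le> 1" if "0 \<le> t" for t :: real
        using that by (simp add: divide_le_eq_1)
      from this[of "f / real d"] f0 show ?thesis by (intro mult_left_mono power_le_one) auto
    qed
    finally show ?thesis by simp
  qed
qed

text \<open>Only a linear form in the signs occurs, so the constant is the 3 of
  \<open>sign_sum_fourth_moment\<close>. The vector v stays fixed while u is randomised.\<close>

lemma bilin_dev_bound:
  assumes M: "prob_space M" and Y: "left_invariant M rK d e Y" and d: "0 < d"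
    and u: "u \<in> carrier_vec d" "vnorm u = 1" "rK \<Longrightarrow> real_vec u"
    and v: "v \<in> carrier_vec e" and \<zeta>: "cmod \<zeta> = 1"
  shows "(\<integral>\<^sup>+\<omega>. ennreal (bilin_dev \<zeta> k v u (Y \<omega>)) \<partial>M) \<le> ennreal (3 / (real d)\<^sup>2)"
proof (rule nn_integral_le_sign_mean[OF M Y d u])
  show "(\<lambda>h. bilin_dev \<zeta> k v x (mat d e h)) \<in> borel_measurable (entry_space d e)" if "x \<in> carrier_vec d" for x
    by (rule measurable_bilin_dev[OF measurable_mat_id v])
  show "0 \<le> bilin_dev \<zeta> k v x A" for x A by (simp add: bilin_dev_def)
  show "bilin_dev \<zeta> k v x (U * A) = bilin_dev \<zeta> k v (adjoint_mat U *\<^sub>v x) A"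
    if U: "unitary_K rK d U" and x: "x \<in> carrier_vec d" and A: "A \<in> carrier_mat d e" for U x A
  proof -
    have c: "U \<in> carrier_mat d d" "adjoint_mat U \<in> carrier_mat d d" using unitary_carrier[OF U] by auto
    have G: "gpow A k \<in> carrier_mat d d" using A by simp
    have Av: "A *\<^sub>v v \<in> carrier_vec d" using A v by (auto intro: mult_mat_vec_carrier)
    define w where "w = gpow A k *\<^sub>v (A *\<^sub>v v)"
    have w: "w \<in> carrier_vec d" unfolding w_def by (rule mult_mat_vec_carrier[OF G Av])
    have cancel: "adjoint_mat U *\<^sub>v (U *\<^sub>v y) = y" if "y \<in> carrier_vec d" for y
      using assoc_mult_mat_vec[OF c(2) c(1) that] unitary_right[OF U] that by simp
    have "gpow (U * A) k *\<^sub>v ((U * A) *\<^sub>v v) = (U * gpow A k * adjoint_mat U) *\<^sub>v (U *\<^sub>v (A *\<^sub>v v))"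
      unfolding gpow_unitary[OF U A] using assoc_mult_mat_vec[OF c(1) A v] by simp
    also have "\<dots> = (U * gpow A k) *\<^sub>v (adjoint_mat U *\<^sub>v (U *\<^sub>v (A *\<^sub>v v)))"
      by (rule assoc_mult_mat_vec[of _ d d _ d]) (use c G Av in \<open>auto intro: mult_mat_vec_carrier\<close>)
    also have "\<dots> = U *\<^sub>v w"
      unfolding cancel[OF Av] w_def by (rule assoc_mult_mat_vec[OF c(1) G Av])
    finally have e: "gpow (U * A) k *\<^sub>v ((U * A) *\<^sub>v v) = U *\<^sub>v w" .
    have "cinner (U *\<^sub>v w) (U *\<^sub>v w) = cinner w w"
      using cinner_mult_mat_vec[OF c(1) w, of "U *\<^sub>v w"] cancel[OF w] mult_mat_vec_carrier[OF c(1) w] by simp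
    then have "(vnorm (U *\<^sub>v w))\<^sup>2 = (vnorm w)\<^sup>2" unfolding cinner_self of_real_eq_iff .
    then show ?thesis
      unfolding bilin_dev_def e w_def[symmetric] using cinner_mult_mat_vec[OF c(1) w x] by simp
  qed
  show "sign_mean d (\<lambda>\<epsilon>. bilin_dev \<zeta> k v (sign_vec d \<epsilon>) A) \<le> 3 / (real d)\<^sup>2" if A: "A \<in> carrier_mat d e" for A
  proof -
    define w where "w = gpow A k *\<^sub>v (A *\<^sub>v v)"
    have w: "w \<in> carrier_vec d"
      unfolding w_def by (rule mult_mat_vec_carrier[of _ d d]) (use A v in \<open>auto intro: mult_mat_vec_carrier\<close>)
    define a where "a = (\<lambda>i. Re (\<zeta> * w $ i))"
    define f where "f = (vnorm w)\<^sup>2"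
    have f0: "0 \<le> f" by (simp add: f_def)
    have form: "Re (\<zeta> * cinner w (sign_vec d \<epsilon>)) = (\<Sum>i<d. a i * \<epsilon> i) / sqrt (real d)" for \<epsilon>
    proof -
      have "\<zeta> * cinner w (sign_vec d \<epsilon>) = (\<Sum>i<d. (\<zeta> * w $ i) * complex_of_real (\<epsilon> i / sqrt (real d)))"
        unfolding cinner_eq_sum[OF w] sum_distrib_left
        by (intro sum.cong refl) (auto simp: sign_vec_def)
      then show ?thesis by (simp add: a_def sum_divide_distrib)
    qed
    have "sign_mean d (\<lambda>\<epsilon>. bilin_dev \<zeta> k v (sign_vec d \<epsilon>) A)
        = sign_mean d (\<lambda>\<epsilon>. (1 / ((real d)\<^sup>2 * (1 + f)\<^sup>2)) * (\<Sum>i<d. a i * \<epsilon> i) ^ 4)"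
    proof -
      have "sqrt (real d) ^ 4 = (real d)\<^sup>2" using power_mult[of "sqrt (real d)" 2 2] by simp
      then show ?thesis
        unfolding bilin_dev_def w_def[symmetric] form f_def[symmetric] by (simp add: power_divide)
    qed
    also have "\<dots> = (1 / ((real d)\<^sup>2 * (1 + f)\<^sup>2)) * sign_mean d (\<lambda>\<epsilon>. (\<Sum>i<d. a i * \<epsilon> i) ^ 4)"
      by (rule sign_mean_cmult)
    also have "\<dots> \<le> (1 / ((real d)\<^sup>2 * (1 + f)\<^sup>2)) * (3 * (\<Sum>i<d. (a i)\<^sup>2)\<^sup>2)"
      by (rule mult_left_mono[OF sign_sum_fourth_moment]) simp
    also have "\<dots> \<le> (1 / ((real d)\<^sup>2 * (1 + f)\<^sup>2)) * (3 * f\<^sup>2)"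
    proof -
      have "(a i)\<^sup>2 \<le> (cmod (w $ i))\<^sup>2" for i
      proof -
        have "\<bar>a i\<bar> \<le> cmod (w $ i)" unfolding a_def using abs_Re_le_cmod[of "\<zeta> * w $ i"] \<zeta> by (simp add: norm_mult)
        then show ?thesis by (simp add: abs_le_square_iff[symmetric])
      qed
      then have "(\<Sum>i<d. (a i)\<^sup>2) \<le> f" using w by (auto simp: f_def vnorm_sq intro!: sum_mono)
      then show ?thesis by (intro mult_left_mono power_mono sum_nonneg) auto
    qed
    also have "\<dots> = 3 / (real d)\<^sup>2 * (f / (1 + f))\<^sup>2" by (simp add: power_divide)
    also have "\<dots> \<le> 3 / (real d)\<^sup>2 * 1"
      using f0 by (intro mult_left_mono power_le_one) (auto simp: divide_le_eq_1)
    finally show ?thesis by simp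
  qed
qed

section \<open>Almost sure limits\<close>

text \<open>The expectations are summable, so the sum of the functions is almost surely finite and
  its terms tend to 0. Shifting by \<open>Suc\<close> avoids index 0, where no bound is
  given.\<close>

lemma AE_tendsto_0_of_inverse_square_bound:
  fixes f :: "nat \<Rightarrow> 'w \<Rightarrow> real"
  assumes meas: "\<And>n. n \<ge> 1 \<Longrightarrow> f n \<in> borel_measurable M" and nonneg: "\<And>n \<omega>. 0 \<le> f n \<omega>"
    and bound: "\<And>n. n \<ge> 1 \<Longrightarrow> (\<integral>\<^sup>+\<omega>. ennreal (f n \<omega>) \<partial>M) \<le> ennreal (C / (real n)\<^sup>2)" and C: "0 \<le> C"
  shows "AE \<omega> in M. (\<lambda>n. f n \<omega>) \<longlonglongrightarrow> 0"
proof -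
  have "summable (\<lambda>n. inverse ((of_nat n :: real) ^ 2))" by (rule inverse_power_summable) simp
  then have "summable (\<lambda>n. C * inverse ((of_nat (Suc n) :: real) ^ 2))"
    by (intro summable_mult) (subst summable_Suc_iff)
  then have summ: "summable (\<lambda>n. C / (real (Suc n))\<^sup>2)" by (simp only: divide_inverse)
  have m: "(\<lambda>\<omega>. ennreal (f (Suc n) \<omega>)) \<in> borel_measurable M" for n using meas[of "Suc n"] by simp
  have "(\<integral>\<^sup>+\<omega>. (\<Sum>n. ennreal (f (Suc n) \<omega>)) \<partial>M) = (\<Sum>n. \<integral>\<^sup>+\<omega>. ennreal (f (Suc n) \<omega>) \<partial>M)"
    by (rule nn_integral_suminf[OF m])
  also have "\<dots> \<le> (\<Sum>n. ennreal (C / (real (Suc n))\<^sup>2))"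
    by (rule suminf_le[OF bound summableI summableI]) simp
  also have "\<dots> = ennreal (\<Sum>n. C / (real (Suc n))\<^sup>2)"
    by (rule suminf_ennreal_eq[OF _ summable_sums[OF summ]]) (use C in simp)
  finally have "(\<integral>\<^sup>+\<omega>. (\<Sum>n. ennreal (f (Suc n) \<omega>)) \<partial>M) \<noteq> \<infinity>"
    using ennreal_less_top by (metis infinity_ennreal_def leD)
  then have "AE \<omega> in M. (\<Sum>n. ennreal (f (Suc n) \<omega>)) \<noteq> \<infinity>"
    by (intro nn_integral_PInf_AE borel_measurable_suminf_order m)
  then show ?thesis
  proof eventually_elim
    case (elim \<omega>)
    then have "summable (\<lambda>n. f (Suc n) \<omega>)" by (intro summable_suminf_not_top nonneg) (simp add: infinity_ennreal_def)
    then have "(\<lambda>n. f (Suc n) \<omega>) \<longlonglongrightarrow> 0" by (rule summable_LIMSEQ_zero)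
    then show ?case by (rule LIMSEQ_imp_Suc)
  qed
qed

text \<open>Undoes the normalisation of the deviations on a sample path, where the denominators are
  eventually bounded.\<close>

lemma tendsto_0_of_normalized_fourth_power:
  fixes a c :: "nat \<Rightarrow> real"
  assumes lim: "(\<lambda>n. a n ^ 4 / (1 + c n)\<^sup>2) \<longlonglongrightarrow> 0" and c: "\<forall>\<^sub>F n in sequentially. 0 \<le> c n \<and> c n \<le> B"
  shows "a \<longlonglongrightarrow> 0"
proof -
  have upper: "(\<lambda>n. a n ^ 4 / (1 + c n)\<^sup>2 * (1 + B)\<^sup>2) \<longlonglongrightarrow> 0" using tendsto_mult_right[OF lim, of "(1 + B)\<^sup>2"] by simp
  have le: "\<forall>\<^sub>F n in sequentially. a n ^ 4 \<le> a n ^ 4 / (1 + c n)\<^sup>2 * (1 + B)\<^sup>2"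
    using c
  proof eventually_elim
    case (elim n)
    then have "(1 + c n)\<^sup>2 \<le> (1 + B)\<^sup>2" "0 < (1 + c n)\<^sup>2" by (auto intro!: power_mono)
    then have "1 \<le> (1 + B)\<^sup>2 / (1 + c n)\<^sup>2" by simp
    then have "a n ^ 4 * 1 \<le> a n ^ 4 * ((1 + B)\<^sup>2 / (1 + c n)\<^sup>2)" by (intro mult_left_mono) auto
    then show ?case by simp
  qed
  have ge: "\<forall>\<^sub>F n in sequentially. 0 \<le> a n ^ 4" by simp
  have 4: "(\<lambda>n. a n ^ 4) \<longlonglongrightarrow> 0"
    by (rule tendsto_sandwich[OF ge le tendsto_const upper])
  show ?thesis
  proof (rule LIMSEQ_I)
    fix r :: real assume r: "0 < r"
    have "0 < r ^ 4" using r by simp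
    from LIMSEQ_D[OF 4 this] obtain N where N: "\<forall>n\<ge>N. norm (a n ^ 4 - 0) < r ^ 4" by blast
    have "\<bar>a n\<bar> < r" if "n \<ge> N" for n
    proof (rule power_less_imp_less_base)
      show "\<bar>a n\<bar> ^ 4 < r ^ 4" using N that by (simp add: power_abs)
    qed (use r in simp)
    then show "\<exists>N. \<forall>n\<ge>N. norm (a n - 0) < r" by auto
  qed
qed

subsection \<open>Invariance of the matrix and of its adjoint\<close>

text \<open>Invariance on the right becomes invariance of the adjoint on the left, because V X^H =
  (X V^H)^H.\<close>

lemma left_invariant_of_bi_invariant:
  assumes X: "measurable_mat M n m X"
    and inv: "\<And>U V. unitary_K rK n U \<Longrightarrow> unitary_K rK m V \<Longrightarrow>
        distr M (entry_space n m) (\<lambda>\<omega>. entries n m (U * X \<omega> * V)) = distr M (entry_space n m) (\<lambda>\<omega>. entries n m (X \<omega>))"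
  shows "left_invariant M rK n m X" and "left_invariant M rK m n (\<lambda>\<omega>. adjoint_mat (X \<omega>))"
proof -
  have dim: "X \<omega> \<in> carrier_mat n m" if "\<omega> \<in> space M" for \<omega> by (rule measurable_matD(1)[OF X that])
  show "left_invariant M rK n m X"
    unfolding left_invariant_def
  proof (intro conjI X allI impI)
    fix U assume U: "unitary_K rK n U"
    have "distr M (entry_space n m) (\<lambda>\<omega>. entries n m (U * X \<omega>)) = distr M (entry_space n m) (\<lambda>\<omega>. entries n m (U * X \<omega> * 1\<^sub>m m))"
      by (rule distr_cong)
        (simp_all add: right_mult_one_mat[OF mult_carrier_mat[OF unitary_carrier[OF U] dim]])
    then show "distr M (entry_space n m) (\<lambda>\<omega>. entries n m (U * X \<omega>)) = distr M (entry_space n m) (\<lambda>\<omega>. entries n m (X \<omega>))"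
      using inv[OF U unitary_one] by simp
  qed
  show "left_invariant M rK m n (\<lambda>\<omega>. adjoint_mat (X \<omega>))"
    unfolding left_invariant_def
  proof (intro conjI measurable_mat_adjoint[OF X] allI impI)
    fix V assume V: "unitary_K rK m V"
    \<comment> \<open>Conjugate transposition as a measurable map between the entry spaces; the
      equality of laws is pushed forward along it.\<close>
    define T where "T = (\<lambda>h. entries m n (adjoint_mat (mat n m h)))"
    have T: "T \<in> measurable (entry_space n m) (entry_space m n)"
      unfolding T_def by (rule measurable_entries[OF measurable_mat_adjoint[OF measurable_mat_id]])
    have T_eq: "T (entries n m A) = entries m n (adjoint_mat A)" if "A \<in> carrier_mat n m" for A
      by (simp add: T_def mat_entries[OF that])
    have push: "distr M (entry_space m n) (\<lambda>\<omega>. entries m n (adjoint_mat (Z \<omega>)))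
        = distr (distr M (entry_space n m) (\<lambda>\<omega>. entries n m (Z \<omega>))) (entry_space m n) T" if Z: "measurable_mat M n m Z" for Z
      unfolding distr_distr[OF T measurable_entries[OF Z]]
      by (rule distr_cong) (use T_eq measurable_matD(1)[OF Z] in auto)
    have V': "unitary_K rK m (adjoint_mat V)" by (rule unitary_adjoint[OF V])
    have c: "1\<^sub>m n * X \<omega> * adjoint_mat V \<in> carrier_mat n m" if "\<omega> \<in> space M" for \<omega>
      using dim[OF that] unitary_carrier[OF V'] by auto
    have mZ: "measurable_mat M n m (\<lambda>\<omega>. 1\<^sub>m n * X \<omega> * adjoint_mat V)"
      by (intro measurable_mat_mult[OF measurable_mat_mult[OF measurable_mat_const X]] measurable_mat_const)
        (use unitary_carrier[OF V'] in auto)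
    have "V * adjoint_mat (X \<omega>) = adjoint_mat (1\<^sub>m n * X \<omega> * adjoint_mat V)" if "\<omega> \<in> space M" for \<omega>
      using adjoint_mult[OF dim[OF that] unitary_carrier[OF V']] dim[OF that] by simp
    then have "distr M (entry_space m n) (\<lambda>\<omega>. entries m n (V * adjoint_mat (X \<omega>)))
        = distr M (entry_space m n) (\<lambda>\<omega>. entries m n (adjoint_mat (1\<^sub>m n * X \<omega> * adjoint_mat V)))"
      by (intro distr_cong) auto
    also have "\<dots> = distr M (entry_space m n) (\<lambda>\<omega>. entries m n (adjoint_mat (X \<omega>)))"
      unfolding push[OF mZ] push[OF X] using inv[OF unitary_one V'] by simp
    finally show "distr M (entry_space m n) (\<lambda>\<omega>. entries m n (V * adjoint_mat (X \<omega>)))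
        = distr M (entry_space m n) (\<lambda>\<omega>. entries m n (adjoint_mat (X \<omega>)))" .
  qed
qed

subsection \<open>Moments of the singular value distribution\<close>

lemma emp_sv_map_pmf:
  assumes "A \<in> carrier_mat n m" "n \<ge> 1"
  shows "emp_sv A = measure_pmf (map_pmf (sing_vals A) (pmf_of_set {..<n}))"
proof -
  have "mset (map (sing_vals A) [0..<n]) = image_mset (sing_vals A) (mset_set {..<n})"
    by (simp add: lessThan_atLeast0 mset_upt)
  then show ?thesis
    using assms map_pmf_of_set[of "{..<n}" "sing_vals A"] by (auto simp: emp_sv_def lessThan_empty_iff)
qed

lemma sing_vals_nonneg:
  assumes "A \<in> carrier_mat n m" "n \<le> m" "i < n"
  shows "0 \<le> sing_vals A i"
  using sing_vals_svd[OF assms(1,2)] is_svd_nonneg[OF _ assms(1)] assms(2,3) by auto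

lemma sing_vals_le:
  assumes "A \<in> carrier_mat n m" "n \<le> m" "i < n"
  shows "sing_vals A i \<le> sing_vals A 0"
  using sing_vals_svd[OF assms(1,2)] is_svd_decreasing[OF _ assms(1), of False _ _ _ 0 i] assms(2,3) by auto

text \<open>The distribution functions converge only at continuity points of the limit. Every
  interval (x,0) contains one because there are countably many atoms, and monotonicity does the
  rest.\<close>

lemma weak_limit_nonneg:
  assumes \<mu>: "real_distribution \<mu>" and conv: "weak_conv_m E \<mu>"
    and E: "\<And>n x. n \<ge> 1 \<Longrightarrow> x < 0 \<Longrightarrow> cdf (E n) x = 0"
  shows "AE t in \<mu>. 0 \<le> t"
proof -
  interpret real_distribution \<mu> by (rule \<mu>)
  have zero: "cdf \<mu> x = 0" if x: "x < 0" for x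
  proof -
    have "{y. \<not> isCont (cdf \<mu>) y} = {y. 0 < prob {y}}"
      using isCont_cdf measure_nonneg[of \<mu>] by (auto simp: less_le)
    then have "countable {y. \<not> isCont (cdf \<mu>) y}"
      using countable_atoms by simp
    then have "uncountable ({x<..<0} - {y. \<not> isCont (cdf \<mu>) y})"
      using uncountable_open_interval[of x 0] x by (intro uncountable_minus_countable) auto
    then have "{x<..<0} - {y. \<not> isCont (cdf \<mu>) y} \<noteq> {}" by (metis countable_empty)
    then obtain y where y: "x < y" "y < 0" "isCont (cdf \<mu>) y" by auto
    have "(\<lambda>n. cdf (E n) y) \<longlonglongrightarrow> cdf \<mu> y"
      using conv y by (auto simp: weak_conv_m_def weak_conv_def)
    moreover have "(\<lambda>n. cdf (E n) y) \<longlonglongrightarrow> 0"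
      by (rule Lim_transform_eventually[OF tendsto_const])
        (use eventually_ge_at_top[of 1] in eventually_elim, simp add: E y)
    ultimately have "cdf \<mu> y = 0" by (rule LIMSEQ_unique)
    moreover have "cdf \<mu> x \<le> cdf \<mu> y" using y by (intro cdf_nondecreasing) simp
    ultimately show ?thesis using cdf_nonneg[of x] by simp
  qed
  have "AE t in \<mu>. \<not> t \<le> - 1 / real (Suc k)" for k
  proof -
    have "prob {.. - 1 / real (Suc k)} = 0" using zero[of "- 1 / real (Suc k)"] by (simp add: cdf_def divide_neg_pos)
    then have "AE t in \<mu>. t \<notin> {.. - 1 / real (Suc k)}" by (subst (asm) prob_eq_0) auto
    then show ?thesis by simp
  qed
  then have "AE t in \<mu>. \<forall>k. \<not> t \<le> - 1 / real (Suc k)" unfolding AE_all_countable by blast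
  then show ?thesis
  proof eventually_elim
    case (elim t)
    show ?case
    proof (rule ccontr)
      assume "\<not> 0 \<le> t"
      then obtain k where "1 / real (Suc k) < - t" using nat_approx_posE[of "- t"] by auto
      then have "t \<le> - 1 / real (Suc k)" by simp
      with elim show False by blast
    qed
  qed
qed

text \<open>Weak convergence tests bounded continuous functions only, so t^(2k) is composed with
  clamping to [0,B]. As the largest singular value tends to b < B, the clamping eventually changes
  nothing.\<close>

lemma empirical_moments_tendsto:
  assumes \<mu>: "real_distribution \<mu>" and bounded: "AE t in \<mu>. 0 \<le> t \<and> t \<le> b"
    and A: "\<And>n. A n \<in> carrier_mat n (m n)" and m: "\<And>n. n \<le> m n"
    and conv: "weak_conv_m (\<lambda>n. emp_sv (A n)) \<mu>" and top: "(\<lambda>n. sing_vals (A n) 0) \<longlonglongrightarrow> b"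
  shows "(\<lambda>n. (\<Sum>i<n. sing_vals (A n) i ^ (2 * k)) / real n) \<longlonglongrightarrow> (\<integral>t. t ^ (2 * k) \<partial>\<mu>)"
proof -
  interpret real_distribution \<mu> by (rule \<mu>)
  \<comment> \<open>\<open>emp_sv\<close> carries the discrete sigma-algebra; the identity map
    pushes it to the Borel sets on which weak convergence of real distributions is stated.\<close>
  define E where "E = (\<lambda>n. distr (emp_sv (A n)) borel (\<lambda>x. x))"
  have id: "(\<lambda>x. x) \<in> measurable (emp_sv (A n)) borel" for n by (simp add: emp_sv_def)
  have E: "real_distribution (E n)" for n
    unfolding E_def real_distribution_def real_distribution_axioms_def
    using prob_space.prob_space_distr[OF _ id] by (auto simp: emp_sv_def measure_pmf.prob_space_axioms)
  have "cdf (E n) = cdf (emp_sv (A n))" for n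
    unfolding E_def cdf_def by (rule ext, subst measure_distr[OF id]) (auto simp: emp_sv_def)
  then have conv': "weak_conv_m E \<mu>" using conv by (simp add: weak_conv_m_def)
  define B where "B = max 0 b + 1"
  define f where "f = (\<lambda>t::real. min (max t 0) B ^ (2 * k))"
  have lim: "(\<lambda>n. integral\<^sup>L (E n) f) \<longlonglongrightarrow> integral\<^sup>L \<mu> f"
  proof (rule weak_conv_imp_integral_bdd_continuous_conv[OF E \<mu> conv'])
    show "isCont f x" for x unfolding f_def by (intro continuous_intros)
    show "norm (f x) \<le> B ^ (2 * k)" for x unfolding f_def by (auto simp: B_def intro!: power_mono)
  qed
  have int: "integral\<^sup>L \<mu> f = (\<integral>t. t ^ (2 * k) \<partial>\<mu>)"
  proof (rule integral_cong_AE)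
    show "f \<in> borel_measurable \<mu>" unfolding f_def by simp
    show "AE t in \<mu>. f t = t ^ (2 * k)" using bounded by eventually_elim (auto simp: f_def B_def)
  qed simp
  have ev: "\<forall>\<^sub>F n in sequentially. integral\<^sup>L (E n) f = (\<Sum>i<n. sing_vals (A n) i ^ (2 * k)) / real n"
  proof -
    have "\<forall>\<^sub>F n in sequentially. sing_vals (A n) 0 < B" by (rule order_tendstoD(2)[OF top]) (simp add: B_def)
    then show ?thesis using eventually_ge_at_top[of 1]
    proof eventually_elim
      case (elim n)
      have "integral\<^sup>L (E n) f = integral\<^sup>L (emp_sv (A n)) f"
        unfolding E_def by (subst integral_distr[OF id]) (auto simp: f_def)
      also have "\<dots> = (\<Sum>i<n. f (sing_vals (A n) i)) / real n"
        unfolding emp_sv_map_pmf[OF A elim(2)] using elim(2) by (simp add: integral_pmf_of_set lessThan_empty_iff)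
      also have "(\<Sum>i<n. f (sing_vals (A n) i)) = (\<Sum>i<n. sing_vals (A n) i ^ (2 * k))"
      proof (rule sum.cong[OF refl])
        fix i assume "i \<in> {..<n}"
        then have "0 \<le> sing_vals (A n) i" "sing_vals (A n) i \<le> sing_vals (A n) 0"
          using sing_vals_nonneg[OF A m] sing_vals_le[OF A m] by auto
        then show "f (sing_vals (A n) i) = sing_vals (A n) i ^ (2 * k)" using elim(1) by (simp add: f_def)
      qed
      finally show ?case .
    qed
  qed
  show ?thesis using Lim_transform_eventually[OF lim ev] unfolding int .
qed

lemma cdf_emp_sv_neg:
  assumes "A \<in> carrier_mat n m" "n \<le> m" "n \<ge> 1" "x < 0"
  shows "cdf (emp_sv A) x = 0"
proof -
  have "{..<n} \<inter> (sing_vals A -` {..x}) = {}"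
    using sing_vals_nonneg[OF assms(1,2)] assms(4) by fastforce
  then show ?thesis
    unfolding cdf_def emp_sv_map_pmf[OF assms(1,3)] using assms(3) by (simp add: measure_pmf_of_set lessThan_empty_iff)
qed

section \<open>From vanishing deviations to limits of the forms\<close>

lemma cinner_gpow_real:
  assumes Y: "Y \<in> carrier_mat d e" and u: "u \<in> carrier_vec d"
  shows "cinner (gpow Y k *\<^sub>v u) u = complex_of_real (Re (cinner (gpow Y k *\<^sub>v u) u))"
proof -
  have c: "gpow Y k *\<^sub>v u \<in> carrier_vec d" by (rule mult_mat_vec_carrier[OF gpow_carrier[OF Y] u])
  have "cnj (cinner (gpow Y k *\<^sub>v u) u) = cinner (gpow Y k *\<^sub>v u) u"
    using cinner_commute[OF c u] cinner_gpow_swap[OF Y u u] by simp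
  then have "cinner (gpow Y k *\<^sub>v u) u \<in> \<real>" by (simp add: Reals_cnj_iff)
  then show ?thesis by (simp add: of_real_Re)
qed

lemma trace_gpow_sing_vals:
  assumes "A \<in> carrier_mat n m" "n \<le> m" "0 < k"
  shows "Re (\<Sum>i<n. gpow A k $$ (i,i)) = (\<Sum>i<n. sing_vals A i ^ (2 * k))"
    and "Re (\<Sum>i<m. gpow (adjoint_mat A) k $$ (i,i)) = (\<Sum>i<n. sing_vals A i ^ (2 * k))"
    and "fro_sq (gpow A k) = (\<Sum>i<n. sing_vals A i ^ (4 * k))"
    and "fro_sq (gpow (adjoint_mat A) k) = (\<Sum>i<n. sing_vals A i ^ (4 * k))"
proof -
  obtain x y where svd: "is_svd False A (sing_vals A) x y" using sing_vals_svd[OF assms(1,2)] by blast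
  have svd': "is_svd False (adjoint_mat A) (sing_vals A) y x" by (rule is_svd_adjoint[OF svd])
  have A': "adjoint_mat A \<in> carrier_mat m n" using assms(1) by simp
  have q: "min n m = n" "min m n = n" using assms(2) by auto
  show "Re (\<Sum>i<n. gpow A k $$ (i,i)) = (\<Sum>i<n. sing_vals A i ^ (2 * k))"
    unfolding trace_gpow_svd[OF svd assms(1,3)] q by simp
  show "Re (\<Sum>i<m. gpow (adjoint_mat A) k $$ (i,i)) = (\<Sum>i<n. sing_vals A i ^ (2 * k))"
    unfolding trace_gpow_svd[OF svd' A' assms(3)] q by simp
  show "fro_sq (gpow A k) = (\<Sum>i<n. sing_vals A i ^ (4 * k))"
    unfolding fro_sq_gpow_svd[OF svd assms(1,3)] q ..
  show "fro_sq (gpow (adjoint_mat A) k) = (\<Sum>i<n. sing_vals A i ^ (4 * k))"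
    unfolding fro_sq_gpow_svd[OF svd' A' assms(3)] q ..
qed

lemma moment_limits_of_deviations:
  assumes em: "even_moments \<mu> b c"
    and A: "\<And>n. A n \<in> carrier_mat n (m n)" and m: "\<And>n. n \<le> m n"
    and ratio: "(\<lambda>n. real n / real (m n)) \<longlonglongrightarrow> c"
    and u: "\<And>n. n \<ge> 1 \<Longrightarrow> u n \<in> carrier_vec n" "\<And>n. n \<ge> 1 \<Longrightarrow> vnorm (u n) = 1"
    and v: "\<And>n. n \<ge> 1 \<Longrightarrow> v n \<in> carrier_vec (m n)" "\<And>n. n \<ge> 1 \<Longrightarrow> vnorm (v n) = 1"
    and conv: "weak_conv_m (\<lambda>n. emp_sv (A n)) \<mu>" and top: "(\<lambda>n. sing_vals (A n) 0) \<longlonglongrightarrow> b"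
    and dev_u: "\<And>k. (\<lambda>n. quad_dev n k (u n) (A n)) \<longlonglongrightarrow> 0"
    and dev_v: "\<And>k. (\<lambda>n. quad_dev (m n) k (v n) (adjoint_mat (A n))) \<longlonglongrightarrow> 0"
    and dev_uv: "\<And>k. (\<lambda>n. bilin_dev 1 k (v n) (u n) (A n)) \<longlonglongrightarrow> 0"
      "\<And>k. (\<lambda>n. bilin_dev (- \<i>) k (v n) (u n) (A n)) \<longlonglongrightarrow> 0"
  shows "moment_limits A m u v (even_moments.moment \<mu>) (\<lambda>k. if k = 0 then 1 else c * even_moments.moment \<mu> k) b"
proof -
  interpret even_moments \<mu> b c by (rule em)
  have mom: "(\<lambda>n. (\<Sum>i<n. sing_vals (A n) i ^ (2 * k)) / real n) \<longlonglongrightarrow> moment k" for k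
    unfolding moment_def
    by (rule empirical_moments_tendsto[OF _ bounded A m conv top]) (rule real_distribution_axioms)
  define B where "B = b + 1"
  have topB: "\<forall>\<^sub>F n in sequentially. sing_vals (A n) 0 \<le> B \<and> n \<ge> 1"
  proof -
    have "\<forall>\<^sub>F n in sequentially. sing_vals (A n) 0 < B"
      by (rule order_tendstoD(2)[OF top]) (simp add: B_def)
    then show ?thesis using eventually_ge_at_top[of 1] by eventually_elim simp
  qed
  have fro: "0 \<le> (\<Sum>i<n. sing_vals (A n) i ^ (4 * k)) \<and> (\<Sum>i<n. sing_vals (A n) i ^ (4 * k)) \<le> real n * B ^ (4 * k)"
    if "sing_vals (A n) 0 \<le> B" for n k
  proof -
    have "sing_vals (A n) i ^ (4 * k) \<le> B ^ (4 * k)" if "i < n" for i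
      using sing_vals_le[OF A m that] sing_vals_nonneg[OF A m that] \<open>sing_vals (A n) 0 \<le> B\<close> by (intro power_mono) auto
    then have "(\<Sum>i<n. sing_vals (A n) i ^ (4 * k)) \<le> (\<Sum>i<n. B ^ (4 * k))" by (intro sum_mono) auto
    moreover have "0 \<le> (\<Sum>i<n. sing_vals (A n) i ^ (4 * k))" by (rule sum_nonneg) (use sing_vals_nonneg[OF A m] in auto)
    ultimately show ?thesis by simp
  qed
  have B0: "0 \<le> B" using b_nonneg by (simp add: B_def)
  show ?thesis
  proof
    show "(\<lambda>n. cinner (gpow (A n) k *\<^sub>v u n) (u n)) \<longlonglongrightarrow> complex_of_real (moment k)" for k
    \<comment> \<open>For k = 0 the Gram power is the identity and the form is exactly 1; the trace
      formulas are for positive k.\<close>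
    proof (cases "k = 0")
      case True
      show ?thesis
        by (rule Lim_transform_eventually[OF tendsto_const])
          (use eventually_ge_at_top[of 1] in eventually_elim, use u gpow_0[OF A] in \<open>simp add: True moment_0 vnorm_eq_1_iff[symmetric]\<close>)
    next
      case False
      have "(\<lambda>n. Re (cinner (gpow (A n) k *\<^sub>v u n) (u n)) - Re (\<Sum>i<n. gpow (A n) k $$ (i,i)) / real n) \<longlonglongrightarrow> 0"
      proof (rule tendsto_0_of_normalized_fourth_power[OF dev_u[of k, unfolded quad_dev_def]])
        show "\<forall>\<^sub>F n in sequentially. 0 \<le> fro_sq (gpow (A n) k) / real n \<and> fro_sq (gpow (A n) k) / real n \<le> B ^ (4 * k)"
          using topB
        proof eventually_elim
          case (elim n)
          then show ?case using fro[of n k] False trace_gpow_sing_vals(3)[OF A m, of k n] by (simp add: divide_le_eq mult.commute)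
        qed
      qed
      then have "(\<lambda>n. Re (cinner (gpow (A n) k *\<^sub>v u n) (u n)) - (\<Sum>i<n. sing_vals (A n) i ^ (2 * k)) / real n) \<longlonglongrightarrow> 0"
        using False by (simp add: trace_gpow_sing_vals(1)[OF A m] del: Re_sum)
      from tendsto_add[OF this mom[of k]]
      have "(\<lambda>n. Re (cinner (gpow (A n) k *\<^sub>v u n) (u n))) \<longlonglongrightarrow> moment k" by simp
      from tendsto_of_real[OF this, where 'a = complex]
      show ?thesis
        by (rule Lim_transform_eventually)
          (use eventually_ge_at_top[of 1] in eventually_elim, use cinner_gpow_real[OF A u(1)] in simp)
    qed
    show "(\<lambda>n. cinner (gpow (adjoint_mat (A n)) k *\<^sub>v v n) (v n)) \<longlonglongrightarrow> complex_of_real (if k = 0 then 1 else c * moment k)" for k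
    proof (cases "k = 0")
      case True
      have A': "adjoint_mat (A n) \<in> carrier_mat (m n) n" for n using A by simp
      show ?thesis
        by (rule Lim_transform_eventually[OF tendsto_const])
          (use eventually_ge_at_top[of 1] in eventually_elim, use v gpow_0[OF A'] in \<open>simp add: True vnorm_eq_1_iff[symmetric]\<close>)
    next
      case False
      have A': "adjoint_mat (A n) \<in> carrier_mat (m n) n" for n using A by simp
      have "(\<lambda>n. Re (cinner (gpow (adjoint_mat (A n)) k *\<^sub>v v n) (v n)) - Re (\<Sum>i<m n. gpow (adjoint_mat (A n)) k $$ (i,i)) / real (m n)) \<longlonglongrightarrow> 0"
      proof (rule tendsto_0_of_normalized_fourth_power[OF dev_v[of k, unfolded quad_dev_def]])
        show "\<forall>\<^sub>F n in sequentially. 0 \<le> fro_sq (gpow (adjoint_mat (A n)) k) / real (m n) \<and> fro_sq (gpow (adjoint_mat (A n)) k) / real (m n) \<le> B ^ (4 * k)"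
          using topB
        proof eventually_elim
          case (elim n)
          have "real n * B ^ (4 * k) \<le> real (m n) * B ^ (4 * k)" using m[of n] B0 by (intro mult_right_mono) auto
          then show ?case using elim m[of n] fro[of n k] False trace_gpow_sing_vals(4)[OF A m, of k n]
            by (auto simp: divide_le_eq mult.commute)
        qed
      qed
      then have 1: "(\<lambda>n. Re (cinner (gpow (adjoint_mat (A n)) k *\<^sub>v v n) (v n)) - (\<Sum>i<n. sing_vals (A n) i ^ (2 * k)) / real (m n)) \<longlonglongrightarrow> 0"
        using False by (simp add: trace_gpow_sing_vals(2)[OF A m] del: Re_sum)
      \<comment> \<open>On the \<open>v\<close> side the trace is normalised by \<open>m n\<close>
        instead of n; this is where the weight \<open>c\<close> enters.\<close>
      have "(\<lambda>n. (real n / real (m n)) * ((\<Sum>i<n. sing_vals (A n) i ^ (2 * k)) / real n)) \<longlonglongrightarrow> c * moment k"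
        by (rule tendsto_mult[OF ratio mom])
      moreover have "\<forall>\<^sub>F n in sequentially. (real n / real (m n)) * ((\<Sum>i<n. sing_vals (A n) i ^ (2 * k)) / real n) = (\<Sum>i<n. sing_vals (A n) i ^ (2 * k)) / real (m n)"
        using eventually_ge_at_top[of 1] by eventually_elim simp
      ultimately have "(\<lambda>n. (\<Sum>i<n. sing_vals (A n) i ^ (2 * k)) / real (m n)) \<longlonglongrightarrow> c * moment k"
        by (rule Lim_transform_eventually)
      from tendsto_add[OF 1 this]
      have "(\<lambda>n. Re (cinner (gpow (adjoint_mat (A n)) k *\<^sub>v v n) (v n))) \<longlonglongrightarrow> c * moment k" by simp
      from tendsto_of_real[OF this, where 'a = complex]
      have "(\<lambda>n. cinner (gpow (adjoint_mat (A n)) k *\<^sub>v v n) (v n)) \<longlonglongrightarrow> complex_of_real (c * moment k)"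
        by (rule Lim_transform_eventually)
          (use eventually_ge_at_top[of 1] in eventually_elim, use cinner_gpow_real[OF A' v(1)] in simp)
      then show ?thesis using False by simp
    qed
    show "(\<lambda>n. cinner (gpow (A n) k *\<^sub>v (A n *\<^sub>v v n)) (u n)) \<longlonglongrightarrow> 0" for k
    proof -
      \<comment> \<open>The operator norm bounds the denominator of \<open>bilin_dev\<close>, the
        same one for the real and the imaginary part.\<close>
      have bdd: "\<forall>\<^sub>F n in sequentially. 0 \<le> (vnorm (gpow (A n) k *\<^sub>v (A n *\<^sub>v v n)))\<^sup>2 \<and> (vnorm (gpow (A n) k *\<^sub>v (A n *\<^sub>v v n)))\<^sup>2 \<le> (B ^ (2 * k) * B)\<^sup>2"
        using topB
      proof eventually_elim
        case (elim n)
        then have n: "n \<ge> 1" "0 < n" "0 < m n" using m[of n] by auto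
        obtain x y where svd: "is_svd False (A n) (sing_vals (A n)) x y" using sing_vals_svd[OF A m] by blast
        have s0: "0 \<le> sing_vals (A n) 0" using sing_vals_nonneg[OF A m n(2)] .
        have "vnorm (gpow (A n) k *\<^sub>v (A n *\<^sub>v v n)) \<le> sing_vals (A n) 0 ^ (2 * k) * vnorm (A n *\<^sub>v v n)"
          by (rule vnorm_gpow_le[OF svd A n(2,3) mult_mat_vec_carrier[OF A v(1)[OF n(1)]]])
        also have "\<dots> \<le> sing_vals (A n) 0 ^ (2 * k) * (sing_vals (A n) 0 * vnorm (v n))"
          using s0 by (intro mult_left_mono svd_op_bound[OF svd A v(1)[OF n(1)] n(2,3)]) auto
        also have "\<dots> \<le> B ^ (2 * k) * B"
          using elim s0 v(2)[OF n(1)] by (auto intro!: mult_mono power_mono)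
        finally show ?case by (auto intro!: power_mono)
      qed
      have re: "(\<lambda>n. Re (1 * cinner (gpow (A n) k *\<^sub>v (A n *\<^sub>v v n)) (u n))) \<longlonglongrightarrow> 0"
        by (rule tendsto_0_of_normalized_fourth_power[OF dev_uv(1)[of k, unfolded bilin_dev_def] bdd])
      have im: "(\<lambda>n. Re (- \<i> * cinner (gpow (A n) k *\<^sub>v (A n *\<^sub>v v n)) (u n))) \<longlonglongrightarrow> 0"
        by (rule tendsto_0_of_normalized_fourth_power[OF dev_uv(2)[of k, unfolded bilin_dev_def] bdd])
      show ?thesis using re im by (simp add: tendsto_complex_iff)
    qed
    show "0 \<le> (if k = 0 then 1 else c * moment k)" for k using moment_nonneg c by simp
  qed (use A m u v top moment_nonneg moment_0 in auto)
qed

section \<open>Almost sure limits of the optimal weight and of both errors\<close>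

theorem theorem2p3:
  fixes M :: "'w measure" and realK :: bool
    and m :: "nat \<Rightarrow> nat" and c :: real
    and X :: "nat \<Rightarrow> 'w \<Rightarrow> complex mat"
    and \<mu>X :: "real measure" and a b :: real
    and \<theta> :: real and u v :: "nat \<Rightarrow> complex vec"
    and sh :: "nat \<Rightarrow> 'w \<Rightarrow> nat \<Rightarrow> real"
    and uh vh :: "nat \<Rightarrow> 'w \<Rightarrow> nat \<Rightarrow> complex vec"
  defines "S \<equiv> (\<lambda>n. complex_of_real \<theta> \<cdot>\<^sub>m outer (u n) (v n))"
  defines "Xt \<equiv> (\<lambda>n \<omega>. S n + X n \<omega>)"
  defines "\<rho> \<equiv> D_inv c \<mu>X b (1 / \<theta>\<^sup>2)"
  defines "supercrit \<equiv> inverse (D_at_b c \<mu>X b) < ereal (\<theta>\<^sup>2)"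
  assumes M: "prob_space M"
    and m_ge: "\<And>n. n \<le> m n"
    and ratio: "(\<lambda>n. real n / real (m n)) \<longlonglongrightarrow> c"
    and X_dim: "\<And>n \<omega>. \<omega> \<in> space M \<Longrightarrow> X n \<omega> \<in> carrier_mat n (m n)"
    and X_real: "\<And>n \<omega>. realK \<Longrightarrow> \<omega> \<in> space M \<Longrightarrow> real_mat (X n \<omega>)"
    and X_meas: "\<And>n i j. i < n \<Longrightarrow> j < m n \<Longrightarrow> (\<lambda>\<omega>. X n \<omega> $$ (i,j)) \<in> borel_measurable M"
    and X_inv: "\<And>n U V. unitary_K realK n U \<Longrightarrow> unitary_K realK (m n) V \<Longrightarrow>
        distr M (PiM ({..<n} \<times> {..<m n}) (\<lambda>_. borel))
             (\<lambda>\<omega>. restrict (\<lambda>(i,j). (U * X n \<omega> * V) $$ (i,j)) ({..<n} \<times> {..<m n}))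
      = distr M (PiM ({..<n} \<times> {..<m n}) (\<lambda>_. borel))
             (\<lambda>\<omega>. restrict (\<lambda>(i,j). X n \<omega> $$ (i,j)) ({..<n} \<times> {..<m n}))"
    and muX: "real_distribution \<mu>X"
    and ab: "a \<le> b"
    and supp: "measure \<mu>X {a..b} = 1"
    and b_endpoint: "\<And>\<epsilon>. \<epsilon> > 0 \<Longrightarrow> measure \<mu>X {b - \<epsilon><..} > 0"
    and esd: "AE \<omega> in M. weak_conv_m (\<lambda>n. emp_sv (X n \<omega>)) \<mu>X"
    and top_sv: "AE \<omega> in M. (\<lambda>n. sing_vals (X n \<omega>) 0) \<longlonglongrightarrow> b"
    and theta_pos: "\<theta> > 0"
    and u_unit: "\<And>n. n \<ge> 1 \<Longrightarrow> u n \<in> carrier_vec n \<and> cinner (u n) (u n) = 1"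
    and v_unit: "\<And>n. n \<ge> 1 \<Longrightarrow> v n \<in> carrier_vec (m n) \<and> cinner (v n) (v n) = 1"
    and uv_real: "\<And>n. realK \<Longrightarrow> real_vec (u n) \<and> real_vec (v n)"
    and Dprime: "filterlim (deriv (D_tr c \<mu>X)) at_bot (at_right b)"
    and svd: "\<And>n \<omega>. n \<ge> 1 \<Longrightarrow> \<omega> \<in> space M \<Longrightarrow>
        is_svd realK (Xt n \<omega>) (sh n \<omega>) (uh n \<omega>) (vh n \<omega>)"
  shows "AE \<omega> in M.
      (\<lambda>n. wopt1 (S n) (uh n \<omega> 0) (vh n \<omega> 0))
         \<longlonglongrightarrow> (if supercrit then -2 / (\<theta>\<^sup>2 * deriv (D_tr c \<mu>X) \<rho>) else 0)
    \<and> (\<lambda>n. mse1 (S n) (uh n \<omega> 0) (vh n \<omega> 0) (wopt1 (S n) (uh n \<omega> 0) (vh n \<omega> 0)))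
         \<longlonglongrightarrow> (if supercrit then \<theta>\<^sup>2 - 4 / (\<theta>\<^sup>2 * deriv (D_tr c \<mu>X) \<rho>)\<^sup>2 else \<theta>\<^sup>2)
    \<and> (\<lambda>n. mse1 (S n) (uh n \<omega> 0) (vh n \<omega> 0) (sh n \<omega> 0))
         \<longlonglongrightarrow> (if supercrit then \<theta>\<^sup>2 + \<rho>\<^sup>2 + 4 * \<rho> / (\<theta>\<^sup>2 * deriv (D_tr c \<mu>X) \<rho>)
             else \<theta>\<^sup>2 + b\<^sup>2)"
proof -
  interpret prob_space M by (rule M)
  have mX: "measurable_mat M n (m n) (X n)" for n
    using X_dim X_meas by (auto simp: measurable_mat_def)
  have inv: "left_invariant M realK n (m n) (X n)"
    "left_invariant M realK (m n) n (\<lambda>\<omega>. adjoint_mat (X n \<omega>))" for n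
    by (rule left_invariant_of_bi_invariant[OF mX X_inv[folded entries_def]]; assumption)+
  have u: "u n \<in> carrier_vec n" "vnorm (u n) = 1" and v: "v n \<in> carrier_vec (m n)" "vnorm (v n) = 1" if "n \<ge> 1" for n
    using u_unit[OF that] v_unit[OF that] by (auto simp: vnorm_eq_1_iff)
  have m_pos: "0 < m n" if "n \<ge> 1" for n using m_ge[of n] that by simp
  have c: "0 \<le> c" "c \<le> 1"
  proof -
    show "0 \<le> c" by (rule LIMSEQ_le_const[OF ratio]) auto
    have "real n / real (m n) \<le> 1" for n using m_ge[of n] by (cases "m n = 0") (auto simp: divide_le_eq_1)
    then show "c \<le> 1" by (intro LIMSEQ_le_const2[OF ratio]) auto
  qed
  have dev_u: "AE \<omega> in M. \<forall>k. (\<lambda>n. quad_dev n k (u n) (X n \<omega>)) \<longlonglongrightarrow> 0"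
    unfolding AE_all_countable
  proof
    fix k show "AE \<omega> in M. (\<lambda>n. quad_dev n k (u n) (X n \<omega>)) \<longlonglongrightarrow> 0"
    proof (rule AE_tendsto_0_of_inverse_square_bound[where C = 108])
      fix n :: nat assume n: "n \<ge> 1"
      show "(\<lambda>\<omega>. quad_dev n k (u n) (X n \<omega>)) \<in> borel_measurable M"
        by (rule measurable_quad_dev[OF mX u(1)[OF n]])
      show "(\<integral>\<^sup>+\<omega>. ennreal (quad_dev n k (u n) (X n \<omega>)) \<partial>M) \<le> ennreal (108 / (real n)\<^sup>2)"
        by (rule quad_dev_bound[OF M inv(1) _ u[OF n]]) (use n uv_real in auto)
    qed (auto simp: quad_dev_def)
  qed
  have dev_v: "AE \<omega> in M. \<forall>k. (\<lambda>n. quad_dev (m n) k (v n) (adjoint_mat (X n \<omega>))) \<longlonglongrightarrow> 0"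
    unfolding AE_all_countable
  proof
    fix k show "AE \<omega> in M. (\<lambda>n. quad_dev (m n) k (v n) (adjoint_mat (X n \<omega>))) \<longlonglongrightarrow> 0"
    proof (rule AE_tendsto_0_of_inverse_square_bound[where C = 108])
      fix n :: nat assume n: "n \<ge> 1"
      show "(\<lambda>\<omega>. quad_dev (m n) k (v n) (adjoint_mat (X n \<omega>))) \<in> borel_measurable M"
        by (rule measurable_quad_dev[OF measurable_mat_adjoint[OF mX] v(1)[OF n]])
      have "(\<integral>\<^sup>+\<omega>. ennreal (quad_dev (m n) k (v n) (adjoint_mat (X n \<omega>))) \<partial>M) \<le> ennreal (108 / (real (m n))\<^sup>2)"
        by (rule quad_dev_bound[OF M inv(2) m_pos[OF n] v[OF n]]) (use uv_real in auto)
      \<comment> \<open>The dimension on this side is \<open>m n\<close>; n <= \<open>m n\<close>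
        turns the bound into one that is summable in n.\<close>
      also have "\<dots> \<le> ennreal (108 / (real n)\<^sup>2)"
        using n m_ge[of n] by (intro ennreal_leI divide_left_mono power_mono) auto
      finally show "(\<integral>\<^sup>+\<omega>. ennreal (quad_dev (m n) k (v n) (adjoint_mat (X n \<omega>))) \<partial>M) \<le> ennreal (108 / (real n)\<^sup>2)" .
    qed (auto simp: quad_dev_def)
  qed
  have dev_uv: "AE \<omega> in M. \<forall>k. (\<lambda>n. bilin_dev \<zeta> k (v n) (u n) (X n \<omega>)) \<longlonglongrightarrow> 0" if \<zeta>: "cmod \<zeta> = 1" for \<zeta>
    unfolding AE_all_countable
  proof
    fix k show "AE \<omega> in M. (\<lambda>n. bilin_dev \<zeta> k (v n) (u n) (X n \<omega>)) \<longlonglongrightarrow> 0"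
    proof (rule AE_tendsto_0_of_inverse_square_bound[where C = 3])
      fix n :: nat assume n: "n \<ge> 1"
      show "(\<lambda>\<omega>. bilin_dev \<zeta> k (v n) (u n) (X n \<omega>)) \<in> borel_measurable M"
        by (rule measurable_bilin_dev[OF mX v(1)[OF n]])
      show "(\<integral>\<^sup>+\<omega>. ennreal (bilin_dev \<zeta> k (v n) (u n) (X n \<omega>)) \<partial>M) \<le> ennreal (3 / (real n)\<^sup>2)"
        by (rule bilin_dev_bound[OF M inv(1) _ u[OF n] _ v(1)[OF n] \<zeta>]) (use n uv_real in auto)
    qed (auto simp: bilin_dev_def)
  qed
  have "cmod 1 = 1" "cmod (- \<i>) = 1" by auto
  note dev_re = dev_uv[OF this(1)] and dev_im = dev_uv[OF this(2)]
  have space: "AE \<omega> in M. \<omega> \<in> space M" by (rule AE_space)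
  show ?thesis
    using space esd top_sv dev_u dev_v dev_re dev_im
  proof eventually_elim
    case (elim \<omega>)
    \<comment> \<open>With \<omega> fixed, the choice of singular vectors at each n may be
      arbitrary.\<close>
    define A where "A = (\<lambda>n. X n \<omega>)"
    have A: "A n \<in> carrier_mat n (m n)" for n unfolding A_def by (rule X_dim[OF elim(1)])
    have conv: "weak_conv_m (\<lambda>n. emp_sv (A n)) \<mu>X" and top: "(\<lambda>n. sing_vals (A n) 0) \<longlonglongrightarrow> b"
      using elim(2,3) by (auto simp: A_def)
    have b0: "0 \<le> b"
    proof (rule LIMSEQ_le_const[OF top], intro exI[of _ 1] allI impI)
      fix n :: nat assume "1 \<le> n"
      then show "0 \<le> sing_vals (A n) 0" by (intro sing_vals_nonneg[OF A m_ge]) simp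
    qed
    interpret \<mu>: real_distribution \<mu>X by (rule muX)
    have "AE t in \<mu>X. 0 \<le> t" by (rule weak_limit_nonneg[OF muX conv]) (rule cdf_emp_sv_neg[OF A m_ge])
    moreover have "AE t in \<mu>X. t \<in> {a..b}" by (rule \<mu>.AE_prob_1[OF supp])
    ultimately have bounded: "AE t in \<mu>X. 0 \<le> t \<and> t \<le> b" by eventually_elim simp
    have em: "even_moments \<mu>X b c"
      unfolding even_moments_def even_moments_axioms_def using muX bounded b0 c by simp
    have ml: "moment_limits A m u v (even_moments.moment \<mu>X) (\<lambda>k. if k = 0 then 1 else c * even_moments.moment \<mu>X k) b"
      by (rule moment_limits_of_deviations[OF em A m_ge ratio u v conv top]) (use elim in \<open>auto simp: A_def\<close>)
    interpret D: spike_transform "D_tr c \<mu>X" b by (rule even_moments.spike_transform_D[OF em Dprime])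
    have sv: "is_svd realK (spiked (A n) \<theta> (u n) (v n)) (sh n \<omega>) (uh n \<omega>) (vh n \<omega>)" if "n \<ge> 1" for n
      using svd[OF that elim(1)] by (simp add: spiked_def A_def Xt_def S_def)
    define \<tau> where "\<tau> = (\<lambda>n. \<theta> * Re (cinner (vh n \<omega> 0) (v n) * cinner (u n) (uh n \<omega> 0)))"
    define L where "L = (if D.super \<theta> then - 2 / (\<theta>\<^sup>2 * deriv (D_tr c \<mu>X) (D.G \<theta>)) else 0)"
    have s_lim: "(\<lambda>n. sh n \<omega> 0) \<longlonglongrightarrow> D.G \<theta>" and \<tau>_lim: "\<tau> \<longlonglongrightarrow> L"
      using top_value_and_overlap_limits[OF em ml Dprime theta_pos sv] by (auto simp: \<tau>_def L_def)
    \<comment> \<open>The optimal weight is the positive part of \<open>\<tau> n\<close>, so its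
      limit is \<open>L\<close> only because \<open>L\<close> is nonnegative.\<close>
    have L0: "0 \<le> L"
      using D.deriv_neg[OF D.G_super(1)] theta_pos
      by (simp add: L_def divide_nonpos_nonpos mult_nonneg_nonpos less_imp_le)
    have super: "supercrit \<longleftrightarrow> D.super \<theta>"
      unfolding supercrit_def D_at_b_def by (rule D.Lim_at_b[OF theta_pos])
    have \<rho>: "D.G \<theta> = \<rho>" if "D.super \<theta>"
      using that by (simp add: D.G_def \<rho>_def D_inv_def)
    have Gb: "D.G \<theta> = b" if "\<not> D.super \<theta>" using that by (simp add: D.G_def)
    have mse: "mse1 (S n) (uh n \<omega> 0) (vh n \<omega> 0) w = \<theta>\<^sup>2 - 2 * w * \<tau> n + w\<^sup>2" if n: "n \<ge> 1" for n w
      using mse1_quadratic[OF u[OF n] v[OF n] moment_limits.top_singular_vectors(2-5)[OF ml sv[OF n] n], of \<theta> w]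
      by (simp add: S_def \<tau>_def)
    have wopt: "wopt1 (S n) (uh n \<omega> 0) (vh n \<omega> 0) = max 0 (\<tau> n)" if n: "n \<ge> 1" for n
      by (rule wopt1_eq[OF mse[OF n]])
    have ev: "\<forall>\<^sub>F n in sequentially. n \<ge> (1::nat)" by (rule eventually_ge_at_top)
    have max_lim: "(\<lambda>n. max 0 (\<tau> n)) \<longlonglongrightarrow> L"
      using tendsto_max[OF tendsto_const \<tau>_lim, of 0] L0 by (simp add: max_absorb2)
    have w_lim: "(\<lambda>n. wopt1 (S n) (uh n \<omega> 0) (vh n \<omega> 0)) \<longlonglongrightarrow> L"
      by (rule Lim_transform_eventually[OF max_lim]) (use ev in eventually_elim, simp add: wopt)
    have "(\<lambda>n. \<theta>\<^sup>2 - 2 * max 0 (\<tau> n) * \<tau> n + (max 0 (\<tau> n))\<^sup>2) \<longlonglongrightarrow> \<theta>\<^sup>2 - 2 * L * L + L\<^sup>2"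
      by (intro tendsto_intros max_lim \<tau>_lim)
    then have opt_lim: "(\<lambda>n. mse1 (S n) (uh n \<omega> 0) (vh n \<omega> 0) (wopt1 (S n) (uh n \<omega> 0) (vh n \<omega> 0))) \<longlonglongrightarrow> \<theta>\<^sup>2 - 2 * L * L + L\<^sup>2"
      by (rule Lim_transform_eventually) (use ev in eventually_elim, simp add: wopt mse)
    have "(\<lambda>n. \<theta>\<^sup>2 - 2 * sh n \<omega> 0 * \<tau> n + (sh n \<omega> 0)\<^sup>2) \<longlonglongrightarrow> \<theta>\<^sup>2 - 2 * D.G \<theta> * L + (D.G \<theta>)\<^sup>2"
      by (intro tendsto_intros s_lim \<tau>_lim)
    then have eym_lim: "(\<lambda>n. mse1 (S n) (uh n \<omega> 0) (vh n \<omega> 0) (sh n \<omega> 0)) \<longlonglongrightarrow> \<theta>\<^sup>2 - 2 * D.G \<theta> * L + (D.G \<theta>)\<^sup>2"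
      by (rule Lim_transform_eventually) (use ev in eventually_elim, simp add: mse)
    have 1: "L = (if supercrit then -2 / (\<theta>\<^sup>2 * deriv (D_tr c \<mu>X) \<rho>) else 0)"
      using \<rho> by (simp add: L_def super)
    have 2: "\<theta>\<^sup>2 - 2 * L * L + L\<^sup>2 = (if supercrit then \<theta>\<^sup>2 - 4 / (\<theta>\<^sup>2 * deriv (D_tr c \<mu>X) \<rho>)\<^sup>2 else \<theta>\<^sup>2)"
    proof -
      have e: "\<theta>\<^sup>2 - 2 * L * L + L\<^sup>2 = \<theta>\<^sup>2 - L\<^sup>2" by (simp add: power2_eq_square)
      have sq: "L\<^sup>2 = (if supercrit then 4 / (\<theta>\<^sup>2 * deriv (D_tr c \<mu>X) \<rho>)\<^sup>2 else 0)"
        by (cases supercrit) (simp_all add: 1 power_divide)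
      show ?thesis by (rule trans[OF e]) (simp add: sq)
    qed
    have 3: "\<theta>\<^sup>2 - 2 * D.G \<theta> * L + (D.G \<theta>)\<^sup>2
        = (if supercrit then \<theta>\<^sup>2 + \<rho>\<^sup>2 + 4 * \<rho> / (\<theta>\<^sup>2 * deriv (D_tr c \<mu>X) \<rho>) else \<theta>\<^sup>2 + b\<^sup>2)"
      using \<rho> Gb by (simp add: 1 super)
    show ?case
      using w_lim opt_lim eym_lim unfolding 2 3 unfolding 1 by blast
  qed
qed

end
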